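(* Let $\mathbb A$ be an admissible set in which $\omega$ is realizable. Let $G$ be a recursively presented Polish group, $X$ a recursively presented Polish $G$-space and $x\in X$, such that $G$, the $G$-action on $X$, and $x$ are codable in $\mathbb A$. Let $y\in X$ be any point such that $x$ and $y$ are in the same $G$-invariant Borel subsets of $X$ having Borel codes belonging to $\mathbb A$ (i.e. $x\in B\iff y\in B$ for each such $B$). Then for every $\alpha\le o(\mathbb A)$, $x$ and $y$ are in the same $G$-invariant Borel subsets of $X$ of Borel rank $\alpha$.
   Context: A Polish $G$-space is a Polish space $X$ with a continuous action of a Polish group $G$. A set $B\subseteq X$ is invariant if $gB=B$ for all $g\in G$. Borel rank refers to the usual (boldface) Borel hierarchy $\mathbf\Sigma^0_\alpha,\mathbf\Pi^0_\alpha$, $1\le\alpha<\omega_1$: sets of Borel rank $\alpha$ are those in $\mathbf\Sigma^0_\alpha\cup\mathbf\Pi^0_\alpha$. Recursive presentations. A Polish space with compatible complete metric $d$ is recursively presented if it is equipped with a dense sequence $\{r_i:i\in\omega\}$ such that the relations (in $i,j,k,m$) $d(r_i,r_j)\le\frac{m}{k+1}$ and $d(r_i,r_j)<\frac{m}{k+1}$ are recursive. The canonical basis consists of the (nonempty) open balls $\{x:d(x,r_i)<\frac{m}{k+1}\}$, $m\ge1$, enumerated effectively; $\{U_n:n\in\omega\}$ is such an enumeration for $X$ and $\{V_n:n\in\omega\}$ one for $G$, where additionally $V_0=G$. Admissible sets. An admissible set $\mathbb A$ is a transitive model of KPU (Kripke–Platek set theory with urelements, in the sense of Barwise), regarded as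 a two-sorted structure in a language $L$ containing $\emptyset,\in$, where one sort corresponds to urelements (which usually form a relational first-order structure for the remaining symbols of $L$); $\mathbb A$ is assumed to satisfy KPU with respect to all formulas of $L$. $o(\mathbb A)$ is the least ordinal not in $\mathbb A$. We say $\omega$ is realizable in $\mathbb A$ if $\mathbb A$ contains a copy of the structure $\langle\omega,<\rangle$ as an element; this copy (possibly a set of urelements) is identified with $\omega$, and statements that subsets of $\omega^k$ or functions $\omega\to\omega$ belong to $\mathbb A$ are meant with respect to this copy. Codability. (1) $x\in X$ is codable in $\mathbb A$ if $r_x=\{n:x\in U_n\}\in\mathbb A$. (2) $G$ is codable in $\mathbb A$ if the relations $r_o=\{(k,l,n):V_kV_l\subseteq V_n\}$ and $r_i=\{(k,l):V_k^{-1}\subseteq V_l\}$ are in $\mathbb A$. (3) The $G$-action on $X$ is codable in $\mathbb A$ if $r_a=\{(k,i,j):V_kU_i\subseteq U_j\}$ is in $\mathbb A$. Borel codes (as in Moschovakis, Descriptive Set Theory, Ch. 7). Let $\mathcal N=\omega^\omega$, and let $P\subseteq\mathcal N\times\omega\times\omega$ be a fixed good (semirecursive) parametrization of the subsets of $\omega\times\omega$, e.g. $P=\{(\varepsilon,n,s):\exists i\ \varepsilon(i)=\langle n,s\rangle+1\}$ for a recursive pairing bijection $\langle\cdot,\cdot\rangle$. Let $\{N_s\}$ be the canonical basis of $\mathcal N$. For $\varepsilon\in\mathcal N$ and $n\in\omega$ write $\{\varepsilon\}(n)\downarrow=\beta$ if $\beta\in\mathcal N$ satisfies $\{s:\beta\in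 N_s\}=\{s:(\varepsilon,n,s)\in P\}$ (such $\beta$ is unique if it exists). For $\alpha\in\mathcal N$ put $\alpha^*(n)=\alpha(n+1)$. Define $BC_1=\{\alpha:\alpha(0)=0\}$ and, for countable $\xi>1$, $$BC_\xi=\bigcup_{\eta<\xi}BC_\eta\cup\{\alpha:\alpha(0)=1\text{ and for all }n,\ \{\alpha^*\}(n)\downarrow\in\bigcup_{\eta<\xi}BC_\eta\},$$ and $BC=\bigcup_{\xi<\omega_1}BC_\xi$. The coding map $\pi:BC\to \mathrm{Borel}(X)$ is defined by $\pi(\alpha)=\bigcup\{U_{m}: \alpha^*(n)=m+1\text{ for some }n\}$ if $\alpha(0)=0$, and $\pi(\alpha)=\bigcup_n\big(X\setminus\pi(\{\alpha^*\}(n))\big)$ if $\alpha(0)=1$; $\pi$ maps $BC_\xi$ onto $\mathbf\Sigma^0_\xi(X)$. An $\alpha\in BC$ is a Borel code of $A\subseteq X$ if $\pi(\alpha)=A$. *)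

theory Defs
  imports "HOL-Analysis.Analysis" "HOL-Library.Nat_Bijection" "HOL-Library.Countable_Set_Type"
begin

section \<open>Countable ordinals\<close>

text \<open>
  The type of all countable ordinals: \<^term>\<open>cardSuc natLeq\<close> is a well-order of type omega_1.
  An element \<open>\<alpha>\<close> stands for the order type of \<open>{..<\<alpha>}\<close>.
\<close>

typedef omega1 = "Field (cardSuc natLeq)"
proof -
  have "infinite (Field (cardSuc natLeq))"
    by (simp add: cardSuc_finite[OF natLeq_Card_order] Field_natLeq)
  then show ?thesis
    by (metis ex_in_conv finite.emptyI)
qed

lemma Well_order_cardSuc_natLeq: "Well_order (cardSuc natLeq)"
  by (rule cardSuc_Well_order[OF natLeq_Card_order])

instantiation omega1 :: wellorder
begin

definition less_eq_omega1 :: "omega1 \<Rightarrow> omega1 \<Rightarrow> bool" where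
  "\<alpha> \<le> \<beta> \<longleftrightarrow> (Rep_omega1 \<alpha>, Rep_omega1 \<beta>) \<in> cardSuc natLeq"

definition less_omega1 :: "omega1 \<Rightarrow> omega1 \<Rightarrow> bool" where
  "\<alpha> < \<beta> \<longleftrightarrow> \<alpha> \<le> \<beta> \<and> \<alpha> \<noteq> (\<beta> :: omega1)"

instance
proof -
  let ?r = "cardSuc natLeq"
  have wo: "wo_rel ?r"
    using Well_order_cardSuc_natLeq by (simp add: wo_rel_def)
  have refl: "\<alpha> \<le> \<alpha>" for \<alpha> :: omega1
    using wo_rel.REFL[OF wo] Rep_omega1[of \<alpha>] unfolding less_eq_omega1_def refl_on_def by blast
  have anti: "\<alpha> = \<beta>" if "\<alpha> \<le> \<beta>" "\<beta> \<le> \<alpha>" for \<alpha> \<beta> :: omega1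
    using that wo_rel.ANTISYM[OF wo] unfolding less_eq_omega1_def antisym_def
    by (metis Rep_omega1_inject)
  show "OFCLASS(omega1, wellorder_class)"
  proof
    fix \<alpha> \<beta> \<gamma> :: omega1
    show "\<alpha> < \<beta> \<longleftrightarrow> \<alpha> \<le> \<beta> \<and> \<not> \<beta> \<le> \<alpha>"
      using anti refl unfolding less_omega1_def by metis
    show "\<alpha> \<le> \<alpha>"
      by (rule refl)
    show "\<alpha> \<le> \<beta> \<Longrightarrow> \<beta> \<le> \<gamma> \<Longrightarrow> \<alpha> \<le> \<gamma>"
      using wo_rel.TRANS[OF wo] unfolding less_eq_omega1_def by (rule transD)
    show "\<alpha> \<le> \<beta> \<Longrightarrow> \<beta> \<le> \<alpha> \<Longrightarrow> \<alpha> = \<beta>"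
      by (rule anti)
    show "\<alpha> \<le> \<beta> \<or> \<beta> \<le> \<alpha>"
      using wo_rel.TOTALS[OF wo] Rep_omega1[of \<alpha>] Rep_omega1[of \<beta>]
      unfolding less_eq_omega1_def by blast
  next
    fix P :: "omega1 \<Rightarrow> bool" and \<alpha>
    assume step: "\<And>\<alpha>. (\<And>\<beta>. \<beta> < \<alpha> \<Longrightarrow> P \<beta>) \<Longrightarrow> P \<alpha>"
    have "wf (inv_image (?r - Id) Rep_omega1)"
      using Well_order_cardSuc_natLeq by (simp add: well_order_on_def wf_inv_image)
    then show "P \<alpha>"
    proof (induction \<alpha> rule: wf_induct_rule)
      case (less \<alpha>)
      show ?case
        by (rule step, rule less)
          (auto simp: less_omega1_def less_eq_omega1_def Rep_omega1_inject)
    qed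
  qed
qed

end

instantiation omega1 :: "{zero, one}"
begin

definition zero_omega1 :: omega1 where "0 = (LEAST \<alpha> :: omega1. True)"
definition one_omega1 :: omega1 where "1 = (LEAST \<alpha> :: omega1. 0 < \<alpha>)"

instance ..

end

lemma countable_lessThan_omega1: "countable {..<\<alpha> :: omega1}"
proof -
  let ?r = "cardSuc natLeq"
  let ?S = "underS ?r (Rep_omega1 \<alpha>)"
  have "(card_of ?S, ?r) \<in> ordLess"
    by (rule card_of_underS[OF cardSuc_Card_order[OF natLeq_Card_order] Rep_omega1])
  then have "(card_of ?S, natLeq) \<in> ordLeq"
    using cardSuc_ordLess_ordLeq[OF natLeq_Card_order card_of_Card_order]
      cardSuc_ordLeq_ordLess[OF natLeq_Card_order card_of_Card_order] by auto
  then have "countable ?S"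
    by (simp add: countable_card_le_natLeq)
  moreover have "Rep_omega1 ` {..<\<alpha>} \<subseteq> ?S"
    by (auto simp: underS_def less_omega1_def less_eq_omega1_def Rep_omega1_inject)
  ultimately have "countable (Rep_omega1 ` {..<\<alpha>})"
    by (rule countable_subset[rotated])
  then show ?thesis
    by (rule countable_image_inj_on) (auto simp: inj_on_def Rep_omega1_inject)
qed

lemma uncountable_UNIV_omega1: "uncountable (UNIV :: omega1 set)"
proof
  assume "countable (UNIV :: omega1 set)"
  then have "countable (range Rep_omega1)"
    by simp
  then have "(card_of (Field (cardSuc natLeq)), natLeq) \<in> ordLeq"
    by (simp add: countable_card_le_natLeq type_definition.Rep_range[OF type_definition_omega1])
  moreover have "(card_of (Field (cardSuc natLeq)), cardSuc natLeq) \<in> ordIso"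
    by (rule card_of_Field_ordIso[OF cardSuc_Card_order[OF natLeq_Card_order]])
  ultimately show False
    using cardSuc_greater[OF natLeq_Card_order]
    using not_ordLess_ordLeq ordIso_ordLeq_trans ordIso_symmetric by blast
qed


section \<open>Recursive relations\<close>

text \<open>
  Total recursive functions of \<open>n\<close> arguments, i.e. the closure of the initial functions under
  composition, primitive recursion and minimisation of regular functions. Arguments are passed as
  lists; the values on lists whose length differs from \<open>n\<close> are irrelevant.
\<close>

inductive recursive_fun :: "nat \<Rightarrow> (nat list \<Rightarrow> nat) \<Rightarrow> bool" where
  Zero: "recursive_fun n (\<lambda>_. 0)"
| Succ: "recursive_fun 1 (\<lambda>xs. Suc (xs ! 0))"
| Proj: "i < n \<Longrightarrow> recursive_fun n (\<lambda>xs. xs ! i)"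
| Comp: "recursive_fun (length gs) f \<Longrightarrow> \<forall>g\<in>set gs. recursive_fun n g \<Longrightarrow>
    recursive_fun n (\<lambda>xs. f (map (\<lambda>g. g xs) gs))"
| Prim: "recursive_fun n f \<Longrightarrow> recursive_fun (n + 2) g \<Longrightarrow>
    recursive_fun (n + 1)
      (\<lambda>xs. rec_nat (f (tl xs)) (\<lambda>k v. g (k # v # tl xs)) (hd xs))"
| Min: "recursive_fun (n + 1) f \<Longrightarrow> \<forall>xs. length xs = n \<longrightarrow> (\<exists>k. f (k # xs) = 0) \<Longrightarrow>
    recursive_fun n (\<lambda>xs. LEAST k. f (k # xs) = 0)"

definition recursive1 :: "(nat \<Rightarrow> nat) \<Rightarrow> bool" where
  "recursive1 h \<longleftrightarrow> (\<exists>f. recursive_fun 1 f \<and> (\<forall>n. h n = f [n]))"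

definition recursive_rel4 :: "(nat \<Rightarrow> nat \<Rightarrow> nat \<Rightarrow> nat \<Rightarrow> bool) \<Rightarrow> bool" where
  "recursive_rel4 R \<longleftrightarrow>
    (\<exists>f. recursive_fun 4 f \<and> (\<forall>i j k m. f [i, j, k, m] = (if R i j k m then 1 else 0)))"


section \<open>Recursively presented Polish spaces\<close>

text \<open>The compatible complete metric is the \<^const>\<open>dist\<close> of the type class \<^class>\<open>polish_space\<close>.\<close>

definition recursive_presentation :: "(nat \<Rightarrow> 'x::polish_space) \<Rightarrow> bool" where
  "recursive_presentation r \<longleftrightarrow>
    closure (range r) = UNIV \<and>
    recursive_rel4 (\<lambda>i j k m. dist (r i) (r j) \<le> real m / real (k + 1)) \<and>
    recursive_rel4 (\<lambda>i j k m. dist (r i) (r j) < real m / real (k + 1))"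

text \<open>
  Effective enumerations of the canonical basis: the parameters \<open>(i, k, m)\<close> of the \<open>n\<close>-th ball
  depend recursively on \<open>n\<close>, and all parameters with \<open>m \<ge> 1\<close> occur.
\<close>

definition canonical_basis :: "(nat \<Rightarrow> 'x::polish_space) \<Rightarrow> (nat \<Rightarrow> 'x set) \<Rightarrow> bool" where
  "canonical_basis r U \<longleftrightarrow>
    (\<exists>ci ck cm. recursive1 ci \<and> recursive1 ck \<and> recursive1 cm \<and>
      (\<forall>n. cm n \<ge> 1 \<and> U n = ball (r (ci n)) (real (cm n) / real (ck n + 1))) \<and>
      (\<forall>i k m. m \<ge> 1 \<longrightarrow> (\<exists>n. ci n = i \<and> ck n = k \<and> cm n = m)))"

text \<open>
  For the group one requires \<open>V 0 = G\<close>. When the metric is unbounded, \<open>G\<close> is not a ball, and \<open>V 0\<close>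
  can only be an additional entry in front of an enumeration of the balls.
\<close>

definition canonical_group_basis :: "(nat \<Rightarrow> 'g::polish_space) \<Rightarrow> (nat \<Rightarrow> 'g set) \<Rightarrow> bool" where
  "canonical_group_basis r V \<longleftrightarrow>
    V 0 = UNIV \<and> (canonical_basis r V \<or> canonical_basis r (\<lambda>n. V (Suc n)))"


section \<open>Continuous actions of Polish groups\<close>

text \<open>
  Polish groups are types of sort \<open>{polish_space, topological_group_add}\<close>. The class
  \<^class>\<open>topological_group_add\<close> uses additive notation but does not assume commutativity, and the
  metric is not assumed to be invariant.
\<close>

definition continuous_action ::
    "('g::{polish_space, topological_group_add} \<Rightarrow> 'x::polish_space \<Rightarrow> 'x) \<Rightarrow> bool" where
  "continuous_action act \<longleftrightarrow>
    (\<forall>x. act 0 x = x) \<and> (\<forall>g h x. act (g + h) x = act g (act h x)) \<and>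
    continuous_on UNIV (\<lambda>(g, x). act g x)"

definition invariant :: "('g \<Rightarrow> 'x \<Rightarrow> 'x) \<Rightarrow> 'x set \<Rightarrow> bool" where
  "invariant act B \<longleftrightarrow> (\<forall>g. act g ` B = B)"


section \<open>The Borel hierarchy\<close>

function Sigma0 :: "omega1 \<Rightarrow> 'x::topological_space set set" where
  "Sigma0 \<xi> = (if \<xi> \<le> 1 then {A. open A}
    else {\<Union>n. - A n | A :: nat \<Rightarrow> 'x set. \<forall>n. A n \<in> (\<Union>\<eta>\<in>{1..<\<xi>}. Sigma0 \<eta>)})"
  by auto
termination
  by (relation "{(\<eta>, \<xi>). \<eta> < \<xi>}") (rule wf, simp_all)

declare Sigma0.simps [simp del]

definition Pi0 :: "omega1 \<Rightarrow> 'x::topological_space set set" where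
  "Pi0 \<xi> = {- A | A. A \<in> Sigma0 \<xi>}"


section \<open>Borel codes\<close>

text \<open>
  The canonical basis of Baire space, i.e. the cylinders given by finite sequences; these are the
  balls around eventually zero sequences with respect to the metric
  \<open>1 / (1 + least n with \<beta> n \<noteq> \<gamma> n)\<close>.
\<close>

definition baire_nbhd :: "nat \<Rightarrow> (nat \<Rightarrow> nat) set" where
  "baire_nbhd s = {\<beta>. \<forall>i<length (list_decode s). \<beta> i = list_decode s ! i}"

definition good_param :: "((nat \<Rightarrow> nat) \<times> nat \<times> nat) set" where
  "good_param = {(\<epsilon>, n, s). \<exists>i. \<epsilon> i = prod_encode (n, s) + 1}"

text \<open>\<open>app_conv \<epsilon> n \<beta>\<close> is the relation written \<open>{\<epsilon>}(n)\<down> = \<beta>\<close>.\<close>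

definition app_conv :: "(nat \<Rightarrow> nat) \<Rightarrow> nat \<Rightarrow> (nat \<Rightarrow> nat) \<Rightarrow> bool" where
  "app_conv \<epsilon> n \<beta> \<longleftrightarrow> {s. \<beta> \<in> baire_nbhd s} = {s. (\<epsilon>, n, s) \<in> good_param}"

lemma app_conv_unique:
  assumes "app_conv \<epsilon> n \<beta>" and "app_conv \<epsilon> n \<gamma>"
  shows "\<beta> = \<gamma>"
proof
  fix j
  have eq: "\<beta> \<in> baire_nbhd s \<longleftrightarrow> \<gamma> \<in> baire_nbhd s" for s
    using assms by (auto simp: app_conv_def)
  have "\<beta> \<in> baire_nbhd (list_encode (map \<beta> [0..<Suc j]))"
    by (auto simp: baire_nbhd_def simp del: upt_Suc)
  then have "\<gamma> \<in> baire_nbhd (list_encode (map \<beta> [0..<Suc j]))"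
    using eq by blast
  then show "\<beta> j = \<gamma> j"
    by (auto simp: baire_nbhd_def simp del: upt_Suc)
qed

definition star :: "(nat \<Rightarrow> nat) \<Rightarrow> nat \<Rightarrow> nat" where
  "star \<alpha> n = \<alpha> (n + 1)"

function BC_level :: "omega1 \<Rightarrow> (nat \<Rightarrow> nat) set" where
  "BC_level \<xi> = (if \<xi> \<le> 1 then {\<alpha>. \<alpha> 0 = 0}
    else (\<Union>\<eta>\<in>{1..<\<xi>}. BC_level \<eta>) \<union>
      {\<alpha>. \<alpha> 0 = 1 \<and> (\<forall>n. \<exists>\<beta>. app_conv (star \<alpha>) n \<beta> \<and> \<beta> \<in> (\<Union>\<eta>\<in>{1..<\<xi>}. BC_level \<eta>))})"
  by auto
termination
  by (relation "{(\<eta>, \<xi>). \<eta> < \<xi>}") (rule wf, simp_all)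

declare BC_level.simps [simp del]

definition BC :: "(nat \<Rightarrow> nat) set" where
  "BC = (\<Union>\<xi>\<in>{1..}. BC_level \<xi>)"

definition BC_rank :: "(nat \<Rightarrow> nat) \<Rightarrow> omega1" where
  "BC_rank \<alpha> = (LEAST \<xi>. 1 \<le> \<xi> \<and> \<alpha> \<in> BC_level \<xi>)"

lemma BC_rank_app_less:
  assumes "\<alpha> \<in> BC" and "\<alpha> 0 \<noteq> 0"
  shows "BC_rank (THE \<beta>. app_conv (star \<alpha>) n \<beta>) < BC_rank \<alpha>"
proof -
  let ?\<xi> = "BC_rank \<alpha>" and ?P = "\<lambda>\<xi>. 1 \<le> \<xi> \<and> \<alpha> \<in> BC_level \<xi>"
  have "\<exists>\<xi>. ?P \<xi>"
    using assms(1) unfolding BC_def by auto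
  then have "?P ?\<xi>"
    unfolding BC_rank_def by (rule LeastI_ex[of ?P])
  moreover have "\<alpha> \<notin> BC_level \<eta>" if "1 \<le> \<eta>" "\<eta> < ?\<xi>" for \<eta>
    using that not_less_Least[of \<eta> ?P] unfolding BC_rank_def by blast
  ultimately have "\<exists>\<beta>. app_conv (star \<alpha>) n \<beta> \<and> \<beta> \<in> (\<Union>\<eta>\<in>{1..<?\<xi>}. BC_level \<eta>)"
    using assms(2) unfolding BC_level.simps[of ?\<xi>] by (cases "?\<xi> \<le> 1") auto
  then obtain \<beta> \<eta> where \<beta>: "app_conv (star \<alpha>) n \<beta>" "\<beta> \<in> BC_level \<eta>" "1 \<le> \<eta>" "\<eta> < ?\<xi>"
    by auto
  have "(THE \<beta>. app_conv (star \<alpha>) n \<beta>) = \<beta>"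
    using \<beta>(1) app_conv_unique by blast
  moreover have "BC_rank \<beta> \<le> \<eta>"
    unfolding BC_rank_def by (intro Least_le conjI \<beta>)
  ultimately show ?thesis
    using \<beta>(4) by simp
qed

text \<open>The coding map; its value outside \<^const>\<open>BC\<close> is irrelevant.\<close>

function borel_decode :: "(nat \<Rightarrow> 'x set) \<Rightarrow> (nat \<Rightarrow> nat) \<Rightarrow> 'x set" where
  "borel_decode U \<alpha> = (if \<alpha> \<notin> BC then {}
    else if \<alpha> 0 = 0 then \<Union>{U m | m. \<exists>n. star \<alpha> n = m + 1}
    else (\<Union>n. - borel_decode U (THE \<beta>. app_conv (star \<alpha>) n \<beta>)))"
  by auto
termination
  by (relation "inv_image {(\<eta>, \<xi>). \<eta> < \<xi>} (\<lambda>(U, \<alpha>). BC_rank \<alpha>)")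
    (rule wf_inv_image[OF wf], simp add: BC_rank_app_less)

declare borel_decode.simps [simp del]

definition is_borel_code :: "(nat \<Rightarrow> 'x set) \<Rightarrow> (nat \<Rightarrow> nat) \<Rightarrow> 'x set \<Rightarrow> bool" where
  "is_borel_code U \<alpha> A \<longleftrightarrow> \<alpha> \<in> BC \<and> borel_decode U \<alpha> = A"


section \<open>Admissible sets with urelements\<close>

text \<open>
  Structures with a sort of urelements and a sort of sets, for a language with \<open>\<emptyset>\<close>, \<open>\<in>\<close> and further
  relation symbols \<open>'r\<close>. A symbol is interpreted on argument lists of any length; a symbol of arity
  \<open>k\<close> is one that is false on all lists of length other than \<open>k\<close>, and a symbol for the urelement
  sort is one that is false as soon as an argument is a set.
\<close>

record ('a, 'r) ustruct =
  Urel :: "'a set"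
  Vset :: "'a set"
  mem :: "'a \<Rightarrow> 'a \<Rightarrow> bool"
  emp :: 'a
  rel :: "'r \<Rightarrow> 'a list \<Rightarrow> bool"

definition univ :: "('a, 'r) ustruct \<Rightarrow> 'a set" where
  "univ \<A> = Urel \<A> \<union> Vset \<A>"

text \<open>
  Formulas in de Bruijn notation. Variables range over both sorts and the atomic formula
  \<open>IsUrel\<close> tells the sorts apart, so quantifiers over a single sort are relativised quantifiers.
\<close>

datatype trm = Var nat | Empty

datatype 'r fm =
    Eq trm trm
  | Mem trm trm
  | IsUrel trm
  | Rel 'r "trm list"
  | Neg "'r fm"
  | Conj "'r fm" "'r fm"
  | Forall "'r fm"
  | BForall trm "'r fm"

fun trm_val :: "('a, 'r) ustruct \<Rightarrow> (nat \<Rightarrow> 'a) \<Rightarrow> trm \<Rightarrow> 'a" where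
  "trm_val \<A> e (Var i) = e i"
| "trm_val \<A> e Empty = emp \<A>"

abbreviation push :: "'a \<Rightarrow> (nat \<Rightarrow> 'a) \<Rightarrow> nat \<Rightarrow> 'a" where
  "push x e \<equiv> case_nat x e"

fun sat :: "('a, 'r) ustruct \<Rightarrow> (nat \<Rightarrow> 'a) \<Rightarrow> 'r fm \<Rightarrow> bool" where
  "sat \<A> e (Eq s t) \<longleftrightarrow> trm_val \<A> e s = trm_val \<A> e t"
| "sat \<A> e (Mem s t) \<longleftrightarrow> mem \<A> (trm_val \<A> e s) (trm_val \<A> e t)"
| "sat \<A> e (IsUrel t) \<longleftrightarrow> trm_val \<A> e t \<in> Urel \<A>"
| "sat \<A> e (Rel R ts) \<longleftrightarrow> rel \<A> R (map (trm_val \<A> e) ts)"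
| "sat \<A> e (Neg \<phi>) \<longleftrightarrow> \<not> sat \<A> e \<phi>"
| "sat \<A> e (Conj \<phi> \<psi>) \<longleftrightarrow> sat \<A> e \<phi> \<and> sat \<A> e \<psi>"
| "sat \<A> e (Forall \<phi>) \<longleftrightarrow> (\<forall>x\<in>univ \<A>. sat \<A> (push x e) \<phi>)"
| "sat \<A> e (BForall t \<phi>) \<longleftrightarrow> (\<forall>x\<in>univ \<A>. mem \<A> x (trm_val \<A> e t) \<longrightarrow> sat \<A> (push x e) \<phi>)"

fun delta0 :: "'r fm \<Rightarrow> bool" where
  "delta0 (Neg \<phi>) \<longleftrightarrow> delta0 \<phi>"
| "delta0 (Conj \<phi> \<psi>) \<longleftrightarrow> delta0 \<phi> \<and> delta0 \<psi>"
| "delta0 (Forall \<phi>) \<longleftrightarrow> False"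
| "delta0 (BForall t \<phi>) \<longleftrightarrow> delta0 \<phi>"
| "delta0 \<phi> \<longleftrightarrow> True"

text \<open>The parameters of the schemes are the values of the environment \<open>e\<close>.\<close>

definition KPU :: "('a, 'r) ustruct \<Rightarrow> bool" where
  "KPU \<A> \<longleftrightarrow>
    \<comment> \<open>the constant for the empty set\<close>
    emp \<A> \<in> Vset \<A> \<and> (\<forall>x\<in>univ \<A>. \<not> mem \<A> x (emp \<A>)) \<and>
    \<comment> \<open>Extensionality\<close>
    (\<forall>a\<in>Vset \<A>. \<forall>b\<in>Vset \<A>. (\<forall>x\<in>univ \<A>. mem \<A> x a \<longleftrightarrow> mem \<A> x b) \<longrightarrow> a = b) \<and>
    \<comment> \<open>Foundation, for all formulas\<close>
    (\<forall>\<phi> e. range e \<subseteq> univ \<A> \<longrightarrow> (\<exists>x\<in>univ \<A>. sat \<A> (push x e) \<phi>) \<longrightarrow>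
      (\<exists>x\<in>univ \<A>. sat \<A> (push x e) \<phi> \<and>
        (\<forall>y\<in>univ \<A>. mem \<A> y x \<longrightarrow> \<not> sat \<A> (push y e) \<phi>))) \<and>
    \<comment> \<open>Pair\<close>
    (\<forall>x\<in>univ \<A>. \<forall>y\<in>univ \<A>. \<exists>a\<in>Vset \<A>. mem \<A> x a \<and> mem \<A> y a) \<and>
    \<comment> \<open>Union\<close>
    (\<forall>a\<in>Vset \<A>. \<exists>b\<in>Vset \<A>. \<forall>y\<in>univ \<A>. \<forall>x\<in>univ \<A>.
      mem \<A> y a \<longrightarrow> mem \<A> x y \<longrightarrow> mem \<A> x b) \<and>
    \<comment> \<open>Separation, for bounded formulas\<close>
    (\<forall>\<phi> e. delta0 \<phi> \<longrightarrow> range e \<subseteq> univ \<A> \<longrightarrow>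
      (\<forall>a\<in>Vset \<A>. \<exists>b\<in>Vset \<A>. \<forall>x\<in>univ \<A>.
        mem \<A> x b \<longleftrightarrow> mem \<A> x a \<and> sat \<A> (push x e) \<phi>)) \<and>
    \<comment> \<open>Collection, for bounded formulas; variable 0 is \<open>y\<close> and variable 1 is \<open>x\<close>\<close>
    (\<forall>\<phi> e. delta0 \<phi> \<longrightarrow> range e \<subseteq> univ \<A> \<longrightarrow>
      (\<forall>a\<in>Vset \<A>.
        (\<forall>x\<in>univ \<A>. mem \<A> x a \<longrightarrow> (\<exists>y\<in>univ \<A>. sat \<A> (push y (push x e)) \<phi>)) \<longrightarrow>
        (\<exists>b\<in>Vset \<A>. \<forall>x\<in>univ \<A>. mem \<A> x a \<longrightarrow>
          (\<exists>y\<in>univ \<A>. mem \<A> y b \<and> sat \<A> (push y (push x e)) \<phi>))))"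

text \<open>
  Transitive models of KPU, up to isomorphism: by the Mostowski collapse, the transitive sets over
  a collection of urelements are exactly the well-founded and extensional structures
  (extensionality is part of \<^const>\<open>KPU\<close>).
\<close>

definition admissible :: "('a, 'r) ustruct \<Rightarrow> bool" where
  "admissible \<A> \<longleftrightarrow>
    Urel \<A> \<inter> Vset \<A> = {} \<and>
    (\<forall>x a. mem \<A> x a \<longrightarrow> x \<in> univ \<A> \<and> a \<in> Vset \<A>) \<and>
    wf {(x, a). mem \<A> x a} \<and>
    KPU \<A>"

definition trans_elt :: "('a, 'r) ustruct \<Rightarrow> 'a \<Rightarrow> bool" where
  "trans_elt \<A> a \<longleftrightarrow> a \<in> Vset \<A> \<and> (\<forall>x y. mem \<A> x a \<longrightarrow> mem \<A> y x \<longrightarrow> mem \<A> y a)"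

definition ordinal_elt :: "('a, 'r) ustruct \<Rightarrow> 'a \<Rightarrow> bool" where
  "ordinal_elt \<A> a \<longleftrightarrow> trans_elt \<A> a \<and> (\<forall>x. mem \<A> x a \<longrightarrow> trans_elt \<A> x)"

text \<open>
  The least ordinal not in \<open>\<A>\<close> is the order type of the ordinals of \<open>\<A>\<close>; as the type of \<open>\<A>\<close> is
  arbitrary, it is represented by this well-order.
\<close>

definition ord_height :: "('a, 'r) ustruct \<Rightarrow> 'a rel" where
  "ord_height \<A> = {(a, b). ordinal_elt \<A> a \<and> ordinal_elt \<A> b \<and> (a = b \<or> mem \<A> a b)}"

definition le_height :: "omega1 \<Rightarrow> ('a, 'r) ustruct \<Rightarrow> bool" where
  "le_height \<alpha> \<A> \<longleftrightarrow> ({(\<beta>, \<gamma>). \<beta> \<le> \<gamma> \<and> \<gamma> < \<alpha>}, ord_height \<A>) \<in> ordLeq"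


section \<open>Realizing omega; codability\<close>

definition has_ext :: "('a, 'r) ustruct \<Rightarrow> 'a \<Rightarrow> 'a set \<Rightarrow> bool" where
  "has_ext \<A> a Y \<longleftrightarrow> a \<in> Vset \<A> \<and> {x. mem \<A> x a} = Y"

definition is_pair :: "('a, 'r) ustruct \<Rightarrow> 'a \<Rightarrow> 'a \<Rightarrow> 'a \<Rightarrow> bool" where
  "is_pair \<A> x y p \<longleftrightarrow>
    (\<exists>s t. has_ext \<A> s {x} \<and> has_ext \<A> t {x, y} \<and> has_ext \<A> p {s, t})"

definition is_triple :: "('a, 'r) ustruct \<Rightarrow> 'a \<Rightarrow> 'a \<Rightarrow> 'a \<Rightarrow> 'a \<Rightarrow> bool" where
  "is_triple \<A> x y z p \<longleftrightarrow> (\<exists>q. is_pair \<A> y z q \<and> is_pair \<A> x q p)"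

text \<open>
  \<open>c\<close> is an isomorphism of the natural numbers with a structure \<open>w = (d, l)\<close> that is an element
  of \<open>\<A>\<close>; the members of the set \<open>d\<close> may be sets or urelements.
\<close>

definition omega_copy :: "('a, 'r) ustruct \<Rightarrow> (nat \<Rightarrow> 'a) \<Rightarrow> bool" where
  "omega_copy \<A> c \<longleftrightarrow> inj c \<and>
    (\<exists>w d l. has_ext \<A> d (range c) \<and>
      has_ext \<A> l {p. \<exists>m n. m < n \<and> is_pair \<A> (c m) (c n) p} \<and> is_pair \<A> d l w)"

definition set_in :: "('a, 'r) ustruct \<Rightarrow> (nat \<Rightarrow> 'a) \<Rightarrow> nat set \<Rightarrow> bool" where
  "set_in \<A> c R \<longleftrightarrow> (\<exists>a. has_ext \<A> a (c ` R))"

definition rel2_in :: "('a, 'r) ustruct \<Rightarrow> (nat \<Rightarrow> 'a) \<Rightarrow> (nat \<times> nat) set \<Rightarrow> bool" where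
  "rel2_in \<A> c R \<longleftrightarrow>
    (\<exists>a. has_ext \<A> a {p. \<exists>k l. (k, l) \<in> R \<and> is_pair \<A> (c k) (c l) p})"

definition rel3_in :: "('a, 'r) ustruct \<Rightarrow> (nat \<Rightarrow> 'a) \<Rightarrow> (nat \<times> nat \<times> nat) set \<Rightarrow> bool" where
  "rel3_in \<A> c R \<longleftrightarrow>
    (\<exists>a. has_ext \<A> a {p. \<exists>k l n. (k, l, n) \<in> R \<and> is_triple \<A> (c k) (c l) (c n) p})"

definition fun_in :: "('a, 'r) ustruct \<Rightarrow> (nat \<Rightarrow> 'a) \<Rightarrow> (nat \<Rightarrow> nat) \<Rightarrow> bool" where
  "fun_in \<A> c f \<longleftrightarrow> rel2_in \<A> c {(n, f n) | n. True}"

definition point_codable ::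
    "('a, 'r) ustruct \<Rightarrow> (nat \<Rightarrow> 'a) \<Rightarrow> (nat \<Rightarrow> 'x set) \<Rightarrow> 'x \<Rightarrow> bool" where
  "point_codable \<A> c U x \<longleftrightarrow> set_in \<A> c {n. x \<in> U n}"

definition group_codable ::
    "('a, 'r) ustruct \<Rightarrow> (nat \<Rightarrow> 'a) \<Rightarrow> (nat \<Rightarrow> 'g::group_add set) \<Rightarrow> bool" where
  "group_codable \<A> c V \<longleftrightarrow>
    rel3_in \<A> c {(k, l, n). {g + h | g h. g \<in> V k \<and> h \<in> V l} \<subseteq> V n} \<and>
    rel2_in \<A> c {(k, l). {- g | g. g \<in> V k} \<subseteq> V l}"

definition action_codable ::
    "('a, 'r) ustruct \<Rightarrow> (nat \<Rightarrow> 'a) \<Rightarrow> (nat \<Rightarrow> 'g set) \<Rightarrow> (nat \<Rightarrow> 'x set) \<Rightarrow>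
      ('g \<Rightarrow> 'x \<Rightarrow> 'x) \<Rightarrow> bool" where
  "action_codable \<A> c V U act \<longleftrightarrow>
    rel3_in \<A> c {(k, i, j). {act g z | g z. g \<in> V k \<and> z \<in> U i} \<subseteq> U j}"

end

theory Submission
  imports Defs
begin

text \<open>
  Hjorth's comparison \<open>(z, V k) \<le>\<^sub>b (w, V m)\<close> of pieces of orbits is defined by a back-and-forth
  recursion on \<open>b\<close>, and it transfers membership in Borel sets of bounded rank for comeagerly many
  translates. So \<open>x\<close> and \<open>y\<close> lie in the same invariant sets of rank \<open>\<alpha>\<close> as soon as \<open>y\<close> belongs, for
  all \<open>b < \<alpha>\<close>, to the two invariant sets of points whose pieces are compared with those of \<open>x\<close> at
  level \<open>b\<close>, in either direction.

  With \<open>x\<close> fixed, these sets satisfy an infinitary recursion whose data are codable, hence have codes in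
  the admissible set as long as \<open>b\<close> is countable there. In general \<open>b\<close> need not be countable in the
  admissible set. But the relation \<open>(x, V k) \<le>\<^sub>b (x, V m)\<close> decreases with \<open>b\<close>, and as long as
  it decreases strictly, the pairs \<open>(k, m)\<close> that it loses enumerate the ordinals below \<open>b\<close>; once it
  is stationary at some \<open>b\<close>, the levels up to \<open>b + 1\<close> of the comparison with \<open>x\<close> determine all the
  others.
\<close>

text \<open>The point \<open>y\<close> is not assumed codable. So every set that receives a code is
  defined from \<open>x\<close> alone, and \<open>y\<close> enters only through membership in it. A
  set of rank \<alpha> > 1 is a countable union of complements of sets of smaller rank, or the
  complement of such a union; hence only levels below \<alpha> are compared, and these belong to the
  admissible set even when \<alpha> is its height. The obstacle is that a Borel code is a function
  on numbers and can branch over an ordinal only through numerical names for its elements. Moreover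
  only bounded separation and collection are at hand, and the copy of \<omega> comes with nothing
  but its order. A recursion is therefore turned into the existence of a set of triples, which then
  serves as a parameter of further bounded definitions. The one extra level after stabilization pays
  for the exchange of sides in the back-and-forth: a reply is obtained one level lower and then
  raised again by stability.\<close>

fun ren :: "(nat \<Rightarrow> nat) \<Rightarrow> trm \<Rightarrow> trm" where
  "ren \<rho> (Var i) = Var (\<rho> i)"
| "ren \<rho> Empty = Empty"

text \<open>The renaming need not be injective. It serves to give two formulas disjoint variables,
  and also to merge all variables of a formula that stand for the same bound object.\<close>

fun rename :: "(nat \<Rightarrow> nat) \<Rightarrow> 'r fm \<Rightarrow> 'r fm" where
  "rename \<rho> (Eq s t) = Eq (ren \<rho> s) (ren \<rho> t)"
| "rename \<rho> (Mem s t) = Mem (ren \<rho> s) (ren \<rho> t)"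
| "rename \<rho> (IsUrel t) = IsUrel (ren \<rho> t)"
| "rename \<rho> (Rel R ts) = Rel R (map (ren \<rho>) ts)"
| "rename \<rho> (Neg \<phi>) = Neg (rename \<rho> \<phi>)"
| "rename \<rho> (Conj \<phi> \<psi>) = Conj (rename \<rho> \<phi>) (rename \<rho> \<psi>)"
| "rename \<rho> (Forall \<phi>) = Forall (rename (case_nat 0 (Suc \<circ> \<rho>)) \<phi>)"
| "rename \<rho> (BForall t \<phi>) = BForall (ren \<rho> t) (rename (case_nat 0 (Suc \<circ> \<rho>)) \<phi>)"

lemma trm_val_ren: "trm_val \<A> e (ren \<rho> t) = trm_val \<A> (e \<circ> \<rho>) t"
  by (cases t) auto

lemma push_comp_lift: "push x e \<circ> case_nat 0 (Suc \<circ> \<rho>) = push x (e \<circ> \<rho>)"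
  by (auto simp: fun_eq_iff split: nat.splits)

lemma sat_rename: "sat \<A> e (rename \<rho> \<phi>) \<longleftrightarrow> sat \<A> (e \<circ> \<rho>) \<phi>"
  by (induction \<phi> arbitrary: \<rho> e) (simp_all add: trm_val_ren push_comp_lift del: o_apply, simp add: comp_def trm_val_ren)

lemma delta0_rename [simp]: "delta0 (rename \<rho> \<phi>) = delta0 \<phi>"
  by (induction \<phi> arbitrary: \<rho>) auto

lemma range_push: "x \<in> S \<Longrightarrow> range e \<subseteq> S \<Longrightarrow> range (push x e) \<subseteq> S"
  by (clarsimp split: nat.split) blast

section \<open>Bounded definability\<close>

locale omega_admissible =
  fixes \<A> :: "('a, 'r) ustruct" and c :: "nat \<Rightarrow> 'a" and d l :: 'a
  assumes adm: "admissible \<A>" and inj_c: "inj c"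
    and ext_d: "has_ext \<A> d (range c)"
    and ext_l: "has_ext \<A> l {p. \<exists>m n. m < n \<and> is_pair \<A> (c m) (c n) p}"
begin

lemma mem_univ: "mem \<A> x a \<Longrightarrow> x \<in> univ \<A>" "mem \<A> x a \<Longrightarrow> a \<in> univ \<A>" "mem \<A> x a \<Longrightarrow> a \<in> Vset \<A>"
  using adm by (auto simp: admissible_def univ_def)

lemma Vset_univ: "a \<in> Vset \<A> \<Longrightarrow> a \<in> univ \<A>"
  by (auto simp: univ_def)

lemma mem_d: "mem \<A> x d \<longleftrightarrow> x \<in> range c"
  using ext_d by (auto simp: has_ext_def)

lemma mem_l: "mem \<A> p l \<longleftrightarrow> (\<exists>m n. m < n \<and> is_pair \<A> (c m) (c n) p)"
  using ext_l by (auto simp: has_ext_def)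

lemma d_Vset: "d \<in> Vset \<A>" and l_Vset: "l \<in> Vset \<A>"
  using ext_d ext_l by (auto simp: has_ext_def)

lemma d_univ: "d \<in> univ \<A>" and l_univ: "l \<in> univ \<A>"
  using d_Vset l_Vset Vset_univ by auto

lemma c_univ: "c n \<in> univ \<A>"
  using mem_d mem_univ(1) by blast

lemma ext_eq: "a \<in> Vset \<A> \<Longrightarrow> b \<in> Vset \<A> \<Longrightarrow> (\<And>x. mem \<A> x a \<longleftrightarrow> mem \<A> x b) \<Longrightarrow> a = b"
  using adm unfolding admissible_def KPU_def by meson

lemma wf_mem: "wf {(x, a). mem \<A> x a}"
  using adm by (simp add: admissible_def)

text \<open>
  Definability by bounded formulas with parameters is treated semantically: in \<open>P \<nu> e\<close> the
  variables \<open>\<nu> i\<close> range over numbers, read in the admissible set through the copy \<open>c\<close>, and the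
  variables \<open>e i\<close> range over its elements. Free HOL variables play the role of parameters.
\<close>

definition basic_term :: "((nat \<Rightarrow> nat) \<Rightarrow> (nat \<Rightarrow> 'a) \<Rightarrow> 'a) \<Rightarrow> bool" where
  "basic_term t \<longleftrightarrow> (\<exists>i. t = (\<lambda>\<nu> e. c (\<nu> i))) \<or> (\<exists>i. t = (\<lambda>\<nu> e. e i)) \<or> (\<exists>a\<in>univ \<A>. t = (\<lambda>\<nu> e. a))"

text \<open>The sequence \<open>r\<close> says what each variable of the formula stands for. It is
  fixed before \<nu> and \<open>e\<close>, so one formula with one choice of parameters works for
  all values. Infinitely many parameters do no harm, because the schemes of KPU accept any
  environment.\<close>

definition definable :: "((nat \<Rightarrow> nat) \<Rightarrow> (nat \<Rightarrow> 'a) \<Rightarrow> bool) \<Rightarrow> bool" where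
  "definable P \<longleftrightarrow> (\<exists>\<phi> r. delta0 \<phi> \<and> (\<forall>i. basic_term (r i)) \<and>
    (\<forall>\<nu> e. range e \<subseteq> univ \<A> \<longrightarrow> (P \<nu> e \<longleftrightarrow> sat \<A> (\<lambda>i. r i \<nu> e) \<phi>)))"

lemma basic_term_nat [simp]: "basic_term (\<lambda>\<nu> e. c (\<nu> i))"
  and basic_term_var [simp]: "basic_term (\<lambda>\<nu> e. e i)"
  and basic_term_const: "a \<in> univ \<A> \<Longrightarrow> basic_term (\<lambda>\<nu> e. a)"
  by (auto simp: basic_term_def)

lemma basic_term_cases:
  assumes "basic_term t"
  obtains (nat) i where "t = (\<lambda>\<nu> e. c (\<nu> i))" | (var) i where "t = (\<lambda>\<nu> e. e i)"
    | (const) a where "a \<in> univ \<A>" "t = (\<lambda>\<nu> e. a)"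
  using assms unfolding basic_term_def by blast

lemma basic_term_univ: "basic_term t \<Longrightarrow> range e \<subseteq> univ \<A> \<Longrightarrow> t \<nu> e \<in> univ \<A>"
  by (auto simp: basic_term_def c_univ)

lemma definableI:
  assumes "delta0 \<phi>" "\<And>i. basic_term (r i)"
    "\<And>\<nu> e. range e \<subseteq> univ \<A> \<Longrightarrow> P \<nu> e \<longleftrightarrow> sat \<A> (\<lambda>i. r i \<nu> e) \<phi>"
  shows "definable P"
  using assms unfolding definable_def by blast

lemma definableE:
  assumes "definable P"
  obtains \<phi> r where "delta0 \<phi>" "\<And>i. basic_term (r i)"
    "\<And>\<nu> e. range e \<subseteq> univ \<A> \<Longrightarrow> P \<nu> e \<longleftrightarrow> sat \<A> (\<lambda>i. r i \<nu> e) \<phi>"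
  using assms unfolding definable_def by blast

lemma definable_cong:
  assumes "definable P" "\<And>\<nu> e. range e \<subseteq> univ \<A> \<Longrightarrow> P \<nu> e \<longleftrightarrow> Q \<nu> e"
  shows "definable Q"
  using assms unfolding definable_def by simp

lemma definable_eq: "basic_term s \<Longrightarrow> basic_term t \<Longrightarrow> definable (\<lambda>\<nu> e. s \<nu> e = t \<nu> e)"
  by (rule definableI[of "Eq (Var 0) (Var 1)" "case_nat s (\<lambda>_. t)"]) (auto split: nat.splits)

lemma definable_mem: "basic_term s \<Longrightarrow> basic_term t \<Longrightarrow> definable (\<lambda>\<nu> e. mem \<A> (s \<nu> e) (t \<nu> e))"
  by (rule definableI[of "Mem (Var 0) (Var 1)" "case_nat s (\<lambda>_. t)"]) (auto split: nat.splits)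

lemma definable_not: "definable P \<Longrightarrow> definable (\<lambda>\<nu> e. \<not> P \<nu> e)"
  by (erule definableE) (rule definableI[where \<phi> = "Neg _"], auto)

lemma definable_conj:
  assumes "definable P" "definable Q"
  shows "definable (\<lambda>\<nu> e. P \<nu> e \<and> Q \<nu> e)"
proof -
  obtain \<phi> r where 1: "delta0 \<phi>" "\<And>i. basic_term (r i)"
    "\<And>\<nu> e. range e \<subseteq> univ \<A> \<Longrightarrow> P \<nu> e \<longleftrightarrow> sat \<A> (\<lambda>i. r i \<nu> e) \<phi>"
    using assms(1) by (rule definableE) blast
  obtain \<psi> q where 2: "delta0 \<psi>" "\<And>i. basic_term (q i)"
    "\<And>\<nu> e. range e \<subseteq> univ \<A> \<Longrightarrow> Q \<nu> e \<longleftrightarrow> sat \<A> (\<lambda>i. q i \<nu> e) \<psi>"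
    using assms(2) by (rule definableE) blast
  \<comment> \<open>Even variables carry the first formula, odd variables the second.\<close>
  let ?r = "\<lambda>i. if even i then r (i div 2) else q (i div 2)"
  show ?thesis
  proof (rule definableI[where r = ?r])
    show "delta0 (Conj (rename (\<lambda>i. 2 * i) \<phi>) (rename (\<lambda>i. 2 * i + 1) \<psi>))"
      using 1(1) 2(1) by simp
    show "basic_term (?r i)" for i using 1(2) 2(2) by simp
  qed (simp add: sat_rename comp_def 1(3) 2(3))
qed

lemma definable_disj: "definable P \<Longrightarrow> definable Q \<Longrightarrow> definable (\<lambda>\<nu> e. P \<nu> e \<or> Q \<nu> e)"
  using definable_not[OF definable_conj[OF definable_not definable_not]] by simp

lemma definable_imp: "definable P \<Longrightarrow> definable Q \<Longrightarrow> definable (\<lambda>\<nu> e. P \<nu> e \<longrightarrow> Q \<nu> e)"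
  using definable_not[OF definable_conj[OF _ definable_not]] by simp

lemma definable_iff: "definable P \<Longrightarrow> definable Q \<Longrightarrow> definable (\<lambda>\<nu> e. P \<nu> e \<longleftrightarrow> Q \<nu> e)"
  unfolding iff_conv_conj_imp by (intro definable_conj definable_imp)

text \<open>A term is either the variable about to be bound or, after a shift of indices, one that
  ignores it. Which of the two holds depends on the term alone, so a single renaming of the formula
  works for all environments.\<close>

lemma basic_term_push:
  assumes "basic_term r"
  shows "\<exists>r'. basic_term r' \<and> (\<forall>\<nu> x e. r \<nu> (push x e) = (if r = (\<lambda>\<nu> e. e 0) then x else r' \<nu> e))"
proof (cases "r = (\<lambda>\<nu> e. e 0)")
  case True
  then show ?thesis using basic_term_var by fastforce
next
  case False
  obtain r' where "basic_term r'" "\<And>\<nu> x e. r \<nu> (push x e) = r' \<nu> e"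
    using assms unfolding basic_term_def
  proof (elim disjE exE bexE)
    fix i assume *: "r = (\<lambda>\<nu> e. e i)"
    then obtain k where "i = Suc k" using False by (cases i) auto
    then show ?thesis using * that[of "\<lambda>\<nu> e. e k"] basic_term_var by auto
  qed (use that basic_term_nat basic_term_const in auto)
  then show ?thesis using False by auto
qed

lemma basic_term_push_nat:
  assumes "basic_term r"
  shows "\<exists>r'. basic_term r' \<and> (\<forall>\<nu> n e. r (case_nat n \<nu>) e = (if r = (\<lambda>\<nu> e. c (\<nu> 0)) then c n else r' \<nu> e))"
proof (cases "r = (\<lambda>\<nu> e. c (\<nu> 0))")
  case True
  then show ?thesis using basic_term_var by fastforce
next
  case False
  obtain r' where "basic_term r'" "\<And>\<nu> n e. r (case_nat n \<nu>) e = r' \<nu> e"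
    using assms unfolding basic_term_def
  proof (elim disjE exE bexE)
    fix i assume *: "r = (\<lambda>\<nu> e. c (\<nu> i))"
    then obtain k where "i = Suc k" using False by (cases i) auto
    then show ?thesis using * that[of "\<lambda>\<nu> e. c (\<nu> k)"] basic_term_nat by auto
  qed (use that basic_term_var basic_term_const in auto)
  then show ?thesis using False by auto
qed

lemma definable_ball:
  assumes t: "basic_term t" and P: "definable (\<lambda>\<nu> e. P (e 0) \<nu> (\<lambda>i. e (Suc i)))"
  shows "definable (\<lambda>\<nu> e. \<forall>x. mem \<A> x (t \<nu> e) \<longrightarrow> P x \<nu> e)"
proof -
  obtain \<phi> r where 1: "delta0 \<phi>" "\<And>i. basic_term (r i)"
    "\<And>\<nu> e. range e \<subseteq> univ \<A> \<Longrightarrow> P (e 0) \<nu> (\<lambda>i. e (Suc i)) \<longleftrightarrow> sat \<A> (\<lambda>i. r i \<nu> e) \<phi>"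
    using P by (rule definableE) blast
  obtain r' where r': "\<And>i. basic_term (r' i)"
    "\<And>i \<nu> x e. r i \<nu> (push x e) = (if r i = (\<lambda>\<nu> e. e 0) then x else r' i \<nu> e)"
    using basic_term_push[OF 1(2)] by metis
  \<comment> \<open>Under the new quantifier, variable 0 is the bound object, variable 1 is the
    bound \<open>t\<close>, and what remains of the old term number \<open>i\<close> sits at
    \<open>Suc (Suc i)\<close>.\<close>
  let ?\<rho> = "\<lambda>i. if r i = (\<lambda>\<nu> e. e 0) then 0 else Suc (Suc i)"
  show ?thesis
  proof (rule definableI[where r = "case_nat t r'"])
    show "delta0 (BForall (Var 0) (rename ?\<rho> \<phi>))" using 1 by simp
    show "basic_term (case_nat t r' i)" for i using t r' by (simp split: nat.splits)
    fix \<nu> :: "nat \<Rightarrow> nat" and e :: "nat \<Rightarrow> 'a" assume e: "range e \<subseteq> univ \<A>"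
    have "sat \<A> (push x (\<lambda>i. case_nat t r' i \<nu> e)) (rename ?\<rho> \<phi>) \<longleftrightarrow> P x \<nu> e"
      if "x \<in> univ \<A>" for x
    proof -
      have "push x (\<lambda>i. case_nat t r' i \<nu> e) \<circ> ?\<rho> = (\<lambda>i. r i \<nu> (push x e))"
        by (auto simp: r' fun_eq_iff)
      then show ?thesis
        using 1(3)[OF range_push[OF that e], of \<nu>] by (simp add: sat_rename)
    qed
    then show "(\<forall>x. mem \<A> x (t \<nu> e) \<longrightarrow> P x \<nu> e) \<longleftrightarrow>
        sat \<A> (\<lambda>i. case_nat t r' i \<nu> e) (BForall (Var 0) (rename ?\<rho> \<phi>))"
      using mem_univ by auto
  qed
qed

lemma definable_bex:
  assumes t: "basic_term t" and P: "definable (\<lambda>\<nu> e. P (e 0) \<nu> (\<lambda>i. e (Suc i)))"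
  shows "definable (\<lambda>\<nu> e. \<exists>x. mem \<A> x (t \<nu> e) \<and> P x \<nu> e)"
  using definable_not[OF definable_ball[where P = "\<lambda>x \<nu> e. \<not> P x \<nu> e", OF t definable_not[OF P]]] by simp

text \<open>Quantifiers over numbers count as bounded: the members of \<open>d\<close> are exactly
  the values of \<open>c\<close>, and \<open>d\<close> is available as a parameter.\<close>

lemma definable_all:
  assumes P: "definable (\<lambda>\<nu> e. P (\<nu> 0) (\<lambda>i. \<nu> (Suc i)) e)"
  shows "definable (\<lambda>\<nu> e. \<forall>n. P n \<nu> e)"
proof -
  obtain \<phi> r where 1: "delta0 \<phi>" "\<And>i. basic_term (r i)"
    "\<And>\<nu> e. range e \<subseteq> univ \<A> \<Longrightarrow> P (\<nu> 0) (\<lambda>i. \<nu> (Suc i)) e \<longleftrightarrow> sat \<A> (\<lambda>i. r i \<nu> e) \<phi>"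
    using P by (rule definableE) blast
  obtain r' where r': "\<And>i. basic_term (r' i)"
    "\<And>i \<nu> n e. r i (case_nat n \<nu>) e = (if r i = (\<lambda>\<nu> e. c (\<nu> 0)) then c n else r' i \<nu> e)"
    using basic_term_push_nat[OF 1(2)] by metis
  let ?\<rho> = "\<lambda>i. if r i = (\<lambda>\<nu> e. c (\<nu> 0)) then 0 else Suc (Suc i)"
  show ?thesis
  proof (rule definableI[where r = "case_nat (\<lambda>\<nu> e. d) r'"])
    show "delta0 (BForall (Var 0) (rename ?\<rho> \<phi>))" using 1 by simp
    show "basic_term (case_nat (\<lambda>\<nu> e. d) r' i)" for i using basic_term_const[OF d_univ] r' by (simp split: nat.splits)
    fix \<nu> :: "nat \<Rightarrow> nat" and e :: "nat \<Rightarrow> 'a" assume e: "range e \<subseteq> univ \<A>"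
    have "sat \<A> (push (c n) (\<lambda>i. case_nat (\<lambda>\<nu> e. d) r' i \<nu> e)) (rename ?\<rho> \<phi>) \<longleftrightarrow> P n \<nu> e" for n
    proof -
      have "push (c n) (\<lambda>i. case_nat (\<lambda>\<nu> e. d) r' i \<nu> e) \<circ> ?\<rho> = (\<lambda>i. r i (case_nat n \<nu>) e)"
        by (auto simp: r' fun_eq_iff)
      then show ?thesis
        using 1(3)[OF e, of "case_nat n \<nu>"] by (simp add: sat_rename)
    qed
    then show "(\<forall>n. P n \<nu> e) \<longleftrightarrow>
        sat \<A> (\<lambda>i. case_nat (\<lambda>\<nu> e. d) r' i \<nu> e) (BForall (Var 0) (rename ?\<rho> \<phi>))"
      using c_univ by (auto simp: mem_d)
  qed
qed

lemma definable_ex: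
  assumes P: "definable (\<lambda>\<nu> e. P (\<nu> 0) (\<lambda>i. \<nu> (Suc i)) e)"
  shows "definable (\<lambda>\<nu> e. \<exists>n. P n \<nu> e)"
  using definable_not[OF definable_all[where P = "\<lambda>x \<nu> e. \<not> P x \<nu> e", OF definable_not[OF P]]] by simp

section \<open>Number-valued terms inside definable relations\<close>

definition basic_num :: "((nat \<Rightarrow> nat) \<Rightarrow> nat) \<Rightarrow> bool" where
  "basic_num f \<longleftrightarrow> (\<exists>i. f = (\<lambda>\<nu>. \<nu> i)) \<or> (\<exists>n. f = (\<lambda>\<nu>. n))"

lemma basic_num_var [simp]: "basic_num (\<lambda>\<nu>. \<nu> i)" and basic_num_const [simp]: "basic_num (\<lambda>\<nu>. n)"
  by (auto simp: basic_num_def)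

lemma definable_subst:
  assumes P: "definable P" and f: "\<And>i. basic_num (f i)" and h: "\<And>i. basic_term (h i)"
  shows "definable (\<lambda>\<nu> e. P (\<lambda>i. f i \<nu>) (\<lambda>i. h i \<nu> e))"
proof -
  obtain \<phi> r where 1: "delta0 \<phi>" "\<And>i. basic_term (r i)"
    "\<And>\<nu> e. range e \<subseteq> univ \<A> \<Longrightarrow> P \<nu> e \<longleftrightarrow> sat \<A> (\<lambda>i. r i \<nu> e) \<phi>"
    using P by (rule definableE) blast
  show ?thesis
  proof (rule definableI[OF 1(1)])
    show "basic_term (\<lambda>\<nu> e. r i (\<lambda>i. f i \<nu>) (\<lambda>i. h i \<nu> e))" for i
      using 1(2)[of i]
    proof (cases rule: basic_term_cases)
      case (nat j)
      then show ?thesis using f[of j] by (auto simp: basic_num_def intro!: basic_term_const c_univ)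
    next
      case (var j)
      then show ?thesis using h[of j] by simp
    next
      case (const a)
      then show ?thesis by (simp add: basic_term_const)
    qed
    show "P (\<lambda>i. f i \<nu>) (\<lambda>i. h i \<nu> e) = sat \<A> (\<lambda>i. r i (\<lambda>i. f i \<nu>) (\<lambda>i. h i \<nu> e)) \<phi>"
      if "range e \<subseteq> univ \<A>" for \<nu> e
      by (rule 1(3)) (use basic_term_univ[OF h that] in auto)
  qed
qed

text \<open>A function on numbers is represented by its graph, with the value as variable 0 and the
  arguments shifted; \<open>definable_num\<close> then substitutes it through an existential number
  quantifier.\<close>

definition num_term :: "((nat \<Rightarrow> nat) \<Rightarrow> (nat \<Rightarrow> 'a) \<Rightarrow> nat) \<Rightarrow> bool" where
  "num_term t \<longleftrightarrow> definable (\<lambda>\<nu> e. \<nu> 0 = t (\<lambda>i. \<nu> (Suc i)) e)"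

lemma definable_basic_num_eq: "basic_num f \<Longrightarrow> basic_num g \<Longrightarrow> definable (\<lambda>\<nu> e. f \<nu> = g \<nu>)"
  using definable_eq[of "\<lambda>\<nu> e. c (f \<nu>)" "\<lambda>\<nu> e. c (g \<nu>)"] inj_c
  by (auto simp: basic_num_def inj_eq c_univ basic_term_nat basic_term_const)

lemma num_term_basic: "basic_num f \<Longrightarrow> num_term (\<lambda>\<nu> e. f \<nu>)"
  unfolding num_term_def by (rule definable_basic_num_eq) (auto simp: basic_num_def)

lemma num_term_var: "num_term (\<lambda>\<nu> e. \<nu> i)" and num_term_const: "num_term (\<lambda>\<nu> e. n)"
  using num_term_basic[OF basic_num_var] num_term_basic[OF basic_num_const] by auto

lemma definable_num:
  assumes "num_term t" and "definable (\<lambda>\<nu> e. P (\<nu> 0) (\<lambda>i. \<nu> (Suc i)) e)"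
  shows "definable (\<lambda>\<nu> e. P (t \<nu> e) \<nu> e)"
proof -
  have "definable (\<lambda>\<nu> e. \<exists>n. n = t \<nu> e \<and> P n \<nu> e)"
    using assms unfolding num_term_def by (intro definable_ex definable_conj)
  then show ?thesis by simp
qed

lemma num_term_subst:
  assumes "num_term t" "\<And>i. basic_num (f i)" "\<And>i. basic_term (h i)"
  shows "num_term (\<lambda>\<nu> e. t (\<lambda>i. f i \<nu>) (\<lambda>i. h i \<nu> e))"
proof -
  let ?f = "case_nat (\<lambda>\<nu>. \<nu> 0) (\<lambda>i \<nu>. f i (\<lambda>i. \<nu> (Suc i)))"
  let ?h = "\<lambda>i \<nu>. h i (\<lambda>i. \<nu> (Suc i))"
  have t: "definable (\<lambda>\<nu> e. \<nu> 0 = t (\<lambda>i. \<nu> (Suc i)) e)" using assms(1) by (simp add: num_term_def)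
  have f: "basic_num (?f i)" for i
  proof (cases i)
    case (Suc j)
    then show ?thesis using assms(2)[of j] by (auto simp: basic_num_def)
  qed simp
  have h: "basic_term (?h i)" for i
    using assms(3)[of i] by (cases rule: basic_term_cases) (simp_all add: basic_term_const)
  show ?thesis unfolding num_term_def using definable_subst[where f = ?f and h = ?h, OF t f h] by simp
qed

lemma num_term_shift: "num_term t \<Longrightarrow> num_term (\<lambda>\<nu> e. t (\<lambda>i. \<nu> (Suc i)) e)"
  using num_term_subst[of t "\<lambda>i \<nu>. \<nu> (Suc i)" "\<lambda>i \<nu> e. e i"] by auto

lemma definable_num1:
  assumes R: "definable (\<lambda>\<nu> e. R (\<nu> 0))" and t: "num_term t"
  shows "definable (\<lambda>\<nu> e. R (t \<nu> e))"
  by (rule definable_num[OF t, of "\<lambda>n \<nu> e. R n"]) (rule R)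

lemma definable_num2:
  assumes R: "definable (\<lambda>\<nu> e. R (\<nu> 0) (\<nu> 1))" and t: "num_term t" and u: "num_term u"
  shows "definable (\<lambda>\<nu> e. R (t \<nu> e) (u \<nu> e))"
proof (rule definable_num[OF t, of "\<lambda>n \<nu> e. R n (u \<nu> e)"])
  show "definable (\<lambda>\<nu> e. R (\<nu> 0) (u (\<lambda>i. \<nu> (Suc i)) e))"
  proof (rule definable_num[OF num_term_shift[OF u], of "\<lambda>n \<nu> e. R (\<nu> 0) n"])
    show "definable (\<lambda>\<nu> e. R (\<nu> (Suc 0)) (\<nu> 0))"
      using definable_subst[OF R, of "\<lambda>i. if i = 0 then (\<lambda>\<nu>. \<nu> 1) else (\<lambda>\<nu>. \<nu> 0)" "\<lambda>i \<nu> e. e i"] by auto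
  qed
qed

lemma definable_num3:
  assumes R: "definable (\<lambda>\<nu> e. R (\<nu> 0) (\<nu> 1) (\<nu> 2))" and t: "num_term t" and u: "num_term u" and v: "num_term v"
  shows "definable (\<lambda>\<nu> e. R (t \<nu> e) (u \<nu> e) (v \<nu> e))"
proof (rule definable_num[OF v, of "\<lambda>n \<nu> e. R (t \<nu> e) (u \<nu> e) n"])
  show "definable (\<lambda>\<nu> e. R (t (\<lambda>i. \<nu> (Suc i)) e) (u (\<lambda>i. \<nu> (Suc i)) e) (\<nu> 0))"
  proof (rule definable_num[OF num_term_shift[OF t], of "\<lambda>n \<nu> e. R n (u (\<lambda>i. \<nu> (Suc i)) e) (\<nu> 0)"])
    show "definable (\<lambda>\<nu> e. R (\<nu> 0) (u (\<lambda>i. \<nu> (Suc (Suc i))) e) (\<nu> (Suc 0)))"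
    proof (rule definable_num[OF num_term_shift[OF num_term_shift[OF u]], of "\<lambda>n \<nu> e. R (\<nu> 0) n (\<nu> (Suc 0))"])
      show "definable (\<lambda>\<nu> e. R (\<nu> (Suc 0)) (\<nu> 0) (\<nu> (Suc (Suc 0))))"
        using definable_subst[OF R, of "\<lambda>i. if i = 0 then (\<lambda>\<nu>. \<nu> 1) else if i = 1 then (\<lambda>\<nu>. \<nu> 0) else (\<lambda>\<nu>. \<nu> 2)" "\<lambda>i \<nu> e. e i"]
        by (auto simp: numeral_2_eq_2)
    qed
  qed
qed

lemma definable_neq: "num_term t \<Longrightarrow> num_term u \<Longrightarrow> definable (\<lambda>\<nu> e. t \<nu> e = u \<nu> e)"
  by (rule definable_num2[of "(=)"]) (auto intro!: definable_basic_num_eq)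

lemma num_term_comp1:
  assumes "num_term (\<lambda>\<nu> e. f (\<nu> 0))" and t: "num_term t"
  shows "num_term (\<lambda>\<nu> e. f (t \<nu> e))"
proof -
  have "definable (\<lambda>\<nu> e. (\<lambda>a b. a = f b) (\<nu> 0) (\<nu> 1))"
    using assms(1) by (simp add: num_term_def)
  from definable_num2[OF this num_term_var num_term_shift[OF t]] show ?thesis by (simp add: num_term_def)
qed

lemma num_term_comp2:
  assumes "num_term (\<lambda>\<nu> e. f (\<nu> 0) (\<nu> 1))" and t: "num_term t" and u: "num_term u"
  shows "num_term (\<lambda>\<nu> e. f (t \<nu> e) (u \<nu> e))"
proof -
  have "definable (\<lambda>\<nu> e. (\<lambda>a b c. a = f b c) (\<nu> 0) (\<nu> 1) (\<nu> 2))"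
    using assms(1) by (simp add: num_term_def numeral_2_eq_2)
  from definable_num3[OF this num_term_var num_term_shift[OF t] num_term_shift[OF u]] show ?thesis by (simp add: num_term_def)
qed

lemma num_term_If:
  assumes "definable P" "num_term t" "num_term u"
  shows "num_term (\<lambda>\<nu> e. if P \<nu> e then t \<nu> e else u \<nu> e)"
proof -
  have P: "definable (\<lambda>\<nu> e. P (\<lambda>i. \<nu> (Suc i)) e)"
    using definable_subst[OF assms(1), of "\<lambda>i \<nu>. \<nu> (Suc i)" "\<lambda>i \<nu> e. e i"] by auto
  have "definable (\<lambda>\<nu> e. (P (\<lambda>i. \<nu> (Suc i)) e \<and> \<nu> 0 = t (\<lambda>i. \<nu> (Suc i)) e) \<or>
     (\<not> P (\<lambda>i. \<nu> (Suc i)) e \<and> \<nu> 0 = u (\<lambda>i. \<nu> (Suc i)) e))"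
    using assms(2,3) by (intro definable_disj definable_conj definable_not P) (auto simp: num_term_def)
  then show ?thesis unfolding num_term_def by (rule definable_cong) auto
qed

lemma definable_setI:
  assumes "set_in \<A> c R" "num_term t"
  shows "definable (\<lambda>\<nu> e. t \<nu> e \<in> R)"
proof (rule definable_num1[OF _ assms(2)])
  obtain a where a: "has_ext \<A> a (c ` R)" using assms(1) by (auto simp: set_in_def)
  have "definable (\<lambda>\<nu> e. mem \<A> (c (\<nu> 0)) a)"
    using a by (intro definable_mem basic_term_nat basic_term_const Vset_univ) (auto simp: has_ext_def)
  moreover have "mem \<A> (c n) a \<longleftrightarrow> n \<in> R" for n
  proof -
    have "mem \<A> (c n) a \<longleftrightarrow> c n \<in> c ` R" using a by (auto simp: has_ext_def)
    then show ?thesis using inj_c by (simp add: inj_image_mem_iff)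
  qed
  ultimately show "definable (\<lambda>\<nu> e. \<nu> 0 \<in> R)" by simp
qed

section \<open>Pairs, collection and separation\<close>

lemma has_ext1: "has_ext \<A> s {x} \<longleftrightarrow> mem \<A> x s \<and> (\<forall>z. mem \<A> z s \<longrightarrow> z = x)"
  unfolding has_ext_def using mem_univ(3) by auto

lemma has_ext2: "has_ext \<A> s {x, y} \<longleftrightarrow> mem \<A> x s \<and> mem \<A> y s \<and> (\<forall>z. mem \<A> z s \<longrightarrow> z = x \<or> z = y)"
  unfolding has_ext_def using mem_univ(3) by auto

text \<open>The two sets forming a Kuratowski pair are members of it, which turns the unbounded
  quantifiers of \<open>is_pair\<close> into bounded ones.\<close>

lemma is_pair_iff:
  "is_pair \<A> x y p \<longleftrightarrow> (\<exists>s. mem \<A> s p \<and> (\<exists>t. mem \<A> t p \<and>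
    (mem \<A> x s \<and> (\<forall>z. mem \<A> z s \<longrightarrow> z = x)) \<and>
    (mem \<A> x t \<and> mem \<A> y t \<and> (\<forall>z. mem \<A> z t \<longrightarrow> z = x \<or> z = y)) \<and>
    (\<forall>z. mem \<A> z p \<longrightarrow> z = s \<or> z = t)))"
  unfolding is_pair_def has_ext1 has_ext2[of _ x y] has_ext2[of p]
  by (simp only: conj_ac ex_simps(1,2)[symmetric])

lemma definable_term4:
  assumes R: "definable (\<lambda>\<nu> e. R (e 0) (e 1) (e 2) (e 3))" and basic_term: "basic_term s" "basic_term t" "basic_term u" "basic_term v"
  shows "definable (\<lambda>\<nu> e. R (s \<nu> e) (t \<nu> e) (u \<nu> e) (v \<nu> e))"
  using definable_subst[where f = "\<lambda>i \<nu>. \<nu> i" and h = "\<lambda>i. if i = 0 then s else if i = 1 then t else if i = 2 then u else v", OF R] basic_term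
  by simp

lemma definable_is_pair: "basic_term s \<Longrightarrow> basic_term t \<Longrightarrow> basic_term u \<Longrightarrow> definable (\<lambda>\<nu> e. is_pair \<A> (s \<nu> e) (t \<nu> e) (u \<nu> e))"
  by (rule definable_term4[where R = "\<lambda>x y p _. is_pair \<A> x y p" and v = "\<lambda>\<nu> e. e 0"], unfold is_pair_iff)
    (intro definable_bex definable_ball definable_conj definable_disj definable_mem definable_eq basic_term_var | assumption)+

lemma is_pair_mem: "is_pair \<A> x y p \<Longrightarrow> x \<in> univ \<A> \<and> y \<in> univ \<A> \<and> p \<in> Vset \<A>"
  unfolding is_pair_iff by (meson mem_univ)

lemma has_ext_unique: "has_ext \<A> a Y \<Longrightarrow> has_ext \<A> b Y \<Longrightarrow> a = b"
  by (auto simp: has_ext_def intro: ext_eq)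

lemma KPU_sep:
  assumes "delta0 \<phi>" "range e \<subseteq> univ \<A>" "a \<in> Vset \<A>"
  shows "\<exists>b\<in>Vset \<A>. \<forall>x\<in>univ \<A>. mem \<A> x b \<longleftrightarrow> mem \<A> x a \<and> sat \<A> (push x e) \<phi>"
proof -
  have "\<forall>\<phi> e. delta0 \<phi> \<longrightarrow> range e \<subseteq> univ \<A> \<longrightarrow>
      (\<forall>a\<in>Vset \<A>. \<exists>b\<in>Vset \<A>. \<forall>x\<in>univ \<A>.
        mem \<A> x b \<longleftrightarrow> mem \<A> x a \<and> sat \<A> (push x e) \<phi>)"
    using adm unfolding admissible_def KPU_def by (elim conjE)
  then show ?thesis using assms by blast
qed

lemma KPU_coll:
  assumes "delta0 \<phi>" "range e \<subseteq> univ \<A>" "a \<in> Vset \<A>"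
    and "\<And>x. mem \<A> x a \<Longrightarrow> \<exists>y\<in>univ \<A>. sat \<A> (push y (push x e)) \<phi>"
  shows "\<exists>b\<in>Vset \<A>. \<forall>x\<in>univ \<A>. mem \<A> x a \<longrightarrow> (\<exists>y\<in>univ \<A>. mem \<A> y b \<and> sat \<A> (push y (push x e)) \<phi>)"
proof -
  have "(\<forall>\<phi> e. delta0 \<phi> \<longrightarrow> range e \<subseteq> univ \<A> \<longrightarrow>
      (\<forall>a\<in>Vset \<A>.
        (\<forall>x\<in>univ \<A>. mem \<A> x a \<longrightarrow> (\<exists>y\<in>univ \<A>. sat \<A> (push y (push x e)) \<phi>)) \<longrightarrow>
        (\<exists>b\<in>Vset \<A>. \<forall>x\<in>univ \<A>. mem \<A> x a \<longrightarrow>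
          (\<exists>y\<in>univ \<A>. mem \<A> y b \<and> sat \<A> (push y (push x e)) \<phi>))))"
    using adm unfolding admissible_def KPU_def by (elim conjE)
  then show ?thesis using assms by blast
qed

lemma separation:
  assumes "definable (\<lambda>\<nu> e. P (e 0))" and a: "a \<in> Vset \<A>"
  shows "\<exists>b. has_ext \<A> b {x. mem \<A> x a \<and> P x}"
proof -
  obtain \<phi> r where 1: "delta0 \<phi>" "\<And>i. basic_term (r i)"
    "\<And>\<nu> e. range e \<subseteq> univ \<A> \<Longrightarrow> P (e 0) \<longleftrightarrow> sat \<A> (\<lambda>i. r i \<nu> e) \<phi>"
    using assms(1) by (rule definableE) blast
  obtain r' where r': "\<And>i. basic_term (r' i)"
    "\<And>i \<nu> x e. r i \<nu> (push x e) = (if r i = (\<lambda>\<nu> e. e 0) then x else r' i \<nu> e)"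
    using basic_term_push[OF 1(2)] by metis
  let ?\<rho> = "\<lambda>i. if r i = (\<lambda>\<nu> e. e 0) then 0 else Suc i"
  \<comment> \<open>Only variable 0 matters to \<open>P\<close>, so numbers and the other variables
    may take the default values 0 and \<open>c 0\<close>.\<close>
  let ?e = "\<lambda>i. r' i (\<lambda>_. 0) (\<lambda>_. c 0)"
  have e: "range ?e \<subseteq> univ \<A>"
    using basic_term_univ[OF r'(1), of "\<lambda>_. c 0"] c_univ by auto
  have "sat \<A> (push x ?e) (rename ?\<rho> \<phi>) \<longleftrightarrow> P x" if x: "x \<in> univ \<A>" for x
  proof -
    have "push x ?e \<circ> ?\<rho> = (\<lambda>i. r i (\<lambda>_. 0) (push x (\<lambda>_. c 0)))"
      by (auto simp: r' fun_eq_iff)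
    then show ?thesis
      using 1(3)[OF range_push[OF x, of "\<lambda>_. c 0"], of "\<lambda>_. 0"] c_univ by (simp add: sat_rename)
  qed
  then obtain b where b: "b \<in> Vset \<A>" "\<And>x. x \<in> univ \<A> \<Longrightarrow> mem \<A> x b \<longleftrightarrow> mem \<A> x a \<and> P x"
    using KPU_sep[OF _ e a, of "rename ?\<rho> \<phi>"] 1(1) by auto
  then show ?thesis unfolding has_ext_def using mem_univ by blast
qed

lemma collection:
  assumes "definable (\<lambda>\<nu> e. P (e 1) (e 0))" and a: "a \<in> Vset \<A>"
    and ex: "\<And>x. mem \<A> x a \<Longrightarrow> \<exists>y\<in>univ \<A>. P x y"
  shows "\<exists>b\<in>Vset \<A>. \<forall>x. mem \<A> x a \<longrightarrow> (\<exists>y. mem \<A> y b \<and> P x y)"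
proof -
  obtain \<phi> r where 1: "delta0 \<phi>" "\<And>i. basic_term (r i)"
    "\<And>\<nu> e. range e \<subseteq> univ \<A> \<Longrightarrow> P (e 1) (e 0) \<longleftrightarrow> sat \<A> (\<lambda>i. r i \<nu> e) \<phi>"
    using assms(1) by (rule definableE) blast
  obtain r' where r': "\<And>i. basic_term (r' i)"
    "\<And>i \<nu> x e. r i \<nu> (push x e) = (if r i = (\<lambda>\<nu> e. e 0) then x else r' i \<nu> e)"
    using basic_term_push[OF 1(2)] by metis
  obtain q where q: "\<And>i. basic_term (q i)"
    "\<And>i \<nu> x e. r' i \<nu> (push x e) = (if r' i = (\<lambda>\<nu> e. e 0) then x else q i \<nu> e)"
    using basic_term_push[OF r'(1)] by metis
  let ?\<rho> = "\<lambda>i. if r i = (\<lambda>\<nu> e. e 0) then 0 else if r' i = (\<lambda>\<nu> e. e 0) then 1 else Suc (Suc i)"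
  let ?e = "\<lambda>i. q i (\<lambda>_. 0) (\<lambda>_. c 0)"
  have e: "range ?e \<subseteq> univ \<A>"
    using basic_term_univ[OF q(1), of "\<lambda>_. c 0"] c_univ by auto
  have *: "sat \<A> (push y (push x ?e)) (rename ?\<rho> \<phi>) \<longleftrightarrow> P x y" if "x \<in> univ \<A>" "y \<in> univ \<A>" for x y
  proof -
    have "push y (push x ?e) \<circ> ?\<rho> = (\<lambda>i. r i (\<lambda>_. 0) (push y (push x (\<lambda>_. c 0))))"
      by (auto simp: r' q fun_eq_iff)
    then show ?thesis
      using 1(3)[OF range_push[OF that(2) range_push[OF that(1), of "\<lambda>_. c 0"]], of "\<lambda>_. 0"] c_univ
      by (simp add: sat_rename)
  qed
  have "\<exists>y\<in>univ \<A>. sat \<A> (push y (push x ?e)) (rename ?\<rho> \<phi>)" if "mem \<A> x a" for x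
    using ex[OF that] *[OF mem_univ(1)[OF that]] by blast
  from KPU_coll[OF _ e a this]
  obtain b where b: "b \<in> Vset \<A>" "\<And>x. x \<in> univ \<A> \<Longrightarrow> mem \<A> x a \<Longrightarrow>
      \<exists>y\<in>univ \<A>. mem \<A> y b \<and> sat \<A> (push y (push x ?e)) (rename ?\<rho> \<phi>)"
    using 1(1) by auto
  have "\<exists>y. mem \<A> y b \<and> P x y" if "mem \<A> x a" for x
    using b(2)[OF mem_univ(1)[OF that] that] *[OF mem_univ(1)[OF that]] by blast
  then show ?thesis using b(1) by blast
qed

lemma pair_set_ex:
  assumes "x \<in> univ \<A>" "y \<in> univ \<A>"
  shows "\<exists>p. has_ext \<A> p {x, y}"
proof -
  have "\<forall>x\<in>univ \<A>. \<forall>y\<in>univ \<A>. \<exists>a\<in>Vset \<A>. mem \<A> x a \<and> mem \<A> y a"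
    using adm unfolding admissible_def KPU_def by (elim conjE)
  then obtain a where a: "a \<in> Vset \<A>" "mem \<A> x a" "mem \<A> y a" using assms by blast
  have D: "definable (\<lambda>\<nu> e. e 0 = x \<or> e 0 = y)"
    using assms by (intro definable_disj definable_eq basic_term_var basic_term_const)
  obtain p where "has_ext \<A> p {z. mem \<A> z a \<and> (z = x \<or> z = y)}"
    using separation[of "\<lambda>z. z = x \<or> z = y", OF D a(1)] by blast
  moreover have "{z. mem \<A> z a \<and> (z = x \<or> z = y)} = {x, y}" using a by auto
  ultimately show ?thesis by auto
qed

lemma has_ext_univ: "has_ext \<A> a Y \<Longrightarrow> a \<in> univ \<A>"
  by (simp add: has_ext_def Vset_univ)

lemma is_pair_ex:
  assumes "x \<in> univ \<A>" "y \<in> univ \<A>"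
  shows "\<exists>p. is_pair \<A> x y p"
proof -
  obtain s where s: "has_ext \<A> s {x}" using pair_set_ex[OF assms(1,1)] by auto
  obtain t where t: "has_ext \<A> t {x, y}" using pair_set_ex[OF assms] by auto
  show ?thesis
    using pair_set_ex[OF has_ext_univ[OF s] has_ext_univ[OF t]] s t unfolding is_pair_def by blast
qed

lemma is_pair_inj:
  assumes "is_pair \<A> x y p" "is_pair \<A> x' y' p"
  shows "x = x' \<and> y = y'"
proof -
  obtain s t s' t' where "has_ext \<A> s {x}" "has_ext \<A> t {x, y}" "has_ext \<A> p {s, t}"
    "has_ext \<A> s' {x'}" "has_ext \<A> t' {x', y'}" "has_ext \<A> p {s', t'}"
    using assms unfolding is_pair_def by blast
  then have "{s, t} = {s', t'}" and *: "has_ext \<A> s Y \<Longrightarrow> Y = {x}" "has_ext \<A> t Y \<Longrightarrow> Y = {x, y}"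
    "has_ext \<A> s' Y \<Longrightarrow> Y = {x'}" "has_ext \<A> t' Y \<Longrightarrow> Y = {x', y'}" for Y
    by (simp_all add: has_ext_def)
  then consider "s = s'" "t = t'" | "s = t'" "t = s'" by (auto simp: doubleton_eq_iff)
  then show ?thesis
  proof cases
    case 1
    then have "{x} = {x'}" "{x, y} = {x', y'}"
      using \<open>has_ext \<A> s' {x'}\<close> \<open>has_ext \<A> t' {x', y'}\<close> *(1,2) by metis+
    then show ?thesis by (auto simp: doubleton_eq_iff)
  next
    case 2
    then have "{x} = {x', y'}" "{x, y} = {x'}"
      using \<open>has_ext \<A> s' {x'}\<close> \<open>has_ext \<A> t' {x', y'}\<close> *(1,2) by metis+
    then show ?thesis by (auto simp: doubleton_eq_iff)
  qed
qed

lemma is_pair_unique: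
  assumes "is_pair \<A> x y p" "is_pair \<A> x y q"
  shows "p = q"
  using assms unfolding is_pair_def by (metis has_ext_unique)

text \<open>The inner pair \<open>q\<close> is a member of a member of \<open>p\<close>, so it too
  can be quantified boundedly.\<close>

lemma is_triple_iff: "is_triple \<A> x y z p \<longleftrightarrow>
  (\<exists>s. mem \<A> s p \<and> (\<exists>q. mem \<A> q s \<and> is_pair \<A> y z q \<and> is_pair \<A> x q p))"
proof -
  have "\<exists>s. mem \<A> s p \<and> mem \<A> q s" if "is_pair \<A> x q p" for q
    using that unfolding is_pair_iff by blast
  then show ?thesis unfolding is_triple_def by blast
qed

lemma definable_is_triple:
  "basic_term s \<Longrightarrow> basic_term t \<Longrightarrow> basic_term u \<Longrightarrow> basic_term v \<Longrightarrow> definable (\<lambda>\<nu> e. is_triple \<A> (s \<nu> e) (t \<nu> e) (u \<nu> e) (v \<nu> e))"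
  by (rule definable_term4[where R = "is_triple \<A>"], unfold is_triple_iff)
    (intro definable_bex definable_conj definable_is_pair basic_term_var | assumption)+

lemma is_triple_ex: "x \<in> univ \<A> \<Longrightarrow> y \<in> univ \<A> \<Longrightarrow> z \<in> univ \<A> \<Longrightarrow> \<exists>p. is_triple \<A> x y z p"
  unfolding is_triple_def by (meson is_pair_ex is_pair_mem Vset_univ)

lemma is_triple_inj: "is_triple \<A> x y z p \<Longrightarrow> is_triple \<A> x' y' z' p \<Longrightarrow> x = x' \<and> y = y' \<and> z = z'"
  unfolding is_triple_def using is_pair_inj by blast

lemma union_ex:
  assumes "a \<in> Vset \<A>"
  shows "\<exists>b\<in>Vset \<A>. \<forall>x y. mem \<A> y a \<longrightarrow> mem \<A> x y \<longrightarrow> mem \<A> x b"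
proof -
  have "\<forall>a\<in>Vset \<A>. \<exists>b\<in>Vset \<A>. \<forall>y\<in>univ \<A>. \<forall>x\<in>univ \<A>.
      mem \<A> y a \<longrightarrow> mem \<A> x y \<longrightarrow> mem \<A> x b"
    using adm unfolding admissible_def KPU_def by (elim conjE)
  then show ?thesis using assms mem_univ(1) by metis
qed

text \<open>In the absence of power sets the product is assembled by collection: once over
  \<open>b\<close> for a fixed \<open>x\<close>, once over \<open>a\<close> to gather these rows,
  followed by a union that flattens them. Separation later trims the superset obtained.\<close>

lemma prod_cover:
  assumes a: "a \<in> Vset \<A>" and b: "b \<in> Vset \<A>"
  shows "\<exists>q\<in>Vset \<A>. \<forall>x y p. mem \<A> x a \<longrightarrow> mem \<A> y b \<longrightarrow> is_pair \<A> x y p \<longrightarrow> mem \<A> p q"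
proof -
  have row: "\<exists>q\<in>univ \<A>. \<forall>y. mem \<A> y b \<longrightarrow> (\<exists>p. mem \<A> p q \<and> is_pair \<A> x y p)" if x: "mem \<A> x a" for x
  proof -
    have "\<exists>q\<in>Vset \<A>. \<forall>y. mem \<A> y b \<longrightarrow> (\<exists>p. mem \<A> p q \<and> is_pair \<A> x y p)"
    proof (rule collection[OF _ b])
      show "definable (\<lambda>\<nu> e. is_pair \<A> x (e 1) (e 0))"
        using mem_univ(1)[OF x] by (intro definable_is_pair basic_term_const basic_term_var)
      show "\<exists>p\<in>univ \<A>. is_pair \<A> x y p" if "mem \<A> y b" for y
        using is_pair_ex[OF mem_univ(1)[OF x] mem_univ(1)[OF that]] is_pair_mem Vset_univ by blast
    qed
    then show ?thesis using Vset_univ by blast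
  qed
  have "\<exists>u\<in>Vset \<A>. \<forall>x. mem \<A> x a \<longrightarrow> (\<exists>q. mem \<A> q u \<and> (\<forall>y. mem \<A> y b \<longrightarrow> (\<exists>p. mem \<A> p q \<and> is_pair \<A> x y p)))"
  proof (rule collection[OF _ a row])
    show "definable (\<lambda>\<nu> e. \<forall>y. mem \<A> y b \<longrightarrow> (\<exists>p. mem \<A> p (e 0) \<and> is_pair \<A> (e 1) y p))"
      using Vset_univ[OF b] by (intro definable_ball definable_bex definable_is_pair basic_term_const basic_term_var)
  qed
  then obtain u where u: "u \<in> Vset \<A>"
    "\<And>x. mem \<A> x a \<Longrightarrow> \<exists>q. mem \<A> q u \<and> (\<forall>y. mem \<A> y b \<longrightarrow> (\<exists>p. mem \<A> p q \<and> is_pair \<A> x y p))"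
    by blast
  obtain w where "w \<in> Vset \<A>" "\<And>x y. mem \<A> y u \<Longrightarrow> mem \<A> x y \<Longrightarrow> mem \<A> x w"
    using union_ex[OF u(1)] by blast
  then show ?thesis using u(2) is_pair_unique by metis
qed

lemma triple_cover:
  assumes a: "a \<in> Vset \<A>"
  shows "\<exists>q\<in>Vset \<A>. \<forall>x k m p. mem \<A> x a \<longrightarrow> is_triple \<A> x (c k) (c m) p \<longrightarrow> mem \<A> p q"
proof -
  obtain q where q: "q \<in> Vset \<A>" "\<And>x y p. mem \<A> x d \<Longrightarrow> mem \<A> y d \<Longrightarrow> is_pair \<A> x y p \<Longrightarrow> mem \<A> p q"
    using prod_cover[OF d_Vset d_Vset] by blast
  obtain w where w: "w \<in> Vset \<A>" "\<And>x y p. mem \<A> x a \<Longrightarrow> mem \<A> y q \<Longrightarrow> is_pair \<A> x y p \<Longrightarrow> mem \<A> p w"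
    using prod_cover[OF a q(1)] by blast
  show ?thesis
    using w q(2) unfolding is_triple_def by (metis mem_d rangeI)
qed

lemma fun_inI:
  assumes "num_term (\<lambda>\<nu> e. f (\<nu> 0))"
  shows "fun_in \<A> c f"
proof -
  obtain q where q: "q \<in> Vset \<A>" "\<And>x y p. mem \<A> x d \<Longrightarrow> mem \<A> y d \<Longrightarrow> is_pair \<A> x y p \<Longrightarrow> mem \<A> p q"
    using prod_cover[OF d_Vset d_Vset] by blast
  have q': "mem \<A> p q" if "is_pair \<A> (c k) (c m) p" for k m p
    using q(2)[OF _ _ that] by (simp add: mem_d)
  have "\<exists>b. has_ext \<A> b {p. mem \<A> p q \<and> (\<exists>n m. m = f n \<and> is_pair \<A> (c n) (c m) p)}"
  proof (rule separation[OF _ q(1)])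
    show "definable (\<lambda>\<nu> e. \<exists>n m. m = f n \<and> is_pair \<A> (c n) (c m) (e 0))"
      using assms unfolding num_term_def
      by (intro definable_ex definable_conj definable_is_pair basic_term_nat basic_term_var) auto
  qed
  moreover have "{p. mem \<A> p q \<and> (\<exists>n m. m = f n \<and> is_pair \<A> (c n) (c m) p)} =
      {p. \<exists>k l. (k, l) \<in> {(n, f n) | n. True} \<and> is_pair \<A> (c k) (c l) p}"
    using q' by auto
  ultimately show ?thesis unfolding fun_in_def rel2_in_def by auto
qed

section \<open>Coded relations as definable predicates\<close>

lemma ex_pair_iff: "(\<exists>p. (\<exists>k' m'. R k' m' \<and> is_pair \<A> (c k') (c m') p) \<and> is_pair \<A> (c k) (c m) p) \<longleftrightarrow> R k m"
proof
  assume "\<exists>p. (\<exists>k' m'. R k' m' \<and> is_pair \<A> (c k') (c m') p) \<and> is_pair \<A> (c k) (c m) p"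
  then obtain p k' m' where "R k' m'" "is_pair \<A> (c k') (c m') p" "is_pair \<A> (c k) (c m) p" by blast
  then show "R k m" using is_pair_inj inj_c[THEN injD] by metis
qed (use is_pair_ex[OF c_univ[of k] c_univ[of m]] in blast)

lemma ex_triple_iff:
  assumes "x \<in> univ \<A>"
  shows "(\<exists>p. (\<exists>x' k' m'. R x' k' m' \<and> is_triple \<A> x' (c k') (c m') p) \<and> is_triple \<A> x (c k) (c m) p) \<longleftrightarrow> R x k m"
proof
  assume "\<exists>p. (\<exists>x' k' m'. R x' k' m' \<and> is_triple \<A> x' (c k') (c m') p) \<and> is_triple \<A> x (c k) (c m) p"
  then obtain p x' k' m' where "R x' k' m'" "is_triple \<A> x' (c k') (c m') p" "is_triple \<A> x (c k) (c m) p" by blast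
  then show "R x k m" using is_triple_inj inj_c[THEN injD] by metis
qed (use is_triple_ex[OF assms c_univ[of k] c_univ[of m]] in blast)

lemma definable_rel2I:
  assumes "rel2_in \<A> c R" "num_term t" "num_term u"
  shows "definable (\<lambda>\<nu> e. (t \<nu> e, u \<nu> e) \<in> R)"
proof (rule definable_num2[OF _ assms(2,3)])
  obtain a where a: "has_ext \<A> a {p. \<exists>k l. (k, l) \<in> R \<and> is_pair \<A> (c k) (c l) p}"
    using assms(1) by (auto simp: rel2_in_def)
  have "definable (\<lambda>\<nu> e. \<exists>p. mem \<A> p a \<and> is_pair \<A> (c (\<nu> 0)) (c (\<nu> 1)) p)"
    by (intro definable_bex definable_is_pair basic_term_nat basic_term_const basic_term_var has_ext_univ[OF a])
  moreover have "mem \<A> p a \<longleftrightarrow> (\<exists>k l. (k, l) \<in> R \<and> is_pair \<A> (c k) (c l) p)" for p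
    using a by (auto simp: has_ext_def)
  ultimately show "definable (\<lambda>\<nu> e. (\<nu> 0, \<nu> 1) \<in> R)"
    by (simp add: ex_pair_iff[of "\<lambda>k l. (k, l) \<in> R"])
qed

lemma definable_rel3I:
  assumes "rel3_in \<A> c R" "num_term t" "num_term u" "num_term v"
  shows "definable (\<lambda>\<nu> e. (t \<nu> e, u \<nu> e, v \<nu> e) \<in> R)"
proof (rule definable_num3[OF _ assms(2,3,4)])
  obtain a where a: "has_ext \<A> a {p. \<exists>k l n. (k, l, n) \<in> R \<and> is_triple \<A> (c k) (c l) (c n) p}"
    using assms(1) by (auto simp: rel3_in_def)
  have "definable (\<lambda>\<nu> e. \<exists>p. mem \<A> p a \<and> is_triple \<A> (c (\<nu> 0)) (c (\<nu> 1)) (c (\<nu> 2)) p)"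
    by (intro definable_bex definable_is_triple basic_term_nat basic_term_const basic_term_var has_ext_univ[OF a])
  moreover have "(\<exists>p. mem \<A> p a \<and> is_triple \<A> (c k) (c m) (c n) p) \<longleftrightarrow> (k, m, n) \<in> R" for k m n
  proof -
    have "mem \<A> p a \<longleftrightarrow> (\<exists>x l n. (\<exists>k. x = c k \<and> (k, l, n) \<in> R) \<and> is_triple \<A> x (c l) (c n) p)" for p
    proof -
      have "mem \<A> p a \<longleftrightarrow> (\<exists>k l n. (k, l, n) \<in> R \<and> is_triple \<A> (c k) (c l) (c n) p)"
        using a unfolding has_ext_def by blast
      then show ?thesis by blast
    qed
    then show ?thesis
      using ex_triple_iff[OF c_univ, of "\<lambda>x l n. \<exists>k. x = c k \<and> (k, l, n) \<in> R"] inj_c by (simp add: inj_eq)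
  qed
  ultimately show "definable (\<lambda>\<nu> e. (\<nu> 0, \<nu> 1, \<nu> 2) \<in> R)" by simp
qed

lemma definable_less: "num_term t \<Longrightarrow> num_term u \<Longrightarrow> definable (\<lambda>\<nu> e. t \<nu> e < u \<nu> e)"
proof (rule definable_num2[of "(<)"])
  have "definable (\<lambda>\<nu> e. \<exists>p. mem \<A> p l \<and> is_pair \<A> (c (\<nu> 0)) (c (\<nu> 1)) p)"
    by (intro definable_bex definable_is_pair basic_term_nat basic_term_const basic_term_var l_univ)
  then show "definable (\<lambda>\<nu> e. \<nu> 0 < \<nu> 1)" by (simp add: mem_l ex_pair_iff[of "(<)"])
qed

section \<open>Recursion\<close>

text \<open>Reads a set of triples as a family of binary relations on numbers, indexed by elements
  of the admissible set; this is the shape of the approximations in the recursion.\<close>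

definition holds :: "'a \<Rightarrow> 'a \<Rightarrow> nat \<Rightarrow> nat \<Rightarrow> bool" where
  "holds t b k m \<longleftrightarrow> (\<exists>p. mem \<A> p t \<and> is_triple \<A> b (c k) (c m) p)"

lemma definable_holds0:
  assumes "basic_term t" "basic_term b"
  shows "definable (\<lambda>\<nu> e. holds (t \<nu> e) (b \<nu> e) (\<nu> i) (\<nu> j))"
  by (rule definable_term4[where R = "\<lambda>t b k m. \<exists>p. mem \<A> p t \<and> is_triple \<A> b k m p" and u = "\<lambda>\<nu> e. c (\<nu> i)"
        and v = "\<lambda>\<nu> e. c (\<nu> j)", folded holds_def])
    (intro definable_bex definable_is_triple basic_term_var basic_term_nat assms)+

lemma definable_subst_e:
  assumes "definable (\<lambda>\<nu> e. P \<nu> (e 0) (e 1))" "basic_term s" "basic_term t"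
  shows "definable (\<lambda>\<nu> e. P \<nu> (s \<nu> e) (t \<nu> e))"
  using definable_subst[where f = "\<lambda>i \<nu>. \<nu> i" and h = "\<lambda>i. if i = 0 then s else t", OF assms(1)] assms(2,3)
  by simp

text \<open>
  Definition by recursion along \<open>W\<close>: the solution \<open>S\<close> is approximated inside the admissible set by
  its restrictions to initial segments, which exist by induction and collection.
\<close>

lemma set_recursion:
  assumes a: "a \<in> Vset \<A>"
    and W: "definable (\<lambda>\<nu> e. W (e 0) (e 1))" and wf: "wfp W" and trans: "transp W"
    and \<Phi>: "definable (\<lambda>\<nu> e. \<Phi> (e 0) (\<nu> 0) (\<nu> 1) (holds (e 1)))"
    and local: "\<And>b k m X Y. mem \<A> b a \<Longrightarrow>
      (\<And>b' k' m'. mem \<A> b' a \<Longrightarrow> W b' b \<Longrightarrow> X b' k' m' \<longleftrightarrow> Y b' k' m') \<Longrightarrow> \<Phi> b k m X \<Longrightarrow> \<Phi> b k m Y"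
    and S: "\<And>b k m. mem \<A> b a \<Longrightarrow> S b k m \<longleftrightarrow> \<Phi> b k m S"
  shows "\<exists>t\<in>Vset \<A>. \<forall>b k m. mem \<A> b a \<longrightarrow> (holds t b k m \<longleftrightarrow> S b k m)"
proof -
  \<comment> \<open>Correctness below \<open>b\<close> is expressed by the recursion equation
    instead of by \<open>S\<close>, because \<open>\<Phi>\<close> is known to be definable and
    \<open>S\<close> is not.\<close>
  define good where "good t b \<longleftrightarrow> (\<forall>b'. mem \<A> b' a \<longrightarrow> W b' b \<longrightarrow>
    (\<forall>k m. holds t b' k m \<longleftrightarrow> \<Phi> b' k m (holds t)))" for t b
  note univ_a = Vset_univ[OF a]
  have definable_W: "definable (\<lambda>\<nu> e. W (s \<nu> e) (t \<nu> e))" if "basic_term s" "basic_term t" for s t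
    using definable_subst_e[OF W that] .
  have definable_\<Phi>: "definable (\<lambda>\<nu> e. \<Phi> (s \<nu> e) (\<nu> i) (\<nu> j) (holds (t \<nu> e)))" if "basic_term s" "basic_term t" for s t i j
    using definable_subst_e[OF definable_subst[where f = "\<lambda>n. if n = 0 then (\<lambda>\<nu>. \<nu> i) else (\<lambda>\<nu>. \<nu> j)" and h = "\<lambda>n \<nu> e. e n", OF \<Phi>] that]
    by simp
  have definable_good: "definable (\<lambda>\<nu> e. good (s \<nu> e) (t \<nu> e))" if "basic_term s" "basic_term t" for s t
  proof -
    have "definable (\<lambda>\<nu> e. good (e 0) (e 1))"
      unfolding good_def
      by (intro definable_ball definable_imp definable_all definable_iff definable_W definable_\<Phi> definable_holds0 basic_term_var basic_term_const univ_a)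
    from definable_subst_e[OF this that] show ?thesis .
  qed
  have local': "\<Phi> b k m X \<longleftrightarrow> \<Phi> b k m Y"
    if "mem \<A> b a" "\<And>b' k' m'. mem \<A> b' a \<Longrightarrow> W b' b \<Longrightarrow> X b' k' m' \<longleftrightarrow> Y b' k' m'" for b k m X Y
    using local[of b X Y k m] local[of b Y X k m] that by blast
  \<comment> \<open>The equation determines the relation below \<open>b\<close>; transitivity of
    \<open>W\<close> keeps the induction inside that segment.\<close>
  have goodD: "holds t b' k m \<longleftrightarrow> S b' k m" if good: "good t b" and "mem \<A> b' a" "W b' b" for t b b' k m
    using wf that(2,3)
  proof (induction b' arbitrary: k m rule: wfp_induct_rule)
    case (less b')
    have "\<Phi> b' k m (holds t) \<longleftrightarrow> \<Phi> b' k m S"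
    proof (rule local'[OF less.prems(1)])
      show "holds t b'' k' m' \<longleftrightarrow> S b'' k' m'" if "mem \<A> b'' a" "W b'' b'" for b'' k' m'
        using less.IH[OF that(2,1)] transpD[OF trans that(2) less.prems(2)] by blast
    qed
    then show ?case using good less.prems S unfolding good_def by blast
  qed
  obtain q where q: "q \<in> Vset \<A>" "\<And>x k m p. mem \<A> x a \<Longrightarrow> is_triple \<A> x (c k) (c m) p \<Longrightarrow> mem \<A> p q"
    using triple_cover[OF a] by blast
  have glue: "\<exists>t\<in>Vset \<A>. \<forall>b k m. mem \<A> b r \<longrightarrow> (holds t b k m \<longleftrightarrow> S b k m)"
    if r: "r \<in> Vset \<A>" "\<And>b. mem \<A> b r \<Longrightarrow> mem \<A> b a" and ex: "\<And>b. mem \<A> b r \<Longrightarrow> \<exists>t\<in>univ \<A>. good t b" for r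
  proof -
    have "\<exists>u\<in>Vset \<A>. \<forall>b. mem \<A> b r \<longrightarrow> (\<exists>t. mem \<A> t u \<and> good t b)"
      by (rule collection[of "\<lambda>b t. good t b", OF definable_good r(1) ex]) auto
    then obtain u where u: "u \<in> Vset \<A>" "\<And>b. mem \<A> b r \<Longrightarrow> \<exists>t. mem \<A> t u \<and> good t b" by blast
    \<comment> \<open>No approximation has to be chosen: any two that are good for \<open>b\<close>
      yield the same value at \<open>b\<close>, so all of them may be used together.\<close>
    let ?R = "\<lambda>b k m. mem \<A> b r \<and> (\<exists>t. mem \<A> t u \<and> good t b \<and> \<Phi> b k m (holds t))"
    have "\<exists>t. has_ext \<A> t {p. mem \<A> p q \<and>
        (\<exists>b. mem \<A> b r \<and> (\<exists>t. mem \<A> t u \<and> good t b \<and> (\<exists>k m. \<Phi> b k m (holds t) \<and> is_triple \<A> b (c k) (c m) p)))}"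
      by (rule separation[OF _ q(1)])
        (intro definable_bex definable_conj definable_ex definable_good definable_\<Phi> definable_is_triple basic_term_var basic_term_nat basic_term_const Vset_univ r(1) u(1))
    then obtain t where t: "t \<in> Vset \<A>" "\<And>p. mem \<A> p t \<longleftrightarrow> mem \<A> p q \<and>
        (\<exists>b. mem \<A> b r \<and> (\<exists>t. mem \<A> t u \<and> good t b \<and> (\<exists>k m. \<Phi> b k m (holds t) \<and> is_triple \<A> b (c k) (c m) p)))"
      unfolding has_ext_def by blast
    have "mem \<A> p t \<longleftrightarrow> (\<exists>b k m. ?R b k m \<and> is_triple \<A> b (c k) (c m) p)" for p
      unfolding t(2) using q(2) r(2) by blast
    then have "holds t b k m \<longleftrightarrow> ?R b k m" if "mem \<A> b r" for b k m
      unfolding holds_def[of t] using ex_triple_iff[OF mem_univ(1)[OF that], of ?R k m] by simp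
    moreover have "?R b k m \<longleftrightarrow> S b k m" if b: "mem \<A> b r" for b k m
    proof -
      have "\<Phi> b k m (holds t') \<longleftrightarrow> S b k m" if "good t' b" for t'
        using local'[OF r(2)[OF b], of "holds t'" S k m] goodD[OF that] S[OF r(2)[OF b]] by blast
      then show ?thesis using u(2)[OF b] b by blast
    qed
    ultimately show ?thesis using t(1) by blast
  qed
  \<comment> \<open>This induction runs outside the admissible set, along the well-founded
    \<open>W\<close>; each step applies collection to the segment below \<open>b\<close>.\<close>
  have good_ex: "\<exists>t\<in>univ \<A>. good t b" if "mem \<A> b a" for b
    using wf that
  proof (induction b rule: wfp_induct_rule)
    case (less b)
    obtain r where r: "has_ext \<A> r {x. mem \<A> x a \<and> W x b}"
      using separation[of "\<lambda>x. W x b", OF definable_W[OF basic_term_var basic_term_const[OF mem_univ(1)[OF less.prems]]] a] by blast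
    then have r': "r \<in> Vset \<A>" "\<And>x. mem \<A> x r \<longleftrightarrow> mem \<A> x a \<and> W x b" by (auto simp: has_ext_def)
    obtain t where t: "t \<in> Vset \<A>" "\<And>b k m. mem \<A> b r \<Longrightarrow> holds t b k m \<longleftrightarrow> S b k m"
      using glue[OF r'(1)] r'(2) less.IH by blast
    have "good t b"
      unfolding good_def
    proof (intro allI impI)
      fix b' k m assume b': "mem \<A> b' a" "W b' b"
      have "\<Phi> b' k m (holds t) \<longleftrightarrow> \<Phi> b' k m S"
        by (rule local'[OF b'(1)]) (use t(2) r'(2) b' transpD[OF trans] in blast)
      then show "holds t b' k m \<longleftrightarrow> \<Phi> b' k m (holds t)"
        using t(2) r'(2) b' S[OF b'(1)] by blast
    qed
    then show ?case using t(1) Vset_univ by blast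
  qed
  show ?thesis using glue[OF a _ good_ex] by blast
qed

end

section \<open>Borel codes of well-founded graphs\<close>

lemma omega1_bound:
  assumes "countable S"
  shows "\<exists>\<xi>::omega1. \<forall>\<eta>\<in>S. \<eta> < \<xi>"
proof (rule ccontr)
  assume *: "\<nexists>\<xi>. \<forall>\<eta>\<in>S. \<eta> < \<xi>"
  have "UNIV = (\<Union>\<eta>\<in>S. insert \<eta> {..<\<eta>})"
  proof (intro equalityI subsetI)
    fix \<xi> :: omega1
    obtain \<eta> where "\<eta> \<in> S" "\<not> \<eta> < \<xi>" using * by blast
    then show "\<xi> \<in> (\<Union>\<eta>\<in>S. insert \<eta> {..<\<eta>})" by (auto simp: not_less le_less)
  qed simp
  moreover have "countable (\<Union>\<eta>\<in>S. insert \<eta> {..<\<eta>})"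
    using assms countable_lessThan_omega1 by simp
  ultimately show False using uncountable_UNIV_omega1 by simp
qed

lemma omega1_gt_ex: "\<exists>\<xi>::omega1. \<eta> < \<xi>"
  using omega1_bound[of "{\<eta>}"] by auto

lemma zero_le_omega1 [simp]: "(0::omega1) \<le> \<alpha>"
  unfolding zero_omega1_def by (rule Least_le) simp

lemma zero_less_one_omega1: "(0::omega1) < 1"
  unfolding one_omega1_def using omega1_gt_ex[of 0] by (rule LeastI_ex)

lemma one_le_iff_omega1: "(1::omega1) \<le> \<alpha> \<longleftrightarrow> 0 < \<alpha>"
  using zero_less_one_omega1 Least_le[of "\<lambda>\<alpha>::omega1. 0 < \<alpha>" \<alpha>]
  by (auto simp: one_omega1_def[symmetric])

lemma BC_leaf: "\<alpha> 0 = 0 \<Longrightarrow> \<alpha> \<in> BC"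
  unfolding BC_def by (rule UN_I[of 1]) (simp_all add: BC_level.simps[of 1])

lemma BC_node:
  assumes "\<alpha> 0 = 1" and ch: "\<And>n. app_conv (star \<alpha>) n (\<beta> n)" "\<And>n. \<beta> n \<in> BC"
  shows "\<alpha> \<in> BC"
proof -
  obtain \<eta> where \<eta>: "\<And>n. 1 \<le> \<eta> n" "\<And>n. \<beta> n \<in> BC_level (\<eta> n)"
  proof -
    have "\<forall>n. \<exists>\<eta>. 1 \<le> \<eta> \<and> \<beta> n \<in> BC_level \<eta>" using ch(2) unfolding BC_def by auto
    then show ?thesis using that by metis
  qed
  obtain \<xi> where \<xi>: "\<And>n. \<eta> n < \<xi>"
    using omega1_bound[of "range \<eta>"] by auto
  then have 1: "1 < \<xi>" using \<eta>(1) le_less_trans by blast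
  have "\<exists>\<beta>. app_conv (star \<alpha>) n \<beta> \<and> \<beta> \<in> (\<Union>\<eta>\<in>{1..<\<xi>}. BC_level \<eta>)" for n
    using ch(1) \<eta> \<xi> by (intro exI[of _ "\<beta> n"] conjI UN_I[of "\<eta> n"]) auto
  then have "\<alpha> \<in> BC_level \<xi>"
    using assms(1) 1 by (subst BC_level.simps) (simp add: not_le)
  then show ?thesis using 1 by (auto simp: BC_def)
qed

lemma length_list_decode: "length (list_decode s) \<le> s"
proof (induction s rule: list_decode.induct)
  case (2 n)
  obtain a b where ab: "prod_decode n = (a, b)" by fastforce
  then have "b \<le> n" using le_prod_encode_2[of b a] by (metis prod_decode_inverse)
  then show ?case using 2[OF ab[symmetric]] ab by simp
qed simp

text \<open>
  The code of the set attached to the vertex \<open>v\<close> of a well-founded graph. Its value at \<open>Suc i\<close>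
  depends only on values of the codes of the successors of \<open>v\<close> at arguments \<open>\<le> i\<close>, so that the
  codes are computed by recursion on numbers instead of recursion along the graph.
\<close>

function tree_code ::
    "(nat \<Rightarrow> bool) \<Rightarrow> (nat \<Rightarrow> nat \<Rightarrow> bool) \<Rightarrow> (nat \<Rightarrow> nat \<Rightarrow> nat) \<Rightarrow> nat \<Rightarrow> nat \<Rightarrow> nat" where
  "tree_code leaf Q ch v 0 = (if leaf v then 0 else 1)"
| "tree_code leaf Q ch v (Suc i) = (if (if leaf v then Q v i else
      \<forall>j<length (list_decode (snd (prod_decode i))).
        tree_code leaf Q ch (ch v (fst (prod_decode i))) j = list_decode (snd (prod_decode i)) ! j)
    then Suc i else 0)"
  by pat_completeness auto
termination
proof (relation "Wellfounded.measure (\<lambda>(leaf, Q, ch, v, i). i)", simp, clarsimp)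
  fix i j assume "j < length (list_decode (snd (prod_decode i)))"
  also have "\<dots> \<le> snd (prod_decode i)" by (rule length_list_decode)
  also have "\<dots> \<le> i" using le_prod_encode_2[of "snd (prod_decode i)" "fst (prod_decode i)"] by simp
  finally show "j < Suc i" by simp
qed

text \<open>The entry at \<open>Suc i\<close> with \<open>i = prod_encode (n, s)\<close> is nonzero
  exactly when the code of child \<open>n\<close> lies in the neighbourhood \<open>s\<close>. After
  the initial entry, each entry is 0 or its own position, so no other entry can announce this
  pair.\<close>

lemma app_conv_tree_code:
  assumes "\<not> leaf v"
  shows "app_conv (star (tree_code leaf Q ch v)) n (tree_code leaf Q ch (ch v n))"
proof -
  have "(\<exists>i. star (tree_code leaf Q ch v) i = prod_encode (n, s) + 1) \<longleftrightarrow>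
      tree_code leaf Q ch v (Suc (prod_encode (n, s))) = Suc (prod_encode (n, s))" for s
    unfolding star_def by (auto split: if_splits)
  then show ?thesis
    using assms by (auto simp: app_conv_def good_param_def baire_nbhd_def)
qed

lemma is_borel_code_tree_code:
  fixes U :: "nat \<Rightarrow> 'x set"
  assumes wf: "wf {(ch v n, v) | v n. \<not> leaf v}"
    and leaf: "\<And>v. leaf v \<Longrightarrow> F v = \<Union>{U m | m. Q v m}"
    and node: "\<And>v. \<not> leaf v \<Longrightarrow> F v = (\<Union>n. - F (ch v n))"
  shows "is_borel_code U (tree_code leaf Q ch v) (F v)"
  using wf
proof (induction v rule: wf_induct_rule)
  case (less v)
  let ?\<alpha> = "tree_code leaf Q ch"
  show ?case
  proof (cases "leaf v")
    case True
    then have "?\<alpha> v \<in> BC" by (simp add: BC_leaf)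
    moreover have "star (?\<alpha> v) n = m + 1 \<longleftrightarrow> n = m \<and> Q v m" for n m
      using True by (auto simp: star_def)
    ultimately show ?thesis
      using True leaf unfolding is_borel_code_def borel_decode.simps[of U "?\<alpha> v"] by simp
  next
    case False
    have IH: "is_borel_code U (?\<alpha> (ch v n)) (F (ch v n))" for n
      using less False by blast
    have "?\<alpha> v \<in> BC"
      by (rule BC_node[OF _ app_conv_tree_code[where leaf = leaf and v = v, OF False]]) (use False IH in \<open>auto simp: is_borel_code_def\<close>)
    moreover have "(THE \<beta>. app_conv (star (?\<alpha> v)) n \<beta>) = ?\<alpha> (ch v n)" for n
      using app_conv_tree_code[where leaf = leaf and v = v, OF False] app_conv_unique by blast
    ultimately show ?thesis
      using False node IH unfolding is_borel_code_def borel_decode.simps[of U "?\<alpha> v"] by simp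
  qed
qed

section \<open>Recursion on numbers, arithmetic and list entries inside the admissible set\<close>

definition entry :: "nat \<Rightarrow> nat \<Rightarrow> nat \<Rightarrow> bool" where
  "entry s j x \<longleftrightarrow> j < length (list_decode s) \<and> list_decode s ! j = x"

text \<open>One step of list decoding. The code of the tail is smaller than \<open>s\<close>, so
  this is a recursion of the form treated by \<open>recursion_nat\<close>.\<close>

lemma entry_iff: "entry s j x \<longleftrightarrow> (\<exists>h t. s = Suc (prod_encode (h, t)) \<and>
    ((j = 0 \<and> x = h) \<or> (\<exists>j'. j = Suc j' \<and> entry t j' x)))"
proof (cases s)
  case (Suc n)
  obtain h t where ht: "prod_decode n = (h, t)" by fastforce
  then have n: "n = prod_encode (h, t)" by (metis prod_decode_inverse)
  show ?thesis
    by (cases j) (auto simp: Suc n entry_def)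
qed (simp add: entry_def)

context omega_admissible
begin

text \<open>The solution is stored in a set of triples, and quoting that set as a parameter makes
  the predicate bounded. The set \<open>l\<close> supplies the order along which to recurse.\<close>

lemma recursion_nat:
  assumes \<Phi>: "definable (\<lambda>\<nu> e. \<Phi> (\<nu> 0) (\<nu> 1) (\<nu> 2) (\<lambda>n. holds (e 0) (c n)))"
    and local: "\<And>n k m X Y. (\<And>n' k' m'. n' < n \<Longrightarrow> X n' k' m' \<longleftrightarrow> Y n' k' m') \<Longrightarrow> \<Phi> n k m X \<Longrightarrow> \<Phi> n k m Y"
    and S: "\<And>n k m. S n k m \<longleftrightarrow> \<Phi> n k m S"
  shows "definable (\<lambda>\<nu> e. S (\<nu> 0) (\<nu> 1) (\<nu> 2))"
proof -
  let ?W = "\<lambda>b' b. \<exists>m n. b' = c m \<and> b = c n \<and> m < n"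
  let ?\<Phi> = "\<lambda>b k m X. \<exists>n. b = c n \<and> \<Phi> n k m (\<lambda>n. X (c n))"
  have 1: "definable (\<lambda>\<nu> e. ?W (e 0) (e 1))"
    by (intro definable_ex definable_conj definable_eq definable_less basic_term_var basic_term_nat num_term_var)
  have 2: "definable (\<lambda>\<nu> e. ?\<Phi> (e 0) (\<nu> 0) (\<nu> 1) (holds (e 1)))"
  proof (intro definable_ex definable_conj definable_eq basic_term_var basic_term_nat)
    show "definable (\<lambda>\<nu> e. \<Phi> (\<nu> 0) (\<nu> (Suc 0)) (\<nu> (Suc 1)) (\<lambda>n. holds (e 1) (c n)))"
      using definable_subst[where f = "\<lambda>i \<nu>. \<nu> i" and h = "\<lambda>i \<nu> e. e 1", OF \<Phi>] by (simp add: numeral_2_eq_2)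
  qed
  have "\<exists>t\<in>Vset \<A>. \<forall>b k m. mem \<A> b d \<longrightarrow> (holds t b k m \<longleftrightarrow> (\<exists>n. b = c n \<and> S n k m))"
  proof (rule set_recursion[OF d_Vset 1 _ _ 2])
    show "wfp ?W"
      by (rule wfp_if_convertible_to_nat[where f = "inv c"]) (auto simp: inj_c)
    show "transp ?W"
      by (rule transpI) (use inj_c in \<open>auto simp: inj_eq\<close>)
    show "?\<Phi> b k m Y" if XY: "\<And>b' k' m'. mem \<A> b' d \<Longrightarrow> ?W b' b \<Longrightarrow> X b' k' m' \<longleftrightarrow> Y b' k' m'" and X: "?\<Phi> b k m X"
      for b k m X Y
    proof -
      obtain n where n: "b = c n" "\<Phi> n k m (\<lambda>n. X (c n))" using X by blast
      have "\<Phi> n k m (\<lambda>n. Y (c n))"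
        by (rule local[OF _ n(2)]) (use XY n(1) mem_d in blast)
      then show ?thesis using n(1) by blast
    qed
    show "(\<exists>n. b = c n \<and> S n k m) \<longleftrightarrow> (\<exists>n. b = c n \<and> \<Phi> n k m (\<lambda>n k m. \<exists>n'. c n = c n' \<and> S n' k m))" for b k m
    proof -
      have "(\<lambda>n k m. \<exists>n'. c n = c n' \<and> S n' k m) = S" using inj_c by (simp add: inj_eq)
      then show ?thesis using S by simp
    qed
  qed
  then obtain t where t: "t \<in> Vset \<A>" "\<And>n k m. holds t (c n) k m \<longleftrightarrow> S n k m"
    using mem_d inj_c by (auto simp: inj_eq)
  have "definable (\<lambda>\<nu> e. holds t (c (\<nu> 0)) (\<nu> 1) (\<nu> 2))"
    by (intro definable_holds0 basic_term_nat basic_term_const Vset_univ t(1))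
  then show ?thesis by (simp add: t(2))
qed

lemma num_term_Suc: "num_term t \<Longrightarrow> num_term (\<lambda>\<nu> e. Suc (t \<nu> e))"
proof (rule num_term_comp1[of Suc])
  have "definable (\<lambda>\<nu> e. \<nu> 1 < \<nu> 0 \<and> (\<forall>k. \<nu> 1 < k \<longrightarrow> \<not> k < \<nu> 0))"
    by (intro definable_conj definable_all definable_imp definable_not definable_less num_term_var)
  moreover have "(\<nu> 1 < \<nu> 0 \<and> (\<forall>k. \<nu> 1 < k \<longrightarrow> \<not> k < \<nu> 0)) \<longleftrightarrow> \<nu> 0 = Suc (\<nu> 1)" for \<nu> :: "nat \<Rightarrow> nat"
    using not_less_eq by (metis lessI not_less_less_Suc_eq)
  ultimately show "num_term (\<lambda>\<nu> e. Suc (\<nu> 0))" by (simp add: num_term_def)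
qed

lemmas definable_intros = definable_all definable_ex definable_conj definable_disj definable_imp definable_iff definable_not definable_neq definable_less
  num_term_var num_term_const num_term_Suc num_term_If

text \<open>The successor is read off from the order. Addition and then triangular numbers are
  recovered by recursion, and together they give the pairing function.\<close>

lemma num_term_add:
  assumes "num_term t" "num_term u"
  shows "num_term (\<lambda>\<nu> e. t \<nu> e + u \<nu> e)"
proof (rule num_term_comp2[of "(+)", OF _ assms])
  have "definable (\<lambda>\<nu> e. (\<lambda>n k m. m = n + k) (\<nu> 0) (\<nu> 1) (\<nu> 2))"
  proof (rule recursion_nat[where \<Phi> = "\<lambda>n k m X. (n = 0 \<and> m = k) \<or> (\<exists>n' m'. n = Suc n' \<and> m = Suc m' \<and> X n' k m')"])
    show "(m = n + k) = (n = 0 \<and> m = k \<or> (\<exists>n' m'. n = Suc n' \<and> m = Suc m' \<and> m' = n' + k))" for n k m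
      by (cases n) auto
  qed (intro definable_intros definable_holds0 basic_term_var basic_term_nat, auto)
  from definable_num3[where R = "\<lambda>n k m. m = n + k" and t = "\<lambda>\<nu> e. \<nu> 1" and u = "\<lambda>\<nu> e. \<nu> 2" and v = "\<lambda>\<nu> e. \<nu> 0", OF this num_term_var num_term_var num_term_var]
  show "num_term (\<lambda>\<nu> e. \<nu> 0 + \<nu> 1)" by (simp add: num_term_def numeral_2_eq_2)
qed

lemma num_term_triangle:
  assumes "num_term t"
  shows "num_term (\<lambda>\<nu> e. triangle (t \<nu> e))"
proof (rule num_term_comp1[of triangle, OF _ assms])
  have "definable (\<lambda>\<nu> e. (\<lambda>n k m. m = triangle n) (\<nu> 0) (\<nu> 1) (\<nu> 2))"
  proof (rule recursion_nat[where \<Phi> = "\<lambda>n k m X. (n = 0 \<and> m = 0) \<or> (\<exists>n' m'. n = Suc n' \<and> m = m' + n \<and> X n' k m')"])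
    show "(m = triangle n) = (n = 0 \<and> m = 0 \<or> (\<exists>n' m'. n = Suc n' \<and> m = m' + n \<and> m' = triangle n'))" for n m
      by (cases n) auto
  qed (intro definable_intros definable_holds0 basic_term_var basic_term_nat num_term_add, auto)
  from definable_num3[where R = "\<lambda>n k m. m = triangle n" and t = "\<lambda>\<nu> e. \<nu> 1" and u = "\<lambda>\<nu> e. \<nu> 1" and v = "\<lambda>\<nu> e. \<nu> 0", OF this num_term_var num_term_var num_term_var]
  show "num_term (\<lambda>\<nu> e. triangle (\<nu> 0))" by (simp add: num_term_def)
qed

lemma num_term_prod_encode: "num_term t \<Longrightarrow> num_term u \<Longrightarrow> num_term (\<lambda>\<nu> e. prod_encode (t \<nu> e, u \<nu> e))"
  unfolding prod_encode_def by (simp add: num_term_add num_term_triangle)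

lemma num_term_fst: "num_term t \<Longrightarrow> num_term (\<lambda>\<nu> e. fst (prod_decode (t \<nu> e)))"
proof (rule num_term_comp1[of "\<lambda>n. fst (prod_decode n)"])
  have "definable (\<lambda>\<nu> e. \<exists>k. \<nu> 1 = prod_encode (\<nu> 0, k))"
    by (intro definable_intros num_term_prod_encode)
  moreover have "(\<exists>k. n = prod_encode (m, k)) \<longleftrightarrow> m = fst (prod_decode n)" for n m
    by (metis fst_conv prod.collapse prod_decode_inverse prod_encode_inverse)
  ultimately show "num_term (\<lambda>\<nu> e. fst (prod_decode (\<nu> 0)))" by (simp add: num_term_def)
qed

lemma num_term_snd: "num_term t \<Longrightarrow> num_term (\<lambda>\<nu> e. snd (prod_decode (t \<nu> e)))"
proof (rule num_term_comp1[of "\<lambda>n. snd (prod_decode n)"])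
  have "definable (\<lambda>\<nu> e. \<exists>k. \<nu> 1 = prod_encode (k, \<nu> 0))"
    by (intro definable_intros num_term_prod_encode)
  moreover have "(\<exists>k. n = prod_encode (k, m)) \<longleftrightarrow> m = snd (prod_decode n)" for n m
    by (metis snd_conv prod.collapse prod_decode_inverse prod_encode_inverse)
  ultimately show "num_term (\<lambda>\<nu> e. snd (prod_decode (\<nu> 0)))" by (simp add: num_term_def)
qed

lemma definable_entry: "num_term t \<Longrightarrow> num_term u \<Longrightarrow> num_term v \<Longrightarrow> definable (\<lambda>\<nu> e. entry (t \<nu> e) (u \<nu> e) (v \<nu> e))"
proof (rule definable_num3[of entry], rule recursion_nat[where \<Phi> = "\<lambda>s j x X. \<exists>h t. s = Suc (prod_encode (h, t)) \<and>
    ((j = 0 \<and> x = h) \<or> (\<exists>j'. j = Suc j' \<and> X t j' x))"])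
  show "\<exists>h t. s = Suc (prod_encode (h, t)) \<and> ((j = 0 \<and> x = h) \<or> (\<exists>j'. j = Suc j' \<and> Y t j' x))"
    if "\<And>n' k' m'. n' < s \<Longrightarrow> X n' k' m' = Y n' k' m'"
      "\<exists>h t. s = Suc (prod_encode (h, t)) \<and> ((j = 0 \<and> x = h) \<or> (\<exists>j'. j = Suc j' \<and> X t j' x))" for s j x X Y
    using that le_prod_encode_2 by (metis le_imp_less_Suc)
qed (intro definable_intros definable_holds0 basic_term_var basic_term_nat num_term_prod_encode, rule entry_iff)

lemma fun_in_tree_code:
  assumes leaf: "definable (\<lambda>\<nu> e. leaf (\<nu> 0))" and Q: "definable (\<lambda>\<nu> e. Q (\<nu> 0) (\<nu> 1))" and ch: "num_term (\<lambda>\<nu> e. ch (\<nu> 0) (\<nu> 1))"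
  shows "fun_in \<A> c (tree_code leaf Q ch v)"
proof -
  let ?\<alpha> = "tree_code leaf Q ch"
  \<comment> \<open>Tells which entries of the codes are nonzero. The position is the recursion
    variable and the vertex an argument, so the codes of all vertices are computed together;
    \<open>k\<close> fills the third place of the recursion scheme.\<close>
  let ?K = "\<lambda>i v k. ?\<alpha> v (Suc i) = Suc i"
  \<comment> \<open>Recovers that the code of \<open>v\<close> has the value \<open>x\<close> at
    \<open>j\<close> from the nonzero positions recorded in \<open>X\<close>.\<close>
  let ?val = "\<lambda>X k v j x. (j = 0 \<and> (if leaf v then x = 0 else x = 1)) \<or>
    (\<exists>i. j = Suc i \<and> ((X i v k \<and> x = j) \<or> (\<not> X i v k \<and> x = 0)))"
  have val: "?val ?K k v j x \<longleftrightarrow> ?\<alpha> v j = x" for k v j x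
  proof (cases j)
    case (Suc i)
    have "?\<alpha> v (Suc i) = Suc i \<or> ?\<alpha> v (Suc i) = 0" by simp
    then show ?thesis using Suc by (auto simp del: tree_code.simps(2))
  qed auto
  have If: "definable (\<lambda>\<nu> e. if P \<nu> e then R \<nu> e else S \<nu> e)" if "definable P" "definable R" "definable S" for P R S
  proof -
    have "definable (\<lambda>\<nu> e. (P \<nu> e \<longrightarrow> R \<nu> e) \<and> (\<not> P \<nu> e \<longrightarrow> S \<nu> e))" using that by (intro definable_intros)
    then show ?thesis by simp
  qed
  note intros = definable_intros If definable_holds0 basic_term_var basic_term_nat num_term_prod_encode definable_entry num_term_fst num_term_snd
    definable_num1[OF leaf] definable_num2[OF Q] num_term_comp2[OF ch]
  have K: "definable (\<lambda>\<nu> e. ?K (\<nu> 0) (\<nu> 1) (\<nu> 2))"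
  proof (rule recursion_nat[where \<Phi> = "\<lambda>i v k X. if leaf v then Q v i else
      (\<forall>j x. entry (snd (prod_decode i)) j x \<longrightarrow> (\<exists>w. w = ch v (fst (prod_decode i)) \<and> ?val X k w j x))"])
    show "definable (\<lambda>\<nu> e. if leaf (\<nu> 1) then Q (\<nu> 1) (\<nu> 0) else
      (\<forall>j x. entry (snd (prod_decode (\<nu> 0))) j x \<longrightarrow>
        (\<exists>w. w = ch (\<nu> 1) (fst (prod_decode (\<nu> 0))) \<and> ?val (\<lambda>n. holds (e 0) (c n)) (\<nu> 2) w j x)))"
      by (intro intros)
    show "if leaf v then Q v i else
      (\<forall>j x. entry (snd (prod_decode i)) j x \<longrightarrow> (\<exists>w. w = ch v (fst (prod_decode i)) \<and> ?val Y k w j x))"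
      if XY: "\<And>n' k' m'. n' < i \<Longrightarrow> X n' k' m' = Y n' k' m'" and "if leaf v then Q v i else
      (\<forall>j x. entry (snd (prod_decode i)) j x \<longrightarrow> (\<exists>w. w = ch v (fst (prod_decode i)) \<and> ?val X k w j x))"
      for i v k X Y
    proof -
      have "?val X k w j x = ?val Y k w j x" if "entry (snd (prod_decode i)) j x" for w j x
      proof -
        have "j < length (list_decode (snd (prod_decode i)))" using that by (simp add: entry_def)
        also have "\<dots> \<le> snd (prod_decode i)" by (rule length_list_decode)
        also have "\<dots> \<le> i" using le_prod_encode_2[of "snd (prod_decode i)" "fst (prod_decode i)"] by simp
        finally have "X i' w k = Y i' w k" if "j = Suc i'" for i' using XY that by simp
        then show ?thesis by auto
      qed
      then show ?thesis using that(2) by (auto split: if_splits)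
    qed
    show "?K i v k \<longleftrightarrow> (if leaf v then Q v i else
      (\<forall>j x. entry (snd (prod_decode i)) j x \<longrightarrow> (\<exists>w. w = ch v (fst (prod_decode i)) \<and> ?val ?K k w j x)))" for i v k
      unfolding val by (auto simp: entry_def)
  qed
  have fin: "definable (\<lambda>\<nu> e. ?val K 0 v (\<nu> 1) (\<nu> 0))" if "definable (\<lambda>\<nu> e. K (\<nu> 0) (\<nu> 1) (\<nu> 2))" for K
    by (intro intros definable_num3[OF that])
  have "definable (\<lambda>\<nu> e. ?\<alpha> v (\<nu> 1) = \<nu> 0)"
    using fin[OF K] unfolding val .
  moreover have "(?\<alpha> v (\<nu> 1) = \<nu> 0) = (\<nu> 0 = ?\<alpha> v (\<nu> (Suc 0)))" for \<nu> :: "nat \<Rightarrow> nat" by auto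
  ultimately show ?thesis
    by (intro fun_inI) (simp only: num_term_def)
qed

end

section \<open>Successors of countable ordinals\<close>

definition osuc :: "omega1 \<Rightarrow> omega1" where
  "osuc \<delta> = (LEAST \<gamma>. \<delta> < \<gamma>)"

lemma less_osuc_iff: "\<gamma> < osuc \<delta> \<longleftrightarrow> \<gamma> \<le> \<delta>"
proof -
  have 1: "\<delta> < osuc \<delta>" unfolding osuc_def using omega1_gt_ex by (rule LeastI_ex)
  show ?thesis
    using 1 not_less_Least[of \<gamma> "\<lambda>\<gamma>. \<delta> < \<gamma>"] unfolding osuc_def[symmetric] by auto
qed

lemma less_osuc: "\<delta> < osuc \<delta>"
  by (simp add: less_osuc_iff)

section \<open>Baire category\<close>

definition meager :: "'a::topological_space set \<Rightarrow> bool" where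
  "meager S \<longleftrightarrow> (\<exists>F::nat \<Rightarrow> 'a set. S \<subseteq> (\<Union>n. F n) \<and> (\<forall>n. closed (F n) \<and> interior (F n) = {}))"

lemma meager_subset: "meager T \<Longrightarrow> S \<subseteq> T \<Longrightarrow> meager S"
  unfolding meager_def by (meson subset_trans)

lemma meager_nowhere_dense: "closed F \<Longrightarrow> interior F = {} \<Longrightarrow> meager F"
  unfolding meager_def by (intro exI[of _ "\<lambda>_. F"]) auto

lemma meager_empty [simp]: "meager {}"
  by (rule meager_nowhere_dense) auto

lemma meager_UN:
  assumes "\<And>n::nat. meager (S n)"
  shows "meager (\<Union>n. S n)"
proof -
  obtain F :: "nat \<Rightarrow> nat \<Rightarrow> 'a set" where F: "\<And>n. S n \<subseteq> (\<Union>k. F n k)" "\<And>n k. closed (F n k)" "\<And>n k. interior (F n k) = {}"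
    using assms unfolding meager_def by metis
  show ?thesis unfolding meager_def
  proof (intro exI[of _ "\<lambda>i. F (fst (prod_decode i)) (snd (prod_decode i))"] conjI allI F(2,3))
    show "(\<Union>n. S n) \<subseteq> (\<Union>i. F (fst (prod_decode i)) (snd (prod_decode i)))"
    proof
      fix x assume "x \<in> (\<Union>n. S n)"
      then obtain n k where "x \<in> F n k" using F(1) by blast
      then show "x \<in> (\<Union>i. F (fst (prod_decode i)) (snd (prod_decode i)))"
        by (intro UN_I[of "prod_encode (n, k)"]) simp_all
    qed
  qed
qed

lemma meager_Un:
  assumes "meager S" "meager T"
  shows "meager (S \<union> T)"
proof -
  have "meager (\<Union>n::nat. if n = 0 then S else T)" by (rule meager_UN) (simp add: assms)
  then show ?thesis by (rule meager_subset) (auto intro: UN_I[of 0] UN_I[of 1])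
qed

lemma Baire_category:
  fixes W :: "'a::polish_space set"
  assumes "meager W" "open W"
  shows "W = {}"
proof -
  obtain F :: "nat \<Rightarrow> 'a set" where F: "W \<subseteq> (\<Union>n. F n)" "\<And>n. closed (F n)" "\<And>n. interior (F n) = {}"
    using assms(1) unfolding meager_def by metis
  have "Met_TC.mtopology interior_of \<Union>(range F) = {}"
  proof (rule Met_TC.metric_Baire_category_alt)
    show "Met_TC.mcomplete TYPE('a)"
      by (simp add: complete_UNIV)
  qed (use F in auto)
  then have "interior (\<Union>n. F n) = {}" by simp
  then show ?thesis using interior_maximal[OF F(1) assms(2)] by simp
qed

definition baire_property :: "'a::topological_space set \<Rightarrow> bool" where
  "baire_property S \<longleftrightarrow> (\<exists>T. open T \<and> meager (S - T) \<and> meager (T - S))"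

lemma baire_property_open: "open S \<Longrightarrow> baire_property S"
  unfolding baire_property_def by (rule exI[of _ S]) simp

text \<open>If \<open>S\<close> is approximated by the open set \<open>T\<close>, its complement is
  approximated by the exterior of \<open>T\<close>. The additional error is the boundary of
  \<open>T\<close>, which is closed with empty interior.\<close>

lemma baire_property_Compl:
  assumes "baire_property S"
  shows "baire_property (- S)"
proof -
  obtain T where T: "open T" "meager (S - T)" "meager (T - S)"
    using assms unfolding baire_property_def by blast
  have "interior (closure T \<inter> - T) = {}"
  proof -
    let ?I = "interior (closure T \<inter> - T)"
    have "?I \<inter> T = {}" using interior_subset[of "closure T \<inter> - T"] by blast
    then have "?I \<inter> closure T = {}" using open_Int_closure_eq_empty[OF open_interior] by metis
    then show ?thesis using interior_subset[of "closure T \<inter> - T"] by blast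
  qed
  then have fr: "meager (closure T \<inter> - T)"
    using T(1) by (intro meager_nowhere_dense closed_Int) auto
  show ?thesis unfolding baire_property_def
  proof (intro exI[of _ "- closure T"] conjI)
    show "meager (- S - - closure T)"
      by (rule meager_subset[OF meager_Un[OF fr T(3)]]) auto
    show "meager (- closure T - - S)"
      by (rule meager_subset[OF T(2)]) (use closure_subset in blast)
  qed (simp add: open_Compl)
qed

lemma baire_property_UN:
  assumes "\<And>n::nat. baire_property (S n)"
  shows "baire_property (\<Union>n. S n)"
proof -
  obtain T where T: "\<And>n. open (T n)" "\<And>n. meager (S n - T n)" "\<And>n. meager (T n - S n)"
    using assms unfolding baire_property_def by metis
  show ?thesis unfolding baire_property_def
  proof (intro exI[of _ "\<Union>n. T n"] conjI open_UN ballI T(1))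
    show "meager ((\<Union>n. S n) - (\<Union>n. T n))"
      by (rule meager_subset[OF meager_UN[OF T(2)]]) auto
    show "meager ((\<Union>n. T n) - (\<Union>n. S n))"
      by (rule meager_subset[OF meager_UN[OF T(3)]]) auto
  qed
qed

section \<open>Baire property of continuous preimages of Borel sets\<close>

lemma Sigma0_low: "\<xi> \<le> 1 \<Longrightarrow> A \<in> Sigma0 \<xi> \<longleftrightarrow> open A"
  by (subst Sigma0.simps) simp

lemma Sigma0_high: "1 < \<xi> \<Longrightarrow>
    A \<in> Sigma0 \<xi> \<longleftrightarrow> (\<exists>B. A = (\<Union>n::nat. - B n) \<and> (\<forall>n. \<exists>\<eta>. 1 \<le> \<eta> \<and> \<eta> < \<xi> \<and> B n \<in> Sigma0 \<eta>))"
  by (subst Sigma0.simps) (auto simp: not_le Bex_def conj_assoc)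

lemma baire_property_vimage_Sigma0:
  assumes "A \<in> Sigma0 \<xi>" and f: "continuous_on UNIV f"
  shows "baire_property (f -` A)"
  using assms(1)
proof (induction \<xi> arbitrary: A rule: less_induct)
  case (less \<xi>)
  show ?case
  proof (cases "\<xi> \<le> 1")
    case True
    then show ?thesis
      using less.prems f by (intro baire_property_open) (auto simp: Sigma0_low intro: open_vimage)
  next
    case False
    then obtain B where B: "A = (\<Union>n::nat. - B n)" "\<And>n. \<exists>\<eta>. 1 \<le> \<eta> \<and> \<eta> < \<xi> \<and> B n \<in> Sigma0 \<eta>"
      using less.prems by (auto simp: Sigma0_high not_le)
    have "baire_property (\<Union>n. - (f -` B n))"
      using B(2) less.IH by (intro baire_property_UN baire_property_Compl) blast
    moreover have "f -` A = (\<Union>n. - (f -` B n))" using B(1) by auto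
    ultimately show ?thesis by simp
  qed
qed

section \<open>Canonical bases\<close>

lemma canonical_basis_open: "canonical_basis r U \<Longrightarrow> open (U n)"
  unfolding canonical_basis_def by (metis open_ball)

lemma canonical_basis_nonempty:
  assumes "canonical_basis r U"
  shows "U n \<noteq> {}"
proof -
  obtain i k m where "m \<ge> 1" "U n = ball (r i) (real m / real (k + 1))"
    using assms unfolding canonical_basis_def by metis
  then show ?thesis by (simp add: divide_le_0_iff)
qed

lemma canonical_basis_ex:
  assumes "recursive_presentation r" "canonical_basis r U" "open T" "p \<in> T"
  shows "\<exists>n. p \<in> U n \<and> U n \<subseteq> T"
proof -
  obtain e where e: "e > 0" "ball p e \<subseteq> T" using assms(3,4) openE by blast
  obtain k where k: "inverse (real (Suc k)) < e / 2"
    using reals_Archimedean[of "e / 2"] e(1) by auto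
  have "p \<in> closure (range r)" using assms(1) by (simp add: recursive_presentation_def)
  then obtain i where i: "dist (r i) p < 1 / real (k + 1)"
    unfolding closure_approachable by (metis of_nat_0_less_iff rangeE zero_less_divide_1_iff add_gr_0 zero_less_one)
  obtain n where n: "U n = ball (r i) (real 1 / real (k + 1))"
    using assms(2) unfolding canonical_basis_def by (metis order_refl)
  have "ball (r i) (1 / real (k + 1)) \<subseteq> ball p e"
  proof
    fix q assume "q \<in> ball (r i) (1 / real (k + 1))"
    then have "dist (r i) q < 1 / real (k + 1)" by simp
    moreover have "dist p q \<le> dist (r i) p + dist (r i) q" by (metis dist_commute dist_triangle)
    moreover have "1 / real (k + 1) < e / 2" using k by (simp add: inverse_eq_divide)
    ultimately show "q \<in> ball p e" using i by simp
  qed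
  then show ?thesis using n i e(2) by (intro exI[of _ n]) auto
qed

section \<open>Approximate orbit comparison\<close>

locale basic_action =
  fixes act :: "'g::{polish_space, topological_group_add} \<Rightarrow> 'x::polish_space \<Rightarrow> 'x"
    and V :: "nat \<Rightarrow> 'g set" and U :: "nat \<Rightarrow> 'x set"
  assumes action: "continuous_action act"
    and V_0: "V 0 = UNIV" and V_open: "\<And>n. open (V n)" and V_nonempty: "\<And>n. V n \<noteq> {}"
    and V_basis: "\<And>T g. open T \<Longrightarrow> g \<in> T \<Longrightarrow> \<exists>n. g \<in> V n \<and> V n \<subseteq> T"
    and U_open: "\<And>n. open (U n)"
    and U_basis: "\<And>T p. open T \<Longrightarrow> p \<in> T \<Longrightarrow> \<exists>n. p \<in> U n \<and> U n \<subseteq> T"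
begin

lemma act_0: "act 0 z = z" and act_add: "act (g + h) z = act g (act h z)"
  using action by (auto simp: continuous_action_def)

lemma act_minus: "act (- g) (act g z) = z" "act g (act (- g) z) = z"
  using act_add[of "- g" g z] act_add[of g "- g" z] by (simp_all add: act_0)

lemma continuous_act: "continuous_on UNIV (\<lambda>g. act g z)"
proof -
  have "continuous_on UNIV (\<lambda>(g, z). act g z)"
    using action by (simp add: continuous_action_def)
  moreover have "continuous_on UNIV (\<lambda>g. (g, z))"
    by (intro continuous_on_Pair continuous_on_id continuous_on_const)
  ultimately show ?thesis
    using continuous_on_compose2[of UNIV "\<lambda>(g, z). act g z" UNIV "\<lambda>g. (g, z)"] by simp
qed

lemma open_act_vimage: "open T \<Longrightarrow> open {g. act g z \<in> T}"
  using open_vimage[OF _ continuous_act, of T z] by (simp add: vimage_def)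

lemma invariantI:
  assumes "\<And>g z. z \<in> B \<Longrightarrow> act g z \<in> B"
  shows "invariant act B"
  unfolding invariant_def
proof (intro allI equalityI subsetI)
  fix g z assume "z \<in> B"
  then have "act (- g) z \<in> B" by (rule assms)
  then show "z \<in> act g ` B" by (metis act_minus(2) image_eqI)
qed (use assms in auto)

lemma invariantD: "invariant act B \<Longrightarrow> act g z \<in> B \<longleftrightarrow> z \<in> B"
  unfolding invariant_def by (metis act_minus(1) image_eqI)

text \<open>
  Inclusion of basic sets is not among the coded relations; this part of it is definable from
  the coded relation for inverses and still dense (lemma \<open>refines_ex\<close>).
\<close>

definition refines :: "nat \<Rightarrow> nat \<Rightarrow> bool" where
  "refines k m \<longleftrightarrow> (\<exists>l. {- g | g. g \<in> V k} \<subseteq> V l \<and> {- g | g. g \<in> V l} \<subseteq> V m)"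

lemma refines_subset: "refines k m \<Longrightarrow> V k \<subseteq> V m"
  unfolding refines_def by force

lemma open_uminus: "open T \<Longrightarrow> open {g. - g \<in> T}" for T :: "'g set"
  using open_vimage[of T uminus] by (simp add: vimage_def continuous_on_minus)

lemma open_translate: "open T \<Longrightarrow> open {g. g + h \<in> T}" for T :: "'g set"
  using open_vimage[of T "\<lambda>g. g + h"] by (simp add: vimage_def continuous_on_add)

lemma refines_ex:
  assumes "open T" "g \<in> T" "g \<in> V m"
  shows "\<exists>k. refines k m \<and> g \<in> V k \<and> V k \<subseteq> T"
proof -
  obtain l where l: "- g \<in> V l" "V l \<subseteq> {g. - g \<in> V m}"
    using V_basis[OF open_uminus[OF V_open[of m]], of "- g"] assms(3) by auto
  obtain k where k: "g \<in> V k" "V k \<subseteq> T \<inter> {g. - g \<in> V l}"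
    using V_basis[OF open_Int[OF assms(1) open_uminus[OF V_open[of l]]], of g] assms(2) l(1) by auto
  have "refines k m" unfolding refines_def using k(2) l(2) by (intro exI[of _ l]) auto
  then show ?thesis using k by blast
qed

lemma refines_ex1: "\<exists>k. refines k m"
  using V_nonempty[of m] refines_ex[OF open_UNIV] by blast

definition meets :: "'x \<Rightarrow> nat \<Rightarrow> nat \<Rightarrow> bool" where
  "meets z k j \<longleftrightarrow> (\<exists>g\<in>V k. act g z \<in> U j)"

text \<open>Joint continuity of the action at \<open>(g, z)\<close> gives a box of basic sets. The
  right-hand side speaks of \<open>z\<close> only through the basic sets containing it, and
  otherwise through coded relations; so it is definable for \<open>z = x\<close> and shows the
  condition to be open in \<open>z\<close>.\<close>

lemma meets_iff:
  "meets z k j \<longleftrightarrow> (\<exists>i. z \<in> U i \<and> (\<exists>n. refines n k \<and> {act g z | g z. g \<in> V n \<and> z \<in> U i} \<subseteq> U j))"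
proof
  assume "meets z k j"
  then obtain g where g: "g \<in> V k" "act g z \<in> U j" by (auto simp: meets_def)
  have "open ((\<lambda>(g, z). act g z) -` U j)"
    using action U_open by (intro open_vimage) (auto simp: continuous_action_def)
  then obtain S T where ST: "open S" "open T" "g \<in> S" "z \<in> T" "S \<times> T \<subseteq> (\<lambda>(g, z). act g z) -` U j"
    using g(2) by (elim open_prod_elim[where x = "(g, z)"]) auto
  obtain i where "z \<in> U i" "U i \<subseteq> T" using U_basis[OF ST(2,4)] by blast
  moreover obtain n where "refines n k" "V n \<subseteq> S" using refines_ex[OF ST(1,3) g(1)] by blast
  ultimately show "\<exists>i. z \<in> U i \<and> (\<exists>n. refines n k \<and> {act g z | g z. g \<in> V n \<and> z \<in> U i} \<subseteq> U j)"
  proof -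
    assume i: "z \<in> U i" "U i \<subseteq> T" and n: "refines n k" "V n \<subseteq> S"
    have "{act g z | g z. g \<in> V n \<and> z \<in> U i} \<subseteq> U j"
    proof (clarify)
      fix g z' assume "g \<in> V n" "z' \<in> U i"
      then have "(g, z') \<in> S \<times> T" using i(2) n(2) by auto
      then show "act g z' \<in> U j" using ST(5) by auto
    qed
    then show ?thesis using i(1) n(1) by blast
  qed
next
  assume "\<exists>i. z \<in> U i \<and> (\<exists>n. refines n k \<and> {act g z | g z. g \<in> V n \<and> z \<in> U i} \<subseteq> U j)"
  then obtain i n where *: "z \<in> U i" "refines n k" "{act g z | g z. g \<in> V n \<and> z \<in> U i} \<subseteq> U j" by blast
  obtain g where "g \<in> V n" using V_nonempty by blast
  then show "meets z k j" using * refines_subset unfolding meets_def by blast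
qed

text \<open>
  \<open>approx_le b z k w m\<close> is the relation \<open>(z, V k) \<le>\<^sub>1\<^sub>+\<^sub>b (w, V m)\<close> of Hjorth's analysis of Polish group
  actions. At level 0 it says that \<open>V k \<cdot> z\<close> is contained in the closure of \<open>V m \<cdot> w\<close>.
\<close>

function approx_le :: "omega1 \<Rightarrow> 'x \<Rightarrow> nat \<Rightarrow> 'x \<Rightarrow> nat \<Rightarrow> bool" where
  "approx_le b z k w m \<longleftrightarrow> (\<forall>j. meets z k j \<longrightarrow> meets w m j) \<and>
    (\<forall>a\<in>{..<b}. \<forall>k'. refines k' k \<longrightarrow> (\<exists>m'. refines m' m \<and> approx_le a w m' z k'))"
  by auto
termination
  by (relation "inv_image {(\<eta>, \<xi>). \<eta> < \<xi>} (\<lambda>(b, _). b)") (rule wf_inv_image[OF wf], simp)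

declare approx_le.simps [simp del]

lemma approx_le_iff: "approx_le b z k w m \<longleftrightarrow> (\<forall>j. meets z k j \<longrightarrow> meets w m j) \<and>
    (\<forall>a<b. \<forall>k'. refines k' k \<longrightarrow> (\<exists>m'. refines m' m \<and> approx_le a w m' z k'))"
  by (subst approx_le.simps) (simp only: Ball_def lessThan_iff)

lemma approx_leI: "(\<And>j. meets z k j \<Longrightarrow> meets w m j) \<Longrightarrow>
    (\<And>a k'. a < b \<Longrightarrow> refines k' k \<Longrightarrow> \<exists>m'. refines m' m \<and> approx_le a w m' z k') \<Longrightarrow> approx_le b z k w m"
  unfolding approx_le.simps[of b] by simp

lemma approx_le_meets: "approx_le b z k w m \<Longrightarrow> meets z k j \<Longrightarrow> meets w m j"
  and approx_le_step: "approx_le b z k w m \<Longrightarrow> a < b \<Longrightarrow> refines k' k \<Longrightarrow> \<exists>m'. refines m' m \<and> approx_le a w m' z k'"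
  unfolding approx_le.simps[of b] by auto

lemma approx_le_antimono: "approx_le b z k w m \<Longrightarrow> a \<le> b \<Longrightarrow> approx_le a z k w m"
  by (rule approx_leI) (auto dest: approx_le_meets intro: approx_le_step)

lemma approx_le_trans: "approx_le b z k w m \<Longrightarrow> approx_le b w m v n \<Longrightarrow> approx_le b z k v n"
proof (induction b arbitrary: z k w m v n rule: less_induct)
  case (less b)
  show ?case
  proof (rule approx_leI)
    show "meets v n j" if "meets z k j" for j
      using less.prems that approx_le_meets by blast
    show "\<exists>n'. refines n' n \<and> approx_le a v n' z k'" if a: "a < b" and k': "refines k' k" for a k'
    proof -
      obtain m' where m': "refines m' m" "approx_le a w m' z k'" using approx_le_step[OF less.prems(1) a k'] by blast
      obtain n' where "refines n' n" "approx_le a v n' w m'" using approx_le_step[OF less.prems(2) a m'(1)] by blast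
      then show ?thesis using less.IH[OF a _ m'(2)] by blast
    qed
  qed
qed

text \<open>A piece of the orbit seen from \<open>act h z\<close> is a piece seen from
  \<open>z\<close> over a translated set of group elements. A challenge \<open>k'\<close> is
  answered by a basic set inside \<open>V k' + h\<close>, and since the sides are then exchanged,
  the induction hypothesis applies with \<open>- h\<close>.\<close>

lemma approx_le_translate: "(\<And>g. g \<in> V k \<Longrightarrow> g + h \<in> V m) \<Longrightarrow> approx_le b (act h z) k z m"
proof (induction b arbitrary: h z k m rule: less_induct)
  case (less b)
  show ?case
  proof (rule approx_leI)
    show "meets z m j" if "meets (act h z) k j" for j
      using that less.prems unfolding meets_def by (metis act_add)
    show "\<exists>m'. refines m' m \<and> approx_le a z m' (act h z) k'" if a: "a < b" and k': "refines k' k" for a k'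
    proof -
      obtain g where g: "g \<in> V k'" using V_nonempty by blast
      have "open {g. g + - h \<in> V k'}" by (rule open_translate[OF V_open])
      moreover have "g + h \<in> V m" using less.prems g refines_subset[OF k'] by blast
      ultimately obtain m' where m': "refines m' m" "V m' \<subseteq> {g. g + - h \<in> V k'}"
        using refines_ex[of "{g. g + - h \<in> V k'}" "g + h" m] g by (auto simp: add.assoc)
      have "approx_le a (act (- h) (act h z)) m' (act h z) k'"
        by (rule less.IH[OF a]) (use m'(2) in auto)
      then show ?thesis using m'(1) by (auto simp: act_minus)
    qed
  qed
qed

lemma approx_le_subset: "V k \<subseteq> V m \<Longrightarrow> approx_le b z k z m"
  using approx_le_translate[of k 0 m b z] by (auto simp: act_0)

lemma approx_le_osuc: "approx_le (osuc b) z k w m \<longleftrightarrow>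
    approx_le b z k w m \<and> (\<forall>k'. refines k' k \<longrightarrow> (\<exists>m'. refines m' m \<and> approx_le b w m' z k'))"
proof (intro iffI conjI allI impI)
  assume "approx_le (osuc b) z k w m"
  then show "approx_le b z k w m" "refines k' k \<Longrightarrow> \<exists>m'. refines m' m \<and> approx_le b w m' z k'" for k'
    using approx_le_antimono less_osuc[of b] approx_le_step by (blast intro: less_imp_le)+
next
  assume *: "approx_le b z k w m \<and> (\<forall>k'. refines k' k \<longrightarrow> (\<exists>m'. refines m' m \<and> approx_le b w m' z k'))"
  show "approx_le (osuc b) z k w m"
  proof (rule approx_leI)
    show "\<exists>m'. refines m' m \<and> approx_le a w m' z k'" if "a < osuc b" "refines k' k" for a k'
      using * that approx_le_antimono by (auto simp: less_osuc_iff) blast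
  qed (use * approx_le_meets in blast)
qed

text \<open>Since basic sets on both sides are quantified, a translation of \<open>z\<close> can be
  absorbed by translating the witness, and in \<open>dominating\<close> the challenge. This is the
  source of invariance.\<close>

definition dominated :: "omega1 \<Rightarrow> 'x \<Rightarrow> 'x set" where
  "dominated b x = {z. \<forall>k. \<exists>m. approx_le b z m x k}"

definition dominating :: "omega1 \<Rightarrow> 'x \<Rightarrow> 'x set" where
  "dominating b x = {z. \<forall>m. \<exists>k. approx_le b x k z m}"

lemma self_dominated: "x \<in> dominated b x" and self_dominating: "x \<in> dominating b x"
  unfolding dominated_def dominating_def using approx_le_subset by blast+

lemma translate_ex: "\<exists>m'. \<forall>g\<in>V m'. g + h \<in> V m"
proof -
  obtain g where "g \<in> V m" using V_nonempty by blast
  then show ?thesis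
    using V_basis[OF open_translate[OF V_open, of h m], of "g + - h"] by (auto simp: add.assoc)
qed

lemma invariant_dominated: "invariant act (dominated b x)"
proof (rule invariantI)
  fix h z assume z: "z \<in> dominated b x"
  show "act h z \<in> dominated b x" unfolding dominated_def
  proof (clarify)
    fix k
    obtain m where "approx_le b z m x k" using z unfolding dominated_def by blast
    moreover obtain m' where "\<forall>g\<in>V m'. g + h \<in> V m" using translate_ex by blast
    ultimately show "\<exists>m. approx_le b (act h z) m x k"
      using approx_le_translate approx_le_trans by meson
  qed
qed

lemma invariant_dominating: "invariant act (dominating b x)"
proof (rule invariantI)
  fix h z assume z: "z \<in> dominating b x"
  show "act h z \<in> dominating b x" unfolding dominating_def
  proof (clarify)
    fix m
    obtain m' where "\<forall>g\<in>V m'. g + - h \<in> V m" using translate_ex by blast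
    then have "approx_le b z m' (act h z) m"
      using approx_le_translate[of m' "- h" m b "act h z"] by (simp add: act_minus)
    moreover obtain k where "approx_le b x k z m'" using z unfolding dominating_def by blast
    ultimately show "\<exists>k. approx_le b x k (act h z) m"
      using approx_le_trans by blast
  qed
qed

subsection \<open>Transfer of Borel sets\<close>

text \<open>The Vaught transform of \<open>A\<close>, relative to the open set \<open>V k\<close>,
  as a condition on \<open>z\<close>.\<close>

abbreviation forced :: "'x set \<Rightarrow> 'x \<Rightarrow> nat \<Rightarrow> bool" where
  "forced A z k \<equiv> meager {g \<in> V k. act g z \<notin> A}"

lemma forced_nonempty:
  assumes "meager {g \<in> V k. P g}"
  shows "\<exists>g\<in>V k. \<not> P g"
proof (rule ccontr)
  assume "\<not> ?thesis"
  then have "{g \<in> V k. P g} = V k" by blast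
  then show False using assms Baire_category[OF _ V_open] V_nonempty by metis
qed

text \<open>A nonmeager set with the Baire property is comeager in some nonempty open set, and the
  orbit map pulls Borel sets back to sets with the Baire property.\<close>

lemma localize:
  assumes "B \<in> Sigma0 \<xi> \<union> Pi0 \<xi>" and "\<not> meager {g \<in> V k. act g z \<in> B}"
  shows "\<exists>k'. refines k' k \<and> forced B z k'"
proof -
  let ?S = "{g. act g z \<in> B}"
  have "baire_property ((\<lambda>g. act g z) -` B)"
    using assms(1)
  proof
    assume "B \<in> Pi0 \<xi>"
    then obtain A where "B = - A" "A \<in> Sigma0 \<xi>" by (auto simp: Pi0_def)
    then show ?thesis
      using baire_property_Compl[OF baire_property_vimage_Sigma0[OF _ continuous_act]] by (simp add: vimage_Compl)
  qed (rule baire_property_vimage_Sigma0[OF _ continuous_act])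
  then obtain T where T: "open T" "meager (?S - T)" "meager (T - ?S)"
    unfolding baire_property_def vimage_def by blast
  have "T \<inter> V k \<noteq> {}"
  proof
    assume "T \<inter> V k = {}"
    then have "{g \<in> V k. act g z \<in> B} \<subseteq> ?S - T" by blast
    then show False using assms(2) meager_subset[OF T(2)] by blast
  qed
  then obtain k' where "refines k' k" "V k' \<subseteq> T" using refines_ex[OF T(1)] by blast
  moreover from this have "{g \<in> V k'. act g z \<notin> B} \<subseteq> T - ?S" by blast
  ultimately show ?thesis using meager_subset[OF T(3)] by blast
qed

lemma localize_UN:
  assumes "\<And>n::nat. \<exists>\<eta>. B n \<in> Sigma0 \<eta>" and "\<not> meager {g \<in> V k. act g z \<in> (\<Union>n. - B n)}"
  shows "\<exists>n k'. refines k' k \<and> forced (- B n) z k'"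
proof -
  have "{g \<in> V k. act g z \<in> (\<Union>n. - B n)} = (\<Union>n. {g \<in> V k. act g z \<in> - B n})" by auto
  then obtain n where n: "\<not> meager {g \<in> V k. act g z \<in> - B n}"
    using assms(2) meager_UN[of "\<lambda>n. {g \<in> V k. act g z \<in> - B n}"] by metis
  obtain \<eta> where "B n \<in> Sigma0 \<eta>" using assms(1) by blast
  then have "- B n \<in> Sigma0 \<eta> \<union> Pi0 \<eta>" by (auto simp: Pi0_def)
  from localize[OF this n] show ?thesis by blast
qed

text \<open>If the conclusion fails, some \<open>- B n\<close> holds comeagerly on a refinement of
  \<open>V k\<close> for \<open>z\<close>. The back-and-forth provides a refinement of
  \<open>V m\<close> below it, and the induction hypothesis, with the sides exchanged, moves
  \<open>- B n\<close> there for \<open>w\<close>. As \<open>- B n\<close> is part of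
  \<open>A\<close>, this contradicts the assumption on \<open>w\<close>.\<close>

lemma forced_approx_le:
  assumes "A \<in> Sigma0 b" "approx_le b z k w m" "forced (- A) w m"
  shows "forced (- A) z k"
  using assms
proof (induction b arbitrary: A z k w m rule: less_induct)
  case (less b)
  show ?case
  proof (cases "b \<le> 1")
    case True
    then have A: "open A" using less.prems(1) by (simp add: Sigma0_low)
    have "{g \<in> V m. act g w \<notin> - A} = V m \<inter> {g. act g w \<in> A}" by auto
    \<comment> \<open>The condition is open in \<open>g\<close>, so if it holds only on a meager
      set, it holds nowhere.\<close>
    then have w: "{g \<in> V m. act g w \<notin> - A} = {}"
      using less.prems(3) Baire_category open_Int[OF V_open open_act_vimage[OF A]] by metis
    have "{g \<in> V k. act g z \<notin> - A} = {}"
    proof (rule ccontr)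
      assume "\<not> ?thesis"
      then obtain g where g: "g \<in> V k" "act g z \<in> A" by auto
      then obtain j where j: "act g z \<in> U j" "U j \<subseteq> A" using U_basis[OF A] by blast
      then have "meets w m j" using approx_le_meets[OF less.prems(2)] g(1) by (auto simp: meets_def)
      then show False using w j(2) by (auto simp: meets_def)
    qed
    then show ?thesis by (simp only: meager_empty)
  next
    case False
    then obtain B where B: "A = (\<Union>n::nat. - B n)" "\<And>n. \<exists>\<eta>. 1 \<le> \<eta> \<and> \<eta> < b \<and> B n \<in> Sigma0 \<eta>"
      using less.prems(1) by (auto simp: Sigma0_high not_le)
    show ?thesis
    proof (rule ccontr)
      assume "\<not> ?thesis"
      then have "\<not> meager {g \<in> V k. act g z \<in> (\<Union>n. - B n)}" using B(1) by simp
      then obtain n k' where nk: "refines k' k" "forced (- B n) z k'"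
        using localize_UN[of B k z] B(2) by blast
      obtain \<eta> where \<eta>: "\<eta> < b" "B n \<in> Sigma0 \<eta>" using B(2) by blast
      obtain m' where m': "refines m' m" "approx_le \<eta> w m' z k'" using approx_le_step[OF less.prems(2) \<eta>(1) nk(1)] by blast
      have "forced (- B n) w m'" by (rule less.IH[OF \<eta> m'(2) nk(2)])
      from meager_Un[OF this less.prems(3)]
      have *: "meager {g \<in> V m'. act g w \<notin> - B n \<or> act g w \<notin> - A}"
        by (rule meager_subset) (use refines_subset[OF m'(1)] in blast)
      then show False using forced_nonempty[OF *] B(1) by blast
    qed
  qed
qed

text \<open>Beyond rank 1, some \<open>- C n\<close> with \<open>C n\<close> of lower rank holds
  comeagerly on a piece of the orbit of \<open>x\<close>; domination gives a piece of the orbit of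
  \<open>y\<close> below it at that lower level. By invariance a single translate of
  \<open>y\<close> in the set is enough.\<close>

lemma Sigma0_transfer:
  assumes "1 \<le> \<alpha>" "B \<in> Sigma0 \<alpha>" "invariant act B"
    and y: "\<And>b. b < \<alpha> \<Longrightarrow> y \<in> dominated b x \<and> y \<in> dominating b x" and x: "x \<in> B"
  shows "y \<in> B"
proof (cases "\<alpha> \<le> 1")
  case True
  then have B: "open B" using assms(2) by (simp add: Sigma0_low)
  have "0 < \<alpha>" using assms(1) by (simp add: one_le_iff_omega1)
  \<comment> \<open>At rank 1 membership is witnessed by a basic set meeting the orbit, so the
    comparison from \<open>x\<close> to \<open>y\<close> at level 0 is used; \<open>V 0\<close> is
    the whole group.\<close>
  then obtain k where k: "approx_le 0 x k y 0" using y unfolding dominating_def by blast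
  obtain g where g: "g \<in> V k" using V_nonempty by blast
  have "act g x \<in> B" using x assms(3) invariantD by blast
  then obtain j where j: "act g x \<in> U j" "U j \<subseteq> B" using U_basis[OF B] by blast
  then have "meets y 0 j" using approx_le_meets[OF k] g by (auto simp: meets_def)
  then show ?thesis using j(2) invariantD[OF assms(3)] by (auto simp: meets_def)
next
  case False
  then obtain C where C: "B = (\<Union>n::nat. - C n)" "\<And>n. \<exists>\<eta>. 1 \<le> \<eta> \<and> \<eta> < \<alpha> \<and> C n \<in> Sigma0 \<eta>"
    using assms(2) by (auto simp: Sigma0_high not_le)
  have "\<not> meager {g \<in> V 0. act g x \<in> (\<Union>n. - C n)}"
    using forced_nonempty[of 0 "\<lambda>g. act g x \<in> (\<Union>n. - C n)"] invariantD[OF assms(3), of _ x] x C(1) by blast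
  then obtain n k where nk: "forced (- C n) x k"
    using localize_UN[of C 0 x] C(2) by blast
  obtain \<eta> where \<eta>: "\<eta> < \<alpha>" "C n \<in> Sigma0 \<eta>" using C(2) by blast
  obtain m where "approx_le \<eta> y m x k" using y[OF \<eta>(1)] unfolding dominated_def by blast
  from forced_approx_le[OF \<eta>(2) this nk] have *: "forced (- C n) y m" .
  obtain g where "act g y \<in> - C n"
    using forced_nonempty[OF *] by blast
  then show ?thesis using C(1) invariantD[OF assms(3), of g y] by blast
qed

subsection \<open>Stabilization\<close>

text \<open>By \<open>approx_le_osuc\<close> this says that the levels \<open>b\<close> and
  \<open>osuc b\<close> of the comparison of \<open>x\<close> with itself coincide.\<close>

definition stable :: "omega1 \<Rightarrow> 'x \<Rightarrow> bool" where
  "stable b x \<longleftrightarrow> (\<forall>k m. approx_le b x k x m \<longrightarrow> (\<forall>k'. refines k' k \<longrightarrow> (\<exists>m'. refines m' m \<and> approx_le b x m' x k')))"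

text \<open>Level \<open>b\<close> is closed under the back-and-forth step and is therefore
  contained in every level.\<close>

lemma stable_approx_le:
  assumes st: "stable b x" and "approx_le b x k x m"
  shows "approx_le a x k x m"
  using assms(2)
proof (induction a arbitrary: k m rule: less_induct)
  case (less a)
  show ?case
  proof (rule approx_leI)
    show "meets x m j" if "meets x k j" for j using approx_le_meets less.prems that by blast
    show "\<exists>m'. refines m' m \<and> approx_le a' x m' x k'" if "a' < a" "refines k' k" for a' k'
      using st less.prems that less.IH unfolding stable_def by blast
  qed
qed

lemma stable_mono: "stable b x \<Longrightarrow> b \<le> a \<Longrightarrow> stable a x"
  unfolding stable_def using stable_approx_le[of b x] approx_le_antimono by (metis stable_def)

text \<open>The reply is found through \<open>x\<close> alone: a piece of \<open>x\<close> below the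
  challenge \<open>m0\<close> is also below \<open>(x, V k)\<close>, where stability raises the
  comparison by one level and so provides a refinement of \<open>k\<close>.\<close>

lemma stable_dominating:
  assumes st: "stable b x" and y: "y \<in> dominating b x" and approx_le: "approx_le b y m x k"
  shows "approx_le (osuc b) y m x k"
proof -
  have "\<exists>k1. refines k1 k \<and> approx_le b x k1 y m0" if m0: "refines m0 m" for m0
  proof -
    obtain k2 where k2: "approx_le b x k2 y m0" using y unfolding dominating_def by blast
    have "approx_le b x k2 x k"
      using approx_le_trans[OF approx_le_trans[OF k2 approx_le_subset[OF refines_subset[OF m0]]] approx_le] .
    then have *: "approx_le (osuc b) x k2 x k" by (rule stable_approx_le[OF st])
    \<comment> \<open>The raised comparison answers challenges that refine \<open>k2\<close>; as
      \<open>refines\<close> need not be reflexive, \<open>k2\<close> cannot serve as its own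
      challenge.\<close>
    obtain k3 where k3: "refines k3 k2" using refines_ex1 by blast
    obtain k1 where k1: "refines k1 k" "approx_le b x k1 x k3" using approx_le_step[OF * less_osuc k3] by blast
    have "approx_le b x k1 y m0"
      using approx_le_trans[OF approx_le_trans[OF k1(2) approx_le_subset[OF refines_subset[OF k3]]] k2] .
    then show ?thesis using k1(1) by blast
  qed
  then show ?thesis using approx_le by (simp add: approx_le_osuc)
qed

text \<open>Level \<open>osuc b\<close> is closed under the back-and-forth step in both directions.
  From \<open>y\<close> to \<open>x\<close> this is \<open>stable_dominating\<close> at
  \<open>osuc b\<close>; from \<open>x\<close> to \<open>y\<close> a reply is obtained at level
  \<open>b\<close> and raised by \<open>stable_dominating\<close> at \<open>b\<close>.\<close>

lemma stable_all:
  assumes st: "stable b x" and y: "y \<in> dominating b x" "y \<in> dominating (osuc b) x" "y \<in> dominated (osuc b) x"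
  shows "y \<in> dominated a x \<and> y \<in> dominating a x"
proof -
  let ?b = "osuc b"
  have st': "stable ?b x" using stable_mono[OF st] less_osuc by (blast intro: less_imp_le)
  have 1: "approx_le (osuc ?b) y m x k" if "approx_le ?b y m x k" for m k
    by (rule stable_dominating[OF st' y(2) that])
  have 2: "approx_le (osuc ?b) x k y m" if approx_le: "approx_le ?b x k y m" for m k
    unfolding approx_le_osuc[of ?b]
  proof (intro conjI approx_le allI impI)
    fix k' assume "refines k' k"
    then obtain m' where "refines m' m" "approx_le b y m' x k'" using approx_le_step[OF approx_le less_osuc] by blast
    then show "\<exists>m'. refines m' m \<and> approx_le ?b y m' x k'" using stable_dominating[OF st y(1)] by blast
  qed
  \<comment> \<open>Each step exchanges the sides, so both directions are proved in one
    induction.\<close>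
  have "(\<forall>k m. approx_le ?b y m x k \<longrightarrow> approx_le a y m x k) \<and> (\<forall>k m. approx_le ?b x k y m \<longrightarrow> approx_le a x k y m)"
  proof (induction a rule: less_induct)
    case (less a)
    have "approx_le a y m x k" if approx_le: "approx_le ?b y m x k" for k m
    proof (rule approx_leI)
      show "meets x k j" if "meets y m j" for j using approx_le_meets[OF approx_le that] .
      show "\<exists>k'. refines k' k \<and> approx_le a' x k' y m'" if "a' < a" "refines m' m" for a' m'
        using approx_le_step[OF 1[OF approx_le] less_osuc that(2)] less.IH[OF that(1)] by blast
    qed
    moreover have "approx_le a x k y m" if approx_le: "approx_le ?b x k y m" for k m
    proof (rule approx_leI)
      show "meets y m j" if "meets x k j" for j using approx_le_meets[OF approx_le that] .
      show "\<exists>m'. refines m' m \<and> approx_le a' y m' x k'" if "a' < a" "refines k' k" for a' k'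
        using approx_le_step[OF 2[OF approx_le] less_osuc that(2)] less.IH[OF that(1)] by blast
    qed
    ultimately show ?case by blast
  qed
  then show ?thesis using y(2,3) unfolding dominated_def dominating_def by blast
qed

end

section \<open>Codes for the levels of the comparison\<close>

locale coded_action =
  omega_admissible \<A> c d l + basic_action act V U
  for \<A> :: "('a, 'r) ustruct" and c d l
    and act :: "'g::{polish_space, topological_group_add} \<Rightarrow> 'x::polish_space \<Rightarrow> 'x" and V U +
  fixes x :: 'x
  assumes group_codable: "group_codable \<A> c V" and action_codable: "action_codable \<A> c V U act"
    and point_codable: "point_codable \<A> c U x"
begin

section \<open>Definability of the relations attached to the action\<close>

lemma definable_refines: "num_term t \<Longrightarrow> num_term u \<Longrightarrow> definable (\<lambda>\<nu> e. refines (t \<nu> e) (u \<nu> e))"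
proof (rule definable_num2[of refines])
  have "definable (\<lambda>\<nu> e. \<exists>l. (\<nu> 0, l) \<in> {(k, l). {- g | g. g \<in> V k} \<subseteq> V l} \<and>
      (l, \<nu> 1) \<in> {(k, l). {- g | g. g \<in> V k} \<subseteq> V l})"
    using group_codable unfolding group_codable_def by (intro definable_intros definable_rel2I) auto
  then show "definable (\<lambda>\<nu> e. refines (\<nu> 0) (\<nu> 1))" by (simp add: refines_def)
qed

text \<open>The part of \<open>meets_iff\<close> that does not mention the point. It decides
  \<open>meets x\<close> from the code of \<open>x\<close>, and it lists the basic sets making up
  the open set of all \<open>z\<close> with \<open>meets z k j\<close>.\<close>

definition hit :: "nat \<Rightarrow> nat \<Rightarrow> nat \<Rightarrow> bool" where
  "hit k j i \<longleftrightarrow> (\<exists>n. refines n k \<and> (n, i, j) \<in> {(k, i, j). {act g z | g z. g \<in> V k \<and> z \<in> U i} \<subseteq> U j})"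

lemma definable_hit: "num_term t \<Longrightarrow> num_term u \<Longrightarrow> num_term v \<Longrightarrow> definable (\<lambda>\<nu> e. hit (t \<nu> e) (u \<nu> e) (v \<nu> e))"
proof (rule definable_num3[of hit])
  show "definable (\<lambda>\<nu> e. hit (\<nu> 0) (\<nu> 1) (\<nu> 2))"
    using action_codable unfolding action_codable_def hit_def by (intro definable_intros definable_refines definable_rel3I)
qed

lemma meets_hit: "meets z k j \<longleftrightarrow> (\<exists>i. z \<in> U i \<and> hit k j i)"
  by (simp add: meets_iff hit_def)

lemma definable_meets: "num_term t \<Longrightarrow> num_term u \<Longrightarrow> definable (\<lambda>\<nu> e. meets x (t \<nu> e) (u \<nu> e))"
proof (rule definable_num2[of "meets x"])
  have "definable (\<lambda>\<nu> e. \<exists>i. i \<in> {n. x \<in> U n} \<and> hit (\<nu> 0) (\<nu> 1) i)"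
    using point_codable unfolding point_codable_def by (intro definable_intros definable_setI definable_hit)
  then show "definable (\<lambda>\<nu> e. meets x (\<nu> 0) (\<nu> 1))" by (simp add: meets_hit)
qed

text \<open>\<open>K\<close> is the kind. For comparisons, \<open>t\<close> is the direction (0 if
  the variable point is below \<open>x\<close>), \<open>q\<close> names the level, and
  \<open>u\<close>, \<open>v\<close> belong to the lower and the upper side. For kinds 0 and 1,
  \<open>v\<close> is the index of a basic set of the space.\<close>

definition vertex :: "nat \<Rightarrow> nat \<Rightarrow> nat \<Rightarrow> nat \<Rightarrow> nat \<Rightarrow> nat" where
  "vertex K t q u v = prod_encode (K, prod_encode (t, prod_encode (q, prod_encode (u, v))))"

definition vK :: "nat \<Rightarrow> nat" where "vK n = fst (prod_decode n)"
definition vt :: "nat \<Rightarrow> nat" where "vt n = fst (prod_decode (snd (prod_decode n)))"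
definition vq :: "nat \<Rightarrow> nat" where "vq n = fst (prod_decode (snd (prod_decode (snd (prod_decode n)))))"
definition vu :: "nat \<Rightarrow> nat" where
  "vu n = fst (prod_decode (snd (prod_decode (snd (prod_decode (snd (prod_decode n)))))))"
definition vv :: "nat \<Rightarrow> nat" where
  "vv n = snd (prod_decode (snd (prod_decode (snd (prod_decode (snd (prod_decode n)))))))"

lemma vertex_sel [simp]:
  "vK (vertex K t q u v) = K" "vt (vertex K t q u v) = t" "vq (vertex K t q u v) = q"
  "vu (vertex K t q u v) = u" "vv (vertex K t q u v) = v"
  by (simp_all add: vertex_def vK_def vt_def vq_def vu_def vv_def)

lemma num_term_vertex:
  "num_term K \<Longrightarrow> num_term t \<Longrightarrow> num_term q \<Longrightarrow> num_term u \<Longrightarrow> num_term v \<Longrightarrow> num_term (\<lambda>\<nu> e. vertex (K \<nu> e) (t \<nu> e) (q \<nu> e) (u \<nu> e) (v \<nu> e))"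
  unfolding vertex_def by (intro num_term_prod_encode)

lemma num_term_vertex_sel:
  assumes "num_term n"
  shows "num_term (\<lambda>\<nu> e. vK (n \<nu> e))" "num_term (\<lambda>\<nu> e. vt (n \<nu> e))" "num_term (\<lambda>\<nu> e. vq (n \<nu> e))"
    "num_term (\<lambda>\<nu> e. vu (n \<nu> e))" "num_term (\<lambda>\<nu> e. vv (n \<nu> e))"
  unfolding vK_def vt_def vq_def vu_def vv_def by (intro num_term_fst num_term_snd assms)+

text \<open>
  The graph whose vertices are names of the sets needed to build up the levels of the comparison
  from open sets with the single operation \<open>\<Union>n. - A n\<close>: a vertex of kind 2 names the complement of
  a level, one of kind 3 the union of the levels over basic subsets, and kinds 4 and 5 take care of
  the two outermost quantifiers. The numbers \<open>q\<close> name ordinals, ordered by \<open>prec\<close>.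
\<close>

definition vleaf :: "nat \<Rightarrow> bool" where
  "vleaf n \<longleftrightarrow> vK n = 0 \<or> 5 < vK n"

definition vopen :: "nat \<Rightarrow> nat \<Rightarrow> bool" where
  "vopen n i \<longleftrightarrow> 5 < vK n \<or> hit (vu n) (vv n) i"

text \<open>A leaf for the whole space. Its complement adds nothing to a union, so it pads families
  that are indexed by only some of the numbers.\<close>

definition full :: nat where
  "full = vertex 6 0 0 0 0"

text \<open>At kind 2, a point lies outside a level for one of two reasons, told apart by the first
  component of \<open>i\<close>: a basic set met on the lower side only, or a smaller ordinal with a
  challenge that has no reply. Replies compare in the opposite direction, so \<open>t\<close> is
  flipped. Conditions on \<open>x\<close> are decided here, while those on the variable point become
  open sets or their complements.\<close>

definition vchild :: "(nat \<Rightarrow> nat \<Rightarrow> bool) \<Rightarrow> nat \<Rightarrow> nat \<Rightarrow> nat" where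
  "vchild prec n i =
    (if vK n = 1 then vertex 0 0 0 (vu n) (vv n)
     else if vK n = 2 then
       (if fst (prod_decode i) = 0 then
          (if vt n = 0 then
            (if meets x (vv n) (snd (prod_decode i)) then full else vertex 1 0 0 (vu n) (snd (prod_decode i)))
           else (if meets x (vu n) (snd (prod_decode i)) then vertex 0 0 0 (vv n) (snd (prod_decode i)) else full))
        else
          (if prec (fst (prod_decode (snd (prod_decode i)))) (vq n) \<and> refines (snd (prod_decode (snd (prod_decode i)))) (vu n)
           then vertex 3 (if vt n = 0 then 1 else 0) (fst (prod_decode (snd (prod_decode i)))) (vv n) (snd (prod_decode (snd (prod_decode i))))
           else full))
     else if vK n = 3 then (if refines i (vu n) then vertex 2 (vt n) (vq n) i (vv n) else full)
     else if vK n = 4 then vertex 2 (vt n) (vq n) i (vv n)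
     else vertex 4 (vt n) (vq n) 0 i)"

definition level :: "(nat \<Rightarrow> omega1) \<Rightarrow> nat \<Rightarrow> nat \<Rightarrow> nat \<Rightarrow> nat \<Rightarrow> 'x set" where
  "level lev t q u v = {z. if t = 0 then approx_le (lev q) z u x v else approx_le (lev q) x u z v}"

definition vset :: "(nat \<Rightarrow> omega1) \<Rightarrow> nat \<Rightarrow> 'x set" where
  "vset lev n =
    (if vK n = 0 then {z. meets z (vu n) (vv n)}
     else if vK n = 1 then {z. \<not> meets z (vu n) (vv n)}
     else if vK n = 2 then - level lev (vt n) (vq n) (vu n) (vv n)
     else if vK n = 3 then (\<Union>w\<in>{w. refines w (vu n)}. level lev (vt n) (vq n) w (vv n))
     else if vK n = 4 then (\<Union>w. level lev (vt n) (vq n) w (vv n))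
     else if vK n = 5 then (\<Union>a. - (\<Union>w. level lev (vt n) (vq n) w a))
     else UNIV)"

lemma vset_full [simp]: "vset lev full = UNIV"
  by (simp add: vset_def full_def)

lemma vset_vertex [simp]:
  "vset lev (vertex 0 t q u v) = {z. meets z u v}"
  "vset lev (vertex 1 t q u v) = {z. \<not> meets z u v}"
  "vset lev (vertex 2 t q u v) = - level lev t q u v"
  "vset lev (vertex 3 t q u v) = (\<Union>w\<in>{w. refines w u}. level lev t q w v)"
  "vset lev (vertex 4 t q u v) = (\<Union>w. level lev t q w v)"
  "vset lev (vertex 5 t q u v) = (\<Union>a. - (\<Union>w. level lev t q w a))"
  by (simp_all add: vset_def)

lemma vset_leaf: "vleaf n \<Longrightarrow> vset lev n = \<Union>{U i | i. vopen n i}"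
  using U_basis[OF open_UNIV] by (auto simp: vleaf_def vset_def vopen_def meets_hit)

lemma level_iff:
  "z \<in> level lev 0 q u v \<longleftrightarrow> (\<forall>j. meets z u j \<longrightarrow> meets x v j) \<and>
    (\<forall>a<lev q. \<forall>u'. refines u' u \<longrightarrow> (\<exists>v'. refines v' v \<and> approx_le a x v' z u'))"
  "t \<noteq> 0 \<Longrightarrow> z \<in> level lev t q u v \<longleftrightarrow> (\<forall>j. meets x u j \<longrightarrow> meets z v j) \<and>
    (\<forall>a<lev q. \<forall>u'. refines u' u \<longrightarrow> (\<exists>v'. refines v' v \<and> approx_le a z v' x u'))"
  by (simp_all add: level_def approx_le_iff[of "lev q"])

lemma vset_node:
  assumes lev: "\<And>q a. a < lev q \<longleftrightarrow> (\<exists>p. prec p q \<and> lev p = a)" and n: "\<not> vleaf n"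
  shows "vset lev n = (\<Union>i. - vset lev (vchild prec n i))"
proof -
  consider "vK n = 1" | "vK n = 2" | "vK n = 3" | "vK n = 4" | "vK n = 5"
    using n unfolding vleaf_def by linarith
  then show ?thesis
  proof cases
    case 1
    then show ?thesis by (auto simp: vset_def[of lev n] vchild_def)
  next
    case 3
    then show ?thesis by (auto simp: vset_def[of lev n] vchild_def if_distrib[of "vset lev"] split: if_splits)
  next
    case 4
    then show ?thesis by (auto simp: vset_def[of lev n] vchild_def)
  next
    case 5
    then show ?thesis by (auto simp: vset_def[of lev n] vchild_def)
  next
    case 2
    let ?C = "\<lambda>i. vset lev (vchild prec n i)"
    let ?q = "vq n" and ?u = "vu n" and ?v = "vv n"
    \<comment> \<open>First component 0 gives the tests on basic sets; every positive first
      component gives the same family of challenges.\<close>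
    have enc: "(\<exists>i. P i) \<longleftrightarrow> (\<exists>j. P (prod_encode (0, j))) \<or>
        (\<exists>a p u'. P (prod_encode (Suc a, prod_encode (p, u'))))" for P
    proof
      assume "\<exists>i. P i"
      then obtain i where i: "P i" by blast
      obtain a r where ar: "i = prod_encode (a, r)" by (metis prod_decode_inverse surj_pair)
      obtain p u' where "r = prod_encode (p, u')" by (metis prod_decode_inverse surj_pair)
      then show "(\<exists>j. P (prod_encode (0, j))) \<or> (\<exists>a p u'. P (prod_encode (Suc a, prod_encode (p, u'))))"
        using i ar by (cases a) auto
    qed blast
    have all: "(\<forall>a<lev ?q. P a) \<longleftrightarrow> (\<forall>p. prec p ?q \<longrightarrow> P (lev p))" for P
      using lev by metis
    have "z \<notin> level lev (vt n) ?q ?u ?v \<longleftrightarrow> (\<exists>i. z \<notin> ?C i)" for z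
    proof (cases "vt n = 0")
      case True
      have c0: "?C (prod_encode (0, j)) = (if meets x ?v j then UNIV else {z. \<not> meets z ?u j})" for j
        using 2 True by (simp add: vchild_def del: One_nat_def)
      have c1: "?C (prod_encode (Suc a, prod_encode (p, u'))) = (if prec p ?q \<and> refines u' ?u then
          (\<Union>w\<in>{w. refines w ?v}. {z. approx_le (lev p) x w z u'}) else UNIV)" for a p u'
        using 2 True by (simp add: vchild_def level_def del: One_nat_def)
      show ?thesis unfolding enc[of "\<lambda>i. z \<notin> ?C i"] c0 c1 True level_iff(1) all by auto
    next
      case False
      have c0: "?C (prod_encode (0, j)) = (if meets x ?u j then {z. meets z ?v j} else UNIV)" for j
        using 2 False by (simp add: vchild_def del: One_nat_def)
      have c1: "?C (prod_encode (Suc a, prod_encode (p, u'))) = (if prec p ?q \<and> refines u' ?u then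
          (\<Union>w\<in>{w. refines w ?v}. {z. approx_le (lev p) z w x u'}) else UNIV)" for a p u'
        using 2 False by (simp add: vchild_def level_def del: One_nat_def)
      show ?thesis unfolding enc[of "\<lambda>i. z \<notin> ?C i"] c0 c1 level_iff(2)[OF False] all by auto
    qed
    moreover have "vset lev n = - level lev (vt n) ?q ?u ?v" using 2 by (simp add: vset_def)
    ultimately show ?thesis by auto
  qed
qed

text \<open>Only the edge from kind 2 to kind 3 raises the kind, and it lowers the ordinal. Leaves
  and kind 1 carry the ordinal 0, since they name no level, and leaves count as kind 0.\<close>

lemma wf_vchild:
  fixes lev :: "nat \<Rightarrow> omega1"
  assumes lev: "\<And>p q. prec p q \<Longrightarrow> lev p < lev q"
  shows "wf {(vchild prec n i, n) | n i. \<not> vleaf n}"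
proof -
  let ?f = "\<lambda>n. (if vleaf n \<or> vK n = 1 then 0 else lev (vq n) :: omega1, if vleaf n then 0 else vK n)"
  have "wf (inv_image ({(a, b). a < b} <*lex*> less_than) ?f)"
    by (intro wf_inv_image wf_lex_prod wf wf_less_than)
  moreover have "{(vchild prec n i, n) | n i. \<not> vleaf n} \<subseteq> inv_image ({(a, b). a < b} <*lex*> less_than) ?f"
  proof clarify
    fix n i assume n: "\<not> vleaf n"
    have 0: "0 < a \<or> a = 0" for a :: omega1 using zero_le_omega1[of a] by (auto simp: le_less simp del: zero_le_omega1)
    consider "vK n = 1" | "vK n = 2" | "vK n = 3" | "vK n = 4" | "vK n = 5"
      using n unfolding vleaf_def by linarith
    then show "(vchild prec n i, n) \<in> inv_image ({(a, b). a < b} <*lex*> less_than) ?f"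
      by cases (use n 0 lev in \<open>auto simp: vchild_def vleaf_def full_def\<close>)
  qed
  ultimately show ?thesis by (rule wf_subset)
qed

text \<open>\<open>b\<close> is countable in the sense of the admissible set.\<close>

definition enumerated :: "omega1 \<Rightarrow> bool" where
  "enumerated b \<longleftrightarrow> (\<exists>Q lev. lev ` Q = {..<b} \<and> definable (\<lambda>\<nu> e. \<nu> 0 \<in> Q) \<and>
    definable (\<lambda>\<nu> e. \<nu> 0 \<in> Q \<and> \<nu> 1 \<in> Q \<and> lev (\<nu> 0) < lev (\<nu> 1)))"

lemma enumerated_osuc:
  assumes "enumerated b"
  shows "enumerated (osuc b)"
proof -
  obtain Q lev where Q: "lev ` Q = {..<b}" "definable (\<lambda>\<nu> e. \<nu> 0 \<in> Q)"
    "definable (\<lambda>\<nu> e. (\<lambda>p q. p \<in> Q \<and> q \<in> Q \<and> lev p < lev q) (\<nu> 0) (\<nu> 1))"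
    using assms unfolding enumerated_def by auto
  \<comment> \<open>The name 0 is given to \<open>b\<close>, and the old names are shifted up by
    one.\<close>
  let ?Q = "insert 0 (Suc ` Q)" and ?lev = "case_nat b lev"
  show ?thesis unfolding enumerated_def
  proof (intro exI conjI)
    show "?lev ` ?Q = {..<osuc b}"
      using Q(1) by (auto simp: less_osuc_iff image_image le_less)
    have "definable (\<lambda>\<nu> e. \<nu> 0 = 0 \<or> (\<exists>q. \<nu> 0 = Suc q \<and> q \<in> Q))"
      by (intro definable_intros definable_num1[OF Q(2)])
    moreover have "(n = 0 \<or> (\<exists>q. n = Suc q \<and> q \<in> Q)) \<longleftrightarrow> n \<in> ?Q" for n by auto
    ultimately show "definable (\<lambda>\<nu> e. \<nu> 0 \<in> ?Q)" by simp
    have "definable (\<lambda>\<nu> e. \<exists>p. \<nu> 0 = Suc p \<and> ((p \<in> Q \<and> \<nu> 1 = 0) \<or>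
        (\<exists>q. \<nu> 1 = Suc q \<and> p \<in> Q \<and> q \<in> Q \<and> lev p < lev q)))"
      by (intro definable_ex definable_conj definable_disj definable_num2[OF Q(3)] definable_num1[OF Q(2)] definable_neq num_term_Suc num_term_var num_term_const)
    moreover have "(\<exists>p. m = Suc p \<and> ((p \<in> Q \<and> n = 0) \<or> (\<exists>q. n = Suc q \<and> p \<in> Q \<and> q \<in> Q \<and> lev p < lev q))) \<longleftrightarrow>
        m \<in> ?Q \<and> n \<in> ?Q \<and> ?lev m < ?lev n" for m n
    proof -
      have "lev p < b" if "p \<in> Q" for p using Q(1) that by auto
      then show ?thesis by (cases m; cases n) (auto dest: less_asym)
    qed
    ultimately show "definable (\<lambda>\<nu> e. \<nu> 0 \<in> ?Q \<and> \<nu> 1 \<in> ?Q \<and> ?lev (\<nu> 0) < ?lev (\<nu> 1))" by simp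
  qed
qed

text \<open>The outermost quantifiers are universal, so it is the complements that have the form of
  a union of complements. Enumerating \<open>osuc b\<close> ensures that \<open>b\<close> itself has
  a name.\<close>

lemma code_ex:
  assumes "enumerated (osuc b)"
  shows "\<exists>\<gamma>. is_borel_code U \<gamma> (- dominated b x) \<and> fun_in \<A> c \<gamma>"
    and "\<exists>\<gamma>. is_borel_code U \<gamma> (- dominating b x) \<and> fun_in \<A> c \<gamma>"
proof -
  obtain Q lev0 where Q: "lev0 ` Q = {..<osuc b}"
    "definable (\<lambda>\<nu> e. (\<lambda>p q. p \<in> Q \<and> q \<in> Q \<and> lev0 p < lev0 q) (\<nu> 0) (\<nu> 1))"
    using assms unfolding enumerated_def by auto
  \<comment> \<open>Numbers that are not names receive level 0 and no predecessors under
    \<open>prec\<close>, so the equation for \<open>lev\<close> below holds for all numbers.\<close>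
  define lev where "lev q = (if q \<in> Q then lev0 q else 0)" for q
  define prec where "prec p q \<longleftrightarrow> p \<in> Q \<and> q \<in> Q \<and> lev0 p < lev0 q" for p q
  have prec: "definable (\<lambda>\<nu> e. prec (\<nu> 0) (\<nu> 1))" using Q(2) by (simp add: prec_def)
  have lev: "a < lev q \<longleftrightarrow> (\<exists>p. prec p q \<and> lev p = a)" for a q
  proof (cases "q \<in> Q")
    case True
    have "a \<in> lev0 ` Q" if "a < lev0 q"
      using that True Q(1) by (metis imageI lessThan_iff less_trans)
    then show ?thesis using True by (auto simp: lev_def prec_def)
  next
    case False
    then show ?thesis by (simp add: lev_def prec_def not_less)
  qed
  obtain q where q: "lev q = b" using Q(1) less_osuc[of b] by (auto simp: lev_def) (metis imageE lessThan_iff)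
  have code: "\<exists>\<gamma>. is_borel_code U \<gamma> (vset lev n) \<and> fun_in \<A> c \<gamma>" for n
  proof (intro exI conjI)
    show "is_borel_code U (tree_code vleaf vopen (vchild prec) n) (vset lev n)"
      by (rule is_borel_code_tree_code) (use vset_leaf vset_node[OF lev] wf_vchild[of prec lev] lev in blast)+
    show "fun_in \<A> c (tree_code vleaf vopen (vchild prec) n)"
    proof (rule fun_in_tree_code)
      show "definable (\<lambda>\<nu> e. vleaf (\<nu> 0))" unfolding vleaf_def by (intro definable_intros num_term_vertex_sel)
      show "definable (\<lambda>\<nu> e. vopen (\<nu> 0) (\<nu> 1))" unfolding vopen_def by (intro definable_intros num_term_vertex_sel definable_hit)
      show "num_term (\<lambda>\<nu> e. vchild prec (\<nu> 0) (\<nu> 1))" unfolding vchild_def full_def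
        by (intro num_term_If definable_conj definable_neq definable_refines definable_meets definable_num2[OF prec] num_term_vertex num_term_vertex_sel
            num_term_fst num_term_snd num_term_var num_term_const)
    qed
  qed
  have "- dominated b x = vset lev (vertex 5 0 q 0 0)"
    using q by (auto simp: dominated_def vset_def level_def)
  then show "\<exists>\<gamma>. is_borel_code U \<gamma> (- dominated b x) \<and> fun_in \<A> c \<gamma>" by (simp only: code)
  have "- dominating b x = vset lev (vertex 5 1 q 0 0)"
    using q by (auto simp: dominating_def vset_def level_def)
  then show "\<exists>\<gamma>. is_borel_code U \<gamma> (- dominating b x) \<and> fun_in \<A> c \<gamma>" by (simp only: code)
qed

text \<open>
  If no level below \<open>b\<close> is stable, then \<open>b\<close> is countable in the admissible set: an ordinal is named
  by a pair that leaves the comparison of \<open>x\<close> with itself right after it.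
\<close>

definition drops :: "omega1 \<Rightarrow> nat \<Rightarrow> bool" where
  "drops a q \<longleftrightarrow> (\<exists>k m. q = prod_encode (k, m) \<and> approx_le a x k x m \<and>
    (\<exists>k'. refines k' k \<and> (\<forall>m'. refines m' m \<longrightarrow> \<not> approx_le a x m' x k')))"

lemma drops_unique:
  assumes "drops a q" "drops b q"
  shows "a = b"
proof -
  have "\<not> a < b" if a: "drops a q" and b: "drops b q" for a b
  proof
    assume "a < b"
    obtain k m k' where *: "q = prod_encode (k, m)" "refines k' k" "\<And>m'. refines m' m \<Longrightarrow> \<not> approx_le a x m' x k'"
      using a unfolding drops_def by blast
    then have "approx_le b x k x m" using b unfolding drops_def by auto
    from approx_le_step[OF this \<open>a < b\<close> *(2)] show False using *(3) by blast
  qed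
  then show ?thesis using assms by (metis neqE)
qed

text \<open>Recursion along the ordinal \<open>f b\<close> collects all levels below
  \<open>b\<close> of the comparison of \<open>x\<close> with itself in one set \<open>t\<close>.
  With \<open>t\<close> as a parameter, \<open>drops\<close> becomes bounded, and so the set of
  names and their order are definable.\<close>

lemma enumerated_unstable:
  assumes f: "\<And>a. a \<le> b \<Longrightarrow> f a \<in> Vset \<A>"
    and mem_f: "\<And>a s. a \<le> b \<Longrightarrow> mem \<A> s (f a) \<longleftrightarrow> (\<exists>a'<a. s = f a')"
    and unstable: "\<And>a. a < b \<Longrightarrow> \<not> stable a x"
  shows "enumerated b"
proof -
  have irrefl: "\<not> mem \<A> s s" for s using wf_not_refl[OF wf_mem, of s] by simp
  have inj: "a = a'" if "f a = f a'" "a \<le> b" "a' \<le> b" for a a'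
    using that mem_f irrefl by (metis neqE)
  have mem_ff: "mem \<A> (f a) (f a') \<longleftrightarrow> a < a'" if "a \<le> b" "a' \<le> b" for a a'
    using mem_f[OF that(2)] inj[OF _ that(1)] that by (metis less_imp_le order.trans)
  have mem_b: "mem \<A> s (f b) \<longleftrightarrow> (\<exists>a<b. s = f a)" for s using mem_f by simp
  note fb = Vset_univ[OF f[OF order_refl]]
  \<comment> \<open>Membership is restricted to the ordinal \<open>f b\<close>, where it is
    transitive.\<close>
  let ?W = "\<lambda>s' s. mem \<A> s' s \<and> mem \<A> s' (f b) \<and> mem \<A> s (f b)"
  let ?\<Phi> = "\<lambda>s k m X. (\<forall>j. meets x k j \<longrightarrow> meets x m j) \<and>
    (\<forall>s'. mem \<A> s' s \<longrightarrow> (\<forall>k'. refines k' k \<longrightarrow> (\<exists>m'. refines m' m \<and> X s' m' k')))"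
  let ?S = "\<lambda>s k m. \<exists>a<b. s = f a \<and> approx_le a x k x m"
  have S_f: "?S (f a) k m \<longleftrightarrow> approx_le a x k x m" if "a < b" for a k m
    using that inj by (metis less_imp_le)
  have "\<exists>t\<in>Vset \<A>. \<forall>s k m. mem \<A> s (f b) \<longrightarrow> (holds t s k m \<longleftrightarrow> ?S s k m)"
  proof (rule set_recursion)
    show "f b \<in> Vset \<A>" by (rule f) simp
    show "definable (\<lambda>\<nu> e. ?W (e 0) (e 1))" by (intro definable_conj definable_mem basic_term_var basic_term_const fb)
    show "wfp ?W"
      using wf_subset[OF wf_mem, of "{(s', s). ?W s' s}"] by (auto simp: wfp_def)
    show "transp ?W"
    proof (rule transpI)
      fix s s' s'' assume *: "?W s s'" "?W s' s''"
      then obtain a a' a'' where "s = f a" "s' = f a'" "s'' = f a''" "a < b" "a' < b" "a'' < b"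
        using mem_b by blast
      then show "?W s s''" using * mem_ff by (metis less_imp_le less_trans)
    qed
    show "definable (\<lambda>\<nu> e. ?\<Phi> (e 0) (\<nu> 0) (\<nu> 1) (holds (e 1)))"
      by (intro definable_conj definable_all definable_ball definable_imp definable_ex definable_meets definable_refines definable_holds0 num_term_var basic_term_var)
    show "?\<Phi> s k m Y" if s: "mem \<A> s (f b)" and XY: "\<And>s' k' m'. mem \<A> s' (f b) \<Longrightarrow> ?W s' s \<Longrightarrow> X s' k' m' \<longleftrightarrow> Y s' k' m'"
      and X: "?\<Phi> s k m X" for s k m X Y
    proof -
      obtain a where a: "s = f a" "a < b" using s mem_b by blast
      have eq: "X s' k' m' \<longleftrightarrow> Y s' k' m'" if s': "mem \<A> s' s" for s' k' m'
      proof (rule XY)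
        obtain a' where "s' = f a'" "a' < a" using s' mem_f[of a s'] a by auto
        then show "mem \<A> s' (f b)" using mem_b a(2) less_trans by blast
        then show "?W s' s" using s s' by blast
      qed
      show ?thesis
      proof (intro conjI allI impI)
        show "meets x m j" if "meets x k j" for j using X that by blast
        fix s' k' assume "mem \<A> s' s" "refines k' k"
        then show "\<exists>m'. refines m' m \<and> Y s' m' k'" using X eq by blast
      qed
    qed
    show "?S s k m \<longleftrightarrow> ?\<Phi> s k m ?S" if s: "mem \<A> s (f b)" for s k m
    proof -
      obtain a where a: "s = f a" "a < b" using s mem_b by blast
      have "(\<forall>s'. mem \<A> s' (f a) \<longrightarrow> P s') \<longleftrightarrow> (\<forall>a'<a. P (f a'))" for P
        using mem_f[of a] a(2) by (auto simp: less_imp_le)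
      moreover have "?S (f a') k m \<longleftrightarrow> approx_le a' x k x m" if "a' < a" for a' k m
        using S_f that a(2) less_trans by blast
      ultimately show ?thesis
        unfolding a(1) S_f[OF a(2)] approx_le_iff[of a] by simp
    qed
  qed
  then obtain t where t: "t \<in> Vset \<A>" "\<And>a k m. a < b \<Longrightarrow> holds t (f a) k m \<longleftrightarrow> approx_le a x k x m"
    using S_f mem_b by metis
  define D where "D s q \<longleftrightarrow> (\<exists>k m. q = prod_encode (k, m) \<and> holds t s k m \<and>
    (\<exists>k'. refines k' k \<and> (\<forall>m'. refines m' m \<longrightarrow> \<not> holds t s m' k')))" for s q
  have D: "D (f a) q \<longleftrightarrow> drops a q" if "a < b" for a q
    unfolding D_def drops_def t(2)[OF that] ..
  have definable_D: "definable (\<lambda>\<nu> e. D (e i) (\<nu> j))" for i j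
    unfolding D_def
    by (intro definable_ex definable_conj definable_all definable_imp definable_not definable_neq definable_refines definable_holds0 num_term_prod_encode num_term_var basic_term_var
        basic_term_const Vset_univ t(1))
  let ?Q = "{q. \<exists>a<b. drops a q}"
  define lev where "lev q = (THE a. drops a q)" for q
  have lev: "lev q = a" if "drops a q" for a q
    unfolding lev_def using that drops_unique by blast
  show ?thesis unfolding enumerated_def
  proof (intro exI conjI)
    show "lev ` ?Q = {..<b}"
    proof (intro equalityI subsetI)
      fix a assume "a \<in> {..<b}"
      then have "a < b" by simp
      then obtain k m k' where "approx_le a x k x m" "refines k' k" "\<forall>m'. refines m' m \<longrightarrow> \<not> approx_le a x m' x k'"
        using unstable unfolding stable_def by blast
      then have "drops a (prod_encode (k, m))" unfolding drops_def by blast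
      then obtain q where "drops a q" by blast
      then show "a \<in> lev ` ?Q" using \<open>a < b\<close> lev by blast
    qed (use lev in auto)
    have "definable (\<lambda>\<nu> e. \<exists>s. mem \<A> s (f b) \<and> D s (\<nu> 0))"
      by (intro definable_bex definable_D basic_term_const fb)
    moreover have "(\<exists>s. mem \<A> s (f b) \<and> D s q) \<longleftrightarrow> q \<in> ?Q" for q
      using mem_b D by auto
    ultimately show "definable (\<lambda>\<nu> e. \<nu> 0 \<in> ?Q)" by simp
    \<comment> \<open>The order of two names is membership between the ordinals that they
      name.\<close>
    have "definable (\<lambda>\<nu> e. \<exists>s. mem \<A> s (f b) \<and> (D s (\<nu> 1) \<and> (\<exists>s'. mem \<A> s' s \<and> D s' (\<nu> 0))))"
      by (intro definable_bex definable_conj definable_D basic_term_const basic_term_var fb)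
    moreover have "(\<exists>s. mem \<A> s (f b) \<and> (D s q \<and> (\<exists>s'. mem \<A> s' s \<and> D s' p))) \<longleftrightarrow>
        p \<in> ?Q \<and> q \<in> ?Q \<and> lev p < lev q" for p q
    proof
      assume "\<exists>s. mem \<A> s (f b) \<and> (D s q \<and> (\<exists>s'. mem \<A> s' s \<and> D s' p))"
      then obtain s s' where s: "mem \<A> s (f b)" "D s q" "mem \<A> s' s" "D s' p" by blast
      then obtain a where a: "a < b" "s = f a" using mem_b by blast
      then obtain a' where a': "a' < a" "s' = f a'" using s(3) mem_f by (metis less_imp_le)
      then have "drops a q" "drops a' p" "a' < b" using s a D less_trans by blast+
      then show "p \<in> ?Q \<and> q \<in> ?Q \<and> lev p < lev q" using a a' lev by auto
    next
      assume *: "p \<in> ?Q \<and> q \<in> ?Q \<and> lev p < lev q"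
      then obtain a' a where "a' < b" "drops a' p" "a < b" "drops a q" by blast
      moreover from this * have "a' < a" using lev by simp
      ultimately show "\<exists>s. mem \<A> s (f b) \<and> (D s q \<and> (\<exists>s'. mem \<A> s' s \<and> D s' p))"
        using D mem_ff by (intro exI[of _ "f a"] conjI exI[of _ "f a'"]) auto
    qed
    ultimately show "definable (\<lambda>\<nu> e. \<nu> 0 \<in> ?Q \<and> \<nu> 1 \<in> ?Q \<and> lev (\<nu> 0) < lev (\<nu> 1))" by simp
  qed
qed

text \<open>An embedding of well-orders carries initial segments onto initial segments. In
  \<open>ord_height\<close> the strict predecessors of an ordinal are its members, because members
  of ordinals are ordinals; so the values of \<open>f\<close> are von Neumann ordinals of the
  structure.\<close>

lemma height_embedding:
  assumes "le_height \<alpha> \<A>"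
  shows "\<exists>f. \<forall>a<\<alpha>. f a \<in> Vset \<A> \<and> (\<forall>s. mem \<A> s (f a) \<longleftrightarrow> (\<exists>a'<a. s = f a'))"
proof -
  let ?r = "{(\<beta>, \<gamma>). \<beta> \<le> \<gamma> \<and> \<gamma> < \<alpha>}" and ?r' = "ord_height \<A>"
  obtain f where f: "embed ?r ?r' f"
    using assms unfolding le_height_def ordLeq_def by blast
  have bij: "bij_betw f (under ?r a) (under ?r' (f a))" if "a < \<alpha>" for a
    using f that unfolding embed_def Field_def by blast
  have under: "under ?r a = {..a}" if "a < \<alpha>" for a
    using that by (auto simp: under_def)
  have irrefl: "\<not> mem \<A> s s" for s using wf_not_refl[OF wf_mem, of s] by simp
  show ?thesis
  proof (intro exI allI impI conjI)
    fix a assume a: "a < \<alpha>"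
    have img: "f ` {..a} = under ?r' (f a)" and inj: "inj_on f {..a}"
      using bij[OF a] under[OF a] by (auto simp: bij_betw_def)
    have "f a \<in> under ?r' (f a)" using img by auto
    then have ord: "ordinal_elt \<A> (f a)" by (auto simp: under_def ord_height_def)
    then show "f a \<in> Vset \<A>" by (simp add: ordinal_elt_def trans_elt_def)
    fix s
    show "mem \<A> s (f a) \<longleftrightarrow> (\<exists>a'<a. s = f a')"
    proof
      assume s: "mem \<A> s (f a)"
      then have "ordinal_elt \<A> s" using ord unfolding ordinal_elt_def trans_elt_def by blast
      then have "s \<in> f ` {..a}" unfolding img using s ord by (auto simp: under_def ord_height_def)
      then show "\<exists>a'<a. s = f a'" using s irrefl by (metis atMost_iff imageE le_less)
    next
      assume "\<exists>a'<a. s = f a'"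
      then obtain a' where a': "a' < a" "s = f a'" by blast
      then have "s \<in> under ?r' (f a)" unfolding img[symmetric] by auto
      moreover have "s \<noteq> f a" using inj_onD[OF inj, of a' a] a' by (metis atMost_iff less_imp_le less_irrefl order_refl)
      ultimately show "mem \<A> s (f a)" by (auto simp: under_def ord_height_def)
    qed
  qed
qed

lemma invariant_Compl: "invariant act B \<Longrightarrow> invariant act (- B)"
  by (rule invariantI) (use invariantD in blast)

text \<open>The assumption on \<open>y\<close> helps once \<open>b\<close> is countable in the
  admissible set. If some \<open>a\<close> with \<open>osuc a < b\<close> is stable, the induction
  hypothesis at \<open>a\<close> and \<open>osuc a\<close> already settles all levels. Otherwise the
  only level below \<open>b\<close> that may be stable is an immediate predecessor of
  \<open>b\<close>. So either \<open>b\<close> or this predecessor is enumerated by the unstable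
  levels below it, and in the second case one successor step leads to \<open>b\<close>.\<close>

lemma dominated_dominating:
  assumes height: "le_height \<alpha> \<A>"
    and y: "\<And>B. invariant act B \<Longrightarrow> \<exists>\<gamma>. is_borel_code U \<gamma> B \<and> fun_in \<A> c \<gamma> \<Longrightarrow> x \<in> B \<longleftrightarrow> y \<in> B"
    and "b < \<alpha>"
  shows "y \<in> dominated b x \<and> y \<in> dominating b x"
  using assms(3)
proof (induction b rule: less_induct)
  case (less b)
  obtain f where f: "\<And>a. a < \<alpha> \<Longrightarrow> f a \<in> Vset \<A>"
    "\<And>a s. a < \<alpha> \<Longrightarrow> mem \<A> s (f a) \<longleftrightarrow> (\<exists>a'<a. s = f a')"
    using height_embedding[OF height] by blast
  have enum: "enumerated a" if "a \<le> b" "\<And>a'. a' < a \<Longrightarrow> \<not> stable a' x" for a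
    by (rule enumerated_unstable[of a f]) (use f that less.prems in \<open>auto dest: le_less_trans\<close>)
  have osuc_le: "osuc a \<le> b'" if "a < b'" for a b' :: omega1
    using that less_osuc_iff[of b' a] by (meson not_le)
  show ?case
  proof (cases "\<exists>a. osuc a < b \<and> stable a x")
    case True
    then obtain a where a: "osuc a < b" "stable a x" by blast
    then show ?thesis
      using stable_all[OF a(2), of y] less.IH[of a] less.IH[of "osuc a"] less.prems less_osuc[of a] by (meson less_trans)
  next
    case False
    have "enumerated b"
    proof (cases "\<exists>b0. b = osuc b0")
      case True
      then obtain b0 where b0: "b = osuc b0" by blast
      have "\<not> stable a x" if "a < b0" for a
        using False osuc_le[OF that] less_osuc[of b0] b0 le_less_trans by blast
      then show ?thesis unfolding b0 using enum[of b0] less_osuc[of b0] b0 by (intro enumerated_osuc) auto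
    next
      case no_pred: False
      have "\<not> stable a x" if "a < b" for a
        using False osuc_le[OF that] no_pred by (metis le_less)
      then show ?thesis using enum by simp
    qed
    then have "enumerated (osuc b)" by (rule enumerated_osuc)
    then show ?thesis
      using y[OF invariant_Compl[OF invariant_dominated] code_ex(1), of b]
        y[OF invariant_Compl[OF invariant_dominating] code_ex(2), of b] self_dominated self_dominating by blast
  qed
qed

end

theorem theorem4:
  fixes \<A> :: "('a, 'r) ustruct"
    and c :: "nat \<Rightarrow> 'a"
    and rG :: "nat \<Rightarrow> 'g::{polish_space, topological_group_add}"
    and V :: "nat \<Rightarrow> 'g set"
    and rX :: "nat \<Rightarrow> 'x::polish_space"
    and U :: "nat \<Rightarrow> 'x set"
    and act :: "'g \<Rightarrow> 'x \<Rightarrow> 'x"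
    and x y :: 'x
  assumes "admissible \<A>"
    and "omega_copy \<A> c"
    and "recursive_presentation rG" and "canonical_group_basis rG V"
    and "recursive_presentation rX" and "canonical_basis rX U"
    and "continuous_action act"
    and "group_codable \<A> c V"
    and "action_codable \<A> c V U act"
    and "point_codable \<A> c U x"
    and "\<forall>B. invariant act B \<and> (\<exists>\<gamma>. is_borel_code U \<gamma> B \<and> fun_in \<A> c \<gamma>) \<longrightarrow>
      (x \<in> B \<longleftrightarrow> y \<in> B)"
  shows "\<forall>\<alpha>::omega1. 1 \<le> \<alpha> \<and> le_height \<alpha> \<A> \<longrightarrow>
    (\<forall>B. invariant act B \<and> B \<in> Sigma0 \<alpha> \<union> Pi0 \<alpha> \<longrightarrow> (x \<in> B \<longleftrightarrow> y \<in> B))"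
proof (intro allI impI, elim conjE)
  fix \<alpha> :: omega1 and B
  assume \<alpha>: "1 \<le> \<alpha>" "le_height \<alpha> \<A>" and B: "invariant act B" "B \<in> Sigma0 \<alpha> \<union> Pi0 \<alpha>"
  obtain d l where dl: "inj c" "has_ext \<A> d (range c)"
    "has_ext \<A> l {p. \<exists>m n. m < n \<and> is_pair \<A> (c m) (c n) p}"
    using assms(2) unfolding omega_copy_def by blast
  have V0: "V 0 = UNIV" and V: "canonical_basis rG V \<or> canonical_basis rG (\<lambda>n. V (Suc n))"
    using assms(4) by (simp_all add: canonical_group_basis_def)
  have V_props: "open (V n) \<and> V n \<noteq> {}" for n
    using V
  proof
    assume *: "canonical_basis rG (\<lambda>n. V (Suc n))"
    show ?thesis
      using canonical_basis_open[OF *] canonical_basis_nonempty[OF *] V0 by (cases n) simp_all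
  qed (simp add: canonical_basis_open canonical_basis_nonempty)
  have V_basis: "\<exists>n. g \<in> V n \<and> V n \<subseteq> T" if T: "open T" "g \<in> T" for T g
    using V
  proof
    assume "canonical_basis rG (\<lambda>n. V (Suc n))"
    from canonical_basis_ex[OF assms(3) this T] show ?thesis by blast
  qed (rule canonical_basis_ex[OF assms(3) _ T])
  interpret coded_action \<A> c d l act V U x
  proof
    show "\<exists>n. p \<in> U n \<and> U n \<subseteq> T" if "open T" "p \<in> T" for T p
      by (rule canonical_basis_ex[OF assms(5,6) that])
  qed (use assms dl V0 V_props V_basis canonical_basis_open in blast)+
  have y: "y \<in> dominated b x \<and> y \<in> dominating b x" if "b < \<alpha>" for b
    by (rule dominated_dominating[OF \<alpha>(2) _ that]) (use assms(11) in blast)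
  \<comment> \<open>\<open>dominated\<close> and \<open>dominating\<close> are converse to each
    other, so the hypothesis is symmetric in the two points; this yields the reverse
    implication.\<close>
  then have x: "x \<in> dominated b y \<and> x \<in> dominating b y" if "b < \<alpha>" for b
    using that unfolding dominated_def dominating_def by blast
  have Sigma: "x \<in> B \<longleftrightarrow> y \<in> B" if "B \<in> Sigma0 \<alpha>" "invariant act B" for B
    using Sigma0_transfer[OF \<alpha>(1) that y] Sigma0_transfer[OF \<alpha>(1) that x] by blast
  show "x \<in> B \<longleftrightarrow> y \<in> B"
    using B(2)
  proof
    assume "B \<in> Pi0 \<alpha>"
    then obtain A where A: "B = - A" "A \<in> Sigma0 \<alpha>" by (auto simp: Pi0_def)
    then show ?thesis using Sigma[OF A(2)] invariant_Compl[OF B(1)] by simp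
  qed (rule Sigma[OF _ B(1)])
qed

end
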